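(* Let $1\le m\le n$ and let $F\in\mathrm{Exp}(\mathbb C^n,\mathbb C^m)$. If $F$ is Kazarnovskiĭ regular, then $F$ is regular, i.e. for every $G\in\overline{\mathcal B(F)}$ the zero set $V(G)\subseteq\mathbb C^n$ is either empty or of codimension $m$.
   Context: An exponential sum is a finite non-trivial $\mathbb C$-linear combination of exponentials $e^{i\langle z,\lambda\rangle}$, $\lambda\in\mathbb R^n$, where $\langle z,w\rangle=\sum_j z_j\overline{w_j}$; it is written $f(z)=\sum_{\lambda\in\mathrm{Sp} f}a(\lambda,f)e^{i\langle z,\lambda\rangle}$ with $\mathrm{Sp} f$ finite and $a(\lambda,f)\neq0$ for $\lambda\in \mathrm{Sp} f$. $\mathrm{Exp}(\mathbb C^n,\mathbb C^m)$ is the set of mappings $\mathbb C^n\to\mathbb C^m$ all of whose components are exponential sums. $\mathcal B(F)=\{F(\cdot+t): t\in\mathbb R^n\}$, and $\overline{\mathcal B(F)}$ is its closure in the topology of uniform convergence on every tube $\mathbb R^n+i\Omega'$ with $\Omega'\subset\mathbb R^n$ bounded (within the space of holomorphic almost periodic mappings $\mathbb C^n\to\mathbb C^m$). Kazarnovskiĭ regularity. For $F=(f_1,\ldots,f_m)\in\mathrm{Exp}(\mathbb C^n,\mathbb C^m)$ let $\Gamma_\ell\subset i\mathbb R^n$ be the convex hull of $\{-i\lambda:\lambda\in\mathrm{Sp} f_\ell\}$ and $\Gamma_F=\sum_{\ell=1}^m\Gamma_\ell$ (Minkowski sum). Every face $\Delta$ of $\Gamma_F$ ($\Gamma_F$ itself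 included) has a unique representation $\Delta=\sum_{\ell=1}^m\Delta_\ell$ with $\Delta_\ell$ a face of $\Gamma_\ell$. Put $h_{\Delta_\ell}(z)=\sup_{u\in\Delta_\ell}\operatorname{Re}\langle z,u\rangle$ and $f_\ell^\Delta(z)=\sum_{\lambda\in i\Delta_\ell\cap\mathrm{Sp} f_\ell}a(\lambda,f_\ell)e^{i\langle z,\lambda\rangle}$. $F$ is Kazarnovskiĭ regular if for every face $\Delta=\sum_\ell\Delta_\ell$ of $\Gamma_F$ with $\dim\Delta<m$ there is $\varepsilon=\varepsilon(F,\Delta)>0$ such that $\sum_{\ell=1}^m e^{-h_{\Delta_\ell}(z)}|f_\ell^\Delta(z)|\ge\varepsilon$ for every $z\in\mathbb C^n$. *)

theory Defs
  imports "HOL-Analysis.Analysis" "HOL-Library.Set_Algebras"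
begin

section \<open>Exponential sums\<close>

definition hprod :: "complex ^ 'n \<Rightarrow> complex ^ 'n \<Rightarrow> complex" where
  "hprod z w = (\<Sum>j\<in>UNIV. z $ j * cnj (w $ j))"

definition cvec :: "real ^ 'n \<Rightarrow> complex ^ 'n" where
  "cvec x = (\<chi> j. complex_of_real (x $ j))"

definition expo :: "real ^ 'n \<Rightarrow> complex ^ 'n \<Rightarrow> complex" where
  "expo l z = exp (\<i> * hprod z (cvec l))"

definition exp_rep :: "(real ^ 'n \<Rightarrow> complex) \<Rightarrow> (complex ^ 'n \<Rightarrow> complex) \<Rightarrow> bool" where
  "exp_rep c f \<longleftrightarrow> finite {l. c l \<noteq> 0} \<and> {l. c l \<noteq> 0} \<noteq> {} \<and>
     f = (\<lambda>z. \<Sum>l | c l \<noteq> 0. c l * expo l z)"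

definition exp_sum :: "(complex ^ 'n \<Rightarrow> complex) \<Rightarrow> bool" where
  "exp_sum f \<longleftrightarrow> (\<exists>c. exp_rep c f)"

text \<open>The coefficient \<open>a(l, f)\<close> is \<open>exp_coeff f l\<close>. The exponentials are linearly independent,
  so the description below is definite for exponential sums; see \<open>exp_coeff_eq\<close>.\<close>

definition exp_coeff :: "(complex ^ 'n \<Rightarrow> complex) \<Rightarrow> real ^ 'n \<Rightarrow> complex" where
  "exp_coeff f = (THE c. exp_rep c f)"

definition Sp :: "(complex ^ 'n \<Rightarrow> complex) \<Rightarrow> (real ^ 'n) set" where
  "Sp f = {l. exp_coeff f l \<noteq> 0}"

definition Exp_maps :: "(complex ^ 'n \<Rightarrow> complex ^ 'm) set" where
  "Exp_maps = {F. \<forall>k. exp_sum (\<lambda>z. F z $ k)}"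

lemma expo_add: "expo l (z + w) = expo l z * expo l w"
  by (simp add: expo_def hprod_def distrib_right distrib_left sum.distrib exp_add)

lemma expo_separates:
  assumes "l \<noteq> k"
  shows "\<exists>w. expo l w \<noteq> expo k w"
proof
  let ?w = "- \<i> *s cvec (l - k)"
  have e: "expo x ?w = exp (of_real ((l - k) \<bullet> x))" for x
    by (simp add: expo_def hprod_def cvec_def inner_vec_def sum_distrib_left sum_negf algebra_simps
          flip: sum_subtractf)
  have "(l - k) \<bullet> l - (l - k) \<bullet> k = (l - k) \<bullet> (l - k)"
    by (simp add: inner_diff_right)
  with assms have "(l - k) \<bullet> l \<noteq> (l - k) \<bullet> k"
    by (metis eq_iff_diff_eq_0 inner_eq_zero_iff)
  then show "expo l ?w \<noteq> expo k ?w"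
    unfolding e by (metis exp_inj_iff exp_of_real of_real_eq_iff)
qed

lemma expo_independent:
  assumes "finite S" "\<And>z. (\<Sum>l\<in>S. c l * expo l z) = 0" "l \<in> S"
  shows "c l = 0"
  using assms
proof (induction S arbitrary: c l rule: finite_induct)
  case empty
  then show ?case by simp
next
  case (insert k S)
  have z: "c l = 0" if l: "l \<in> S" for l
  proof -
    obtain w where w: "expo l w \<noteq> expo k w"
      using expo_separates[of l k] l insert.hyps by blast
    have "(\<Sum>l\<in>S. (c l * (expo l w - expo k w)) * expo l z) = 0" for z
    proof -
      have 1: "c k * expo k z + (\<Sum>l\<in>S. c l * expo l z) = 0"
        using insert.prems(1)[of z] insert.hyps by simp
      have 2: "c k * (expo k z * expo k w) + (\<Sum>l\<in>S. c l * (expo l z * expo l w)) = 0"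
        using insert.prems(1)[of "z + w"] insert.hyps by (simp add: expo_add)
      have "(\<Sum>l\<in>S. (c l * (expo l w - expo k w)) * expo l z)
          = (\<Sum>l\<in>S. c l * (expo l z * expo l w)) - expo k w * (\<Sum>l\<in>S. c l * expo l z)"
        by (simp add: sum_distrib_left sum_subtractf algebra_simps)
      also have "\<dots> = 0"
        using 1 2 by algebra
      finally show ?thesis .
    qed
    from insert.IH[OF this l] w show ?thesis by simp
  qed
  moreover have "c k = 0"
    using insert.prems(1)[of 0] insert.hyps z by (simp add: expo_def)
  ultimately show ?case using insert.prems(2) by auto
qed

lemma exp_rep_unique:
  assumes "exp_rep c f" "exp_rep d f"
  shows "c = d"
proof
  fix l
  let ?C = "{l. c l \<noteq> 0}" and ?D = "{l. d l \<noteq> 0}"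
  have fin: "finite (?C \<union> ?D)" using assms by (simp add: exp_rep_def)
  have "(\<Sum>l\<in>?C \<union> ?D. (c l - d l) * expo l z) = 0" for z
  proof -
    have "(\<Sum>l\<in>?C \<union> ?D. c l * expo l z) = f z"
      using assms(1) fin unfolding exp_rep_def by (auto intro!: sum.mono_neutral_right)
    moreover have "(\<Sum>l\<in>?C \<union> ?D. d l * expo l z) = f z"
      using assms(2) fin unfolding exp_rep_def by (auto intro!: sum.mono_neutral_right)
    ultimately show ?thesis by (simp add: left_diff_distrib sum_subtractf)
  qed
  from expo_independent[OF fin this, of l] show "c l = d l" by force
qed

lemma exp_coeff_eq: "exp_rep c f \<Longrightarrow> exp_coeff f = c"
  unfolding exp_coeff_def by (rule the_equality) (auto intro: exp_rep_unique)


section \<open>Almost periodic mappings and the closure of the set of translates\<close>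

definition clinear_map :: "(complex ^ 'n \<Rightarrow> complex ^ 'm) \<Rightarrow> bool" where
  "clinear_map D \<longleftrightarrow> Vector_Spaces.linear (*s) (*s) D"

text \<open>The real Frechet derivative is required to be complex linear. The derivative is taken at
  \<open>z\<close> in the whole space, so this is holomorphy only for open \<open>U\<close>.\<close>

definition holo_on :: "(complex ^ 'n \<Rightarrow> complex ^ 'm) \<Rightarrow> (complex ^ 'n) set \<Rightarrow> bool" where
  "holo_on F U \<longleftrightarrow> (\<forall>z\<in>U. \<exists>D. clinear_map D \<and> (F has_derivative D) (at z))"

definition tube :: "(real ^ 'n) set \<Rightarrow> (complex ^ 'n) set" where
  "tube Om = {z. (\<chi> j. Im (z $ j)) \<in> Om}"

text \<open>Holomorphic mappings that are almost periodic (in Bohr's sense) on each tube over a bounded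
  base: for each \<open>e\<close> the set of \<open>e\<close>-almost periods is relatively dense in the real space.\<close>

definition HAP :: "(complex ^ 'n \<Rightarrow> complex ^ 'm) set" where
  "HAP = {G. holo_on G UNIV \<and>
     (\<forall>Om e. bounded Om \<and> e > 0 \<longrightarrow>
        (\<exists>L>0. \<forall>x. \<exists>t\<in>cball x L. \<forall>z\<in>tube Om. norm (G (z + cvec t) - G z) < e))}"

definition tube_nbhd ::
  "(complex ^ 'n \<Rightarrow> complex ^ 'm) \<Rightarrow> (real ^ 'n) set \<Rightarrow> real \<Rightarrow> (complex ^ 'n \<Rightarrow> complex ^ 'm) set" where
  "tube_nbhd G Om e = {H \<in> HAP. \<forall>z\<in>tube Om. norm (H z - G z) < e}"

definition tube_topology :: "(complex ^ 'n \<Rightarrow> complex ^ 'm) topology" where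
  "tube_topology = topology (\<lambda>U. U \<subseteq> HAP \<and>
     (\<forall>G\<in>U. \<exists>Om e. bounded Om \<and> e > 0 \<and> tube_nbhd G Om e \<subseteq> U))"

definition translates :: "(complex ^ 'n \<Rightarrow> complex ^ 'm) \<Rightarrow> (complex ^ 'n \<Rightarrow> complex ^ 'm) set" where
  "translates F = {(\<lambda>z. F (z + cvec t)) | t. True}"

abbreviation translates_closure ::
    "(complex ^ 'n \<Rightarrow> complex ^ 'm) \<Rightarrow> (complex ^ 'n \<Rightarrow> complex ^ 'm) set" where
  "translates_closure F \<equiv> tube_topology closure_of translates F"

lemma tube_nbhd_mono: "Om \<subseteq> Om' \<Longrightarrow> e' \<le> e \<Longrightarrow> tube_nbhd G Om' e' \<subseteq> tube_nbhd G Om e"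
  unfolding tube_nbhd_def tube_def by force

lemma openin_tube_topology:
  "openin tube_topology U \<longleftrightarrow> U \<subseteq> HAP \<and>
     (\<forall>G\<in>U. \<exists>Om e. bounded Om \<and> e > 0 \<and> tube_nbhd G Om e \<subseteq> U)"
proof -
  let ?P = "\<lambda>U::(complex ^ 'n \<Rightarrow> complex ^ 'm) set. U \<subseteq> HAP \<and>
     (\<forall>G\<in>U. \<exists>Om e. bounded Om \<and> e > 0 \<and> tube_nbhd G Om e \<subseteq> U)"
  have int: "?P (S \<inter> T)" if PS: "?P S" and PT: "?P T" for S T
  proof (intro conjI ballI)
    show "S \<inter> T \<subseteq> HAP" using PS by blast
    fix G assume "G \<in> S \<inter> T"
    then have "G \<in> S" "G \<in> T" by auto
    obtain Om e where 1: "bounded Om" "e > 0" "tube_nbhd G Om e \<subseteq> S"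
      using PS \<open>G \<in> S\<close> by blast
    obtain Om' e' where 2: "bounded Om'" "e' > 0" "tube_nbhd G Om' e' \<subseteq> T"
      using PT \<open>G \<in> T\<close> by blast
    have "tube_nbhd G (Om \<union> Om') (min e e') \<subseteq> S" "tube_nbhd G (Om \<union> Om') (min e e') \<subseteq> T"
      using 1(3) 2(3) tube_nbhd_mono[of Om "Om \<union> Om'" "min e e'" e G]
        tube_nbhd_mono[of Om' "Om \<union> Om'" "min e e'" e' G] by simp_all
    then show "\<exists>Om e. bounded Om \<and> e > 0 \<and> tube_nbhd G Om e \<subseteq> S \<inter> T"
      using 1 2 by (intro exI[of _ "Om \<union> Om'"] exI[of _ "min e e'"]) simp
  qed
  have un: "?P (\<Union>K)" if PK: "\<forall>S\<in>K. ?P S" for K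
  proof (intro conjI ballI)
    show "\<Union>K \<subseteq> HAP" using PK by blast
    fix G assume "G \<in> \<Union>K"
    then obtain S where S: "S \<in> K" "G \<in> S" by blast
    from PK S(1) have "?P S" by (rule bspec)
    then obtain Om e where "bounded Om" "e > 0" "tube_nbhd G Om e \<subseteq> S"
      using S(2) by (elim conjE) (drule (1) bspec, elim exE conjE, rule that)
    moreover have "S \<subseteq> \<Union>K" using S(1) by (rule Union_upper)
    ultimately show "\<exists>Om e. bounded Om \<and> e > 0 \<and> tube_nbhd G Om e \<subseteq> \<Union>K"
      by (intro exI[of _ Om] exI[of _ e]) simp
  qed
  have "istopology ?P"
    unfolding istopology_def
    by (rule conjI; intro allI impI; (rule int | rule un); assumption)
  from topology_inverse'[OF this] show ?thesis
    unfolding tube_topology_def by (rule fun_cong)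
qed

lemma topspace_tube_topology: "topspace tube_topology = HAP"
proof -
  have "openin tube_topology HAP"
    unfolding openin_tube_topology
    by (intro conjI ballI subset_refl exI[of _ "{}"] exI[of _ "1::real"]) (auto simp: tube_nbhd_def)
  moreover have "topspace tube_topology \<subseteq> HAP"
    using openin_topspace openin_tube_topology by metis
  ultimately show ?thesis
    by (intro subset_antisym openin_subset)
qed

lemma in_closure_of_tube_topology:
  "G \<in> tube_topology closure_of S \<longleftrightarrow>
     G \<in> HAP \<and> (\<forall>Om e. bounded Om \<and> e > 0 \<longrightarrow> (\<exists>H\<in>S. H \<in> tube_nbhd G Om e))"
    (is "?L \<longleftrightarrow> ?R")
proof
  assume L: ?L
  show ?R
  proof (intro conjI allI impI)
    show "G \<in> HAP" using L by (simp add: in_closure_of topspace_tube_topology)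
    fix Om :: "(real ^ 'a) set" and e :: real
    assume "bounded Om \<and> e > 0"
    then have Om: "bounded Om" and e: "e > 0" by auto
    define U where "U = {H \<in> HAP. \<exists>d>0. \<forall>z\<in>tube Om. norm (H z - G z) \<le> e - d}"
    have "openin tube_topology U"
      unfolding openin_tube_topology
    proof (intro conjI ballI)
      show "U \<subseteq> HAP" by (auto simp: U_def)
      fix H assume "H \<in> U"
      then obtain d where d: "d > 0" "\<And>z. z \<in> tube Om \<Longrightarrow> norm (H z - G z) \<le> e - d"
        by (auto simp: U_def)
      have "tube_nbhd H Om (d/2) \<subseteq> U"
      proof
        fix K assume K: "K \<in> tube_nbhd H Om (d/2)"
        have "norm (K z - G z) \<le> e - d/2" if z: "z \<in> tube Om" for z
        proof -
          have "norm (K z - H z) < d/2" using K z by (auto simp: tube_nbhd_def)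
          then show ?thesis
            using d(2)[OF z] norm_triangle_ineq[of "K z - H z" "H z - G z"] by simp
        qed
        with K d(1) show "K \<in> U"
          unfolding U_def by (auto simp: tube_nbhd_def intro!: exI[of _ "d/2"])
      qed
      with Om d(1) show "\<exists>Om e. bounded Om \<and> e > 0 \<and> tube_nbhd H Om e \<subseteq> U"
        by (meson half_gt_zero)
    qed
    moreover have "G \<in> U"
      using \<open>G \<in> HAP\<close> e by (auto simp: U_def intro!: exI[of _ e])
    ultimately obtain H where "H \<in> S" "H \<in> U"
      using L unfolding in_closure_of by blast
    then show "\<exists>H\<in>S. H \<in> tube_nbhd G Om e"
      by (force simp: U_def tube_nbhd_def)
  qed
next
  assume R: ?R
  show ?L
    unfolding in_closure_of topspace_tube_topology
  proof (intro conjI allI impI)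
    show "G \<in> HAP" using R by simp
    fix U assume U: "G \<in> U \<and> openin tube_topology U"
    then obtain Om e where Om: "bounded Om" "e > 0" "tube_nbhd G Om e \<subseteq> U"
      unfolding openin_tube_topology by blast
    with R obtain H where "H \<in> S" "H \<in> tube_nbhd G Om e" by blast
    with Om show "\<exists>H. H \<in> S \<and> H \<in> U" by blast
  qed
qed


section \<open>Dimension of analytic sets\<close>

text \<open>\<open>a\<close> is a regular point of \<open>A\<close> at which \<open>A\<close> has complex dimension \<open>d\<close>: near \<open>a\<close> a
  biholomorphic change of coordinates carries \<open>A\<close> to a \<open>d\<close>-dimensional coordinate subspace
  (the set \<open>J\<close> indexes the free coordinates).\<close>

definition regular_point :: "(complex ^ 'n) set \<Rightarrow> nat \<Rightarrow> complex ^ 'n \<Rightarrow> bool" where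
  "regular_point A d a \<longleftrightarrow> a \<in> A \<and>
     (\<exists>U W \<phi> \<psi>. \<exists>J :: 'n set.
        open U \<and> a \<in> U \<and> open W \<and> homeomorphism U W \<phi> \<psi> \<and> holo_on \<phi> U \<and> holo_on \<psi> W \<and>
        card J = d \<and> \<phi> ` (A \<inter> U) = {w \<in> W. \<forall>j. j \<notin> J \<longrightarrow> w $ j = 0})"

text \<open>The dimension of an analytic set is the largest dimension at its regular points. These are
  dense in an analytic set, so for nonempty analytic \<open>A\<close> the maximum is over a nonempty set, and
  \<open>A\<close> has dimension at most \<open>CARD('n)\<close>.\<close>

definition analytic_dim :: "(complex ^ 'n) set \<Rightarrow> nat" where
  "analytic_dim A = Max {d. \<exists>a. regular_point A d a}"

definition analytic_codim :: "(complex ^ 'n) set \<Rightarrow> nat" where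
  "analytic_codim A = CARD('n) - analytic_dim A"

lemma finite_regular_dims: "finite {d. \<exists>a. regular_point (A :: (complex ^ 'n) set) d a}"
  by (rule finite_subset[of _ "{..CARD('n)}"]) (auto simp: regular_point_def card_mono)

definition zero_set :: "(complex ^ 'n \<Rightarrow> complex ^ 'm) \<Rightarrow> (complex ^ 'n) set" where
  "zero_set G = {z. G z = 0}"

definition regular_map :: "(complex ^ 'n \<Rightarrow> complex ^ 'm) \<Rightarrow> bool" where
  "regular_map F \<longleftrightarrow>
     (\<forall>G\<in>translates_closure F. zero_set G = {} \<or> analytic_codim (zero_set G) = CARD('m))"


section \<open>Kazarnovskii regularity\<close>

definition Newt :: "(complex ^ 'n \<Rightarrow> complex) \<Rightarrow> (complex ^ 'n) set" where
  "Newt f = convex hull ((\<lambda>l. - \<i> *s cvec l) ` Sp f)"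

text \<open>The sum is the Minkowski sum of sets.\<close>

definition Newt_map :: "(complex ^ 'n \<Rightarrow> complex ^ 'm) \<Rightarrow> (complex ^ 'n) set" where
  "Newt_map F = (\<Sum>k\<in>UNIV. Newt (\<lambda>z. F z $ k))"

definition supp_fun :: "(complex ^ 'n) set \<Rightarrow> complex ^ 'n \<Rightarrow> real" where
  "supp_fun D z = (SUP u\<in>D. Re (hprod z u))"

definition face_part :: "(complex ^ 'n \<Rightarrow> complex) \<Rightarrow> (complex ^ 'n) set \<Rightarrow> complex ^ 'n \<Rightarrow> complex" where
  "face_part f D z = (\<Sum>l \<in> {l \<in> Sp f. cvec l \<in> (\<lambda>u. \<i> *s u) ` D}. exp_coeff f l * expo l z)"

text \<open>Faces are nonempty. The summands \<open>D k\<close> are determined by \<open>\<Delta>\<close>, so quantifying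
  universally over them picks out the one decomposition.\<close>

definition kazarnovskii_regular :: "(complex ^ 'n \<Rightarrow> complex ^ 'm) \<Rightarrow> bool" where
  "kazarnovskii_regular F \<longleftrightarrow>
     (\<forall>\<Delta> D. \<Delta> face_of Newt_map F \<and> \<Delta> \<noteq> {} \<and> aff_dim \<Delta> < int CARD('m) \<and>
        (\<forall>k. D k face_of Newt (\<lambda>z. F z $ k)) \<and> \<Delta> = (\<Sum>k\<in>UNIV. D k) \<longrightarrow>
        (\<exists>\<epsilon>>0. \<forall>z. (\<Sum>k\<in>UNIV. exp (- supp_fun (D k) z) * norm (face_part (\<lambda>w. F w $ k) (D k) z)) \<ge> \<epsilon>))"

end

theory Submission
  imports Defs "HOL-Complex_Analysis.Residue_Theorem"
begin

text \<open>By compactness of the unit circle, a mapping \<open>G\<close> in the closure has the spectrum of \<open>F\<close>, with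
  coefficients changed by unimodular factors, and inherits Kazarnovskii's lower bounds for faces of
  dimension less than \<open>m\<close>.

  Suppose that \<open>V(G)\<close> has dimension greater than \<open>n - m\<close> at a regular point. Cut \<open>V(G)\<close> with a complexified
  real affine subspace of dimension \<open>m\<close> through that point, chosen transversal to the orthogonal
  complements of all faces of dimension at least \<open>m\<close>. The point remains a limit point of the
  intersection. A sequence in the intersection with unbounded imaginary parts would select a face
  whose truncated system is arbitrarily small, which the lower bounds exclude. So the imaginary
  parts are bounded, a strictly plurisubharmonic function has a maximum on the derived set of the
  intersection, and this contradicts the local maximum principle for analytic sets. That principle
  is obtained by eliminating one coordinate after the other until the values of a holomorphic
  function on the analytic set form the zero set of functions of one variable.

  The opposite inequality holds because fewer than \<open>n\<close> holomorphic functions of \<open>n\<close> variables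
  have no isolated common zero.\<close>

section \<open>Holomorphic functions of several variables\<close>

text \<open>Dimension theory enters only through one fact, that fewer than n holomorphic functions
  have no isolated common zero; it bounds the dimension at regular points from both sides. The slice
  is a complexified real subspace because its equations then fix inner products of the imaginary
  part with real vectors. It has at most n - m equations because the orthogonal complement of a face
  of dimension at least m has dimension at most n - m.

  Derived sets appear because an isolated point is a strict maximum of any function. Countability
  takes the place of a decomposition into irreducible components: isolated points are countable,
  while near a point that is isolated in its fibre but not in the analytic set a holomorphic
  function takes all nearby values.

  The face selected by a sequence with unbounded imaginary parts y is not the one exposed by a limit
  of y/|y|, since weights may separate at a slower rate than |y|. Hence weights are compared up to
  bounded distance along a subsequence.\<close>

lemma norm_vector_smult: "norm (c *s (v :: complex ^ 'n)) = norm c * norm v"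
  by (simp add: norm_vec_def L2_set_def norm_mult power_mult_distrib sum_distrib_left[symmetric]
      real_sqrt_mult)

lemma of_real_vector_smult: "complex_of_real r *s (v :: complex ^ 'n) = r *\<^sub>R v"
  unfolding vec_eq_iff vector_scaleR_component vector_smult_component
  by (simp add: scaleR_conv_of_real)

lemma continuous_on_vector_smult [continuous_intros]:
  fixes v :: "'a :: topological_space \<Rightarrow> complex ^ 'n"
  assumes "continuous_on S c" "continuous_on S v"
  shows "continuous_on S (\<lambda>x. c x *s v x)"
  unfolding vector_scalar_mult_def by (intro continuous_intros assms)

definition dird :: "(complex ^ 'n \<Rightarrow> complex) \<Rightarrow> complex ^ 'n \<Rightarrow> complex ^ 'n \<Rightarrow> complex" where
  "dird f v z = deriv (\<lambda>t. f (z + t *s v)) 0"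

text \<open>Holomorphy on open sets is continuity plus holomorphy on complex lines; the lemmas
  \<open>hol_has_derivative\<close> and \<open>holI_derivative\<close> compare it with the Frechet derivative in \<open>holo_on\<close>.\<close>

definition hol :: "(complex ^ 'n) set \<Rightarrow> (complex ^ 'n \<Rightarrow> complex) \<Rightarrow> bool" where
  "hol U f \<longleftrightarrow> continuous_on U f \<and>
     (\<forall>z\<in>U. \<forall>v. (\<lambda>t. f (z + t *s v)) field_differentiable at 0)"

lemma hol_continuous: "hol U f \<Longrightarrow> continuous_on U f"
  by (simp add: hol_def)

lemma hol_subset: "hol U f \<Longrightarrow> V \<subseteq> U \<Longrightarrow> hol V f"
  by (auto simp: hol_def intro: continuous_on_subset)

lemma hol_const [simp, intro]: "hol U (\<lambda>z. c)"
  by (simp add: hol_def)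

lemma hol_add: "hol U f \<Longrightarrow> hol U g \<Longrightarrow> hol U (\<lambda>z. f z + g z)"
  by (auto simp: hol_def intro!: continuous_intros field_differentiable_add)

lemma hol_diff: "hol U f \<Longrightarrow> hol U g \<Longrightarrow> hol U (\<lambda>z. f z - g z)"
  by (auto simp: hol_def intro!: continuous_intros field_differentiable_diff)

lemma hol_mult: "hol U f \<Longrightarrow> hol U g \<Longrightarrow> hol U (\<lambda>z. f z * g z)"
  by (auto simp: hol_def intro!: continuous_intros field_differentiable_mult)

lemma hol_power: "hol U f \<Longrightarrow> hol U (\<lambda>z. f z ^ k)"
  by (induction k) (auto intro: hol_mult)

lemma hol_sum: "(\<And>i. i \<in> I \<Longrightarrow> hol U (f i)) \<Longrightarrow> hol U (\<lambda>z. \<Sum>i\<in>I. f i z)"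
  by (induction I rule: infinite_finite_induct) (auto intro: hol_add)

lemma hol_divide:
  assumes "hol U f" "hol U g" "\<And>z. z \<in> U \<Longrightarrow> g z \<noteq> 0"
  shows "hol U (\<lambda>z. f z / g z)"
  using assms by (auto simp: hol_def intro!: continuous_intros field_differentiable_divide)

lemma hol_cong:
  assumes "hol U f" "open U" "\<And>z. z \<in> U \<Longrightarrow> f z = g z"
  shows "hol U g"
  unfolding hol_def
proof (intro conjI ballI allI)
  show "continuous_on U g"
    using assms by (metis continuous_on_cong hol_continuous)
  fix z v assume z: "z \<in> U"
  have "open ((\<lambda>t. z + t *s v) -` U)"
    by (intro open_vimage assms continuous_intros)
  moreover obtain D where "((\<lambda>t. f (z + t *s v)) has_field_derivative D) (at 0)"
    using assms(1) z by (auto simp: hol_def field_differentiable_def)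
  ultimately have "((\<lambda>t. g (z + t *s v)) has_field_derivative D) (at 0)"
    using has_field_derivative_transform_within_open[of "\<lambda>t. f (z + t *s v)" D 0 "(\<lambda>t. z + t *s v) -` U" "\<lambda>t. g (z + t *s v)"]
    z assms(3) by auto
  then show "(\<lambda>t. g (z + t *s v)) field_differentiable at 0"
    by (auto simp: field_differentiable_def)
qed

lemma open_line: "open U \<Longrightarrow> open {t. z + t *s (v :: complex ^ 'n) \<in> U}"
proof -
  assume "open U"
  then have "open ((\<lambda>t. z + t *s v) -` U)"
    by (intro open_vimage continuous_intros)
  then show ?thesis by (simp add: vimage_def)
qed

lemma hol_line_deriv:
  assumes "hol U f" "z + t *s v \<in> U"
  shows "((\<lambda>t. f (z + t *s v)) has_field_derivative dird f v (z + t *s v)) (at t)"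
proof -
  have "(\<lambda>s. f (z + t *s v + s *s v)) field_differentiable at 0"
    using assms by (simp add: hol_def)
  then have "((\<lambda>s. f (z + t *s v + s *s v)) has_field_derivative dird f v (z + t *s v)) (at 0)"
    unfolding dird_def by (simp add: field_differentiable_derivI)
  then have "((\<lambda>s. f (z + (t + s) *s v)) has_field_derivative dird f v (z + t *s v)) (at 0)"
    by (simp add: vector_sadd_rdistrib add.assoc)
  then show ?thesis
    using DERIV_shift[of "\<lambda>s. f (z + s *s v)" "dird f v (z + t *s v)" 0 t]
    by (simp add: add.commute)
qed

lemma hol_line:
  assumes "hol U f"
  shows "(\<lambda>t. f (z + t *s v)) holomorphic_on {t. z + t *s v \<in> U}"
  unfolding holomorphic_on_def field_differentiable_def
  using hol_line_deriv[OF assms, of z _ v] has_field_derivative_at_within by blast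

text \<open>Holomorphy is tested on complex lines, so it is enough that \<open>A\<close> sends each
  line to a line, with the direction given by \<open>L\<close>.\<close>

lemma hol_affine:
  assumes "hol U f" "continuous_on V A" "A ` V \<subseteq> U"
    and "\<And>z t v. z \<in> V \<Longrightarrow> A (z + t *s v) = A z + t *s L v"
  shows "hol V (\<lambda>z. f (A z))"
  using assms unfolding hol_def
  by (auto intro!: continuous_on_compose2[of U f])

lemma hol_component [intro]: "hol U (\<lambda>z. z $ i)"
  by (auto simp: hol_def intro!: continuous_intros derivative_intros field_differentiable_add
      field_differentiable_mult)

text \<open>Morera's theorem on each complex line, with the two integrations exchanged.\<close>

lemma hol_contour_integral:
  fixes B :: "complex ^ 'n \<Rightarrow> complex \<Rightarrow> complex"
  assumes U: "open U" and r: "r > 0"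
    and cB: "continuous_on (U \<times> sphere 0 r) (\<lambda>(w, t). B w t)"
    and hB: "\<And>t. t \<in> sphere 0 r \<Longrightarrow> hol U (\<lambda>w. B w t)"
  shows "hol U (\<lambda>w. contour_integral (circlepath 0 r) (B w))"
proof -
  let ?c = "circlepath 0 r"
  have img: "path_image ?c = sphere 0 r" using r by simp
  have eq: "contour_integral ?c (B w)
      = integral (cbox 0 1) (\<lambda>x. B w (?c x) * vector_derivative ?c (at x))" for w
    by (simp add: contour_integral_integral)
  have cint: "continuous_on U (\<lambda>w. contour_integral ?c (B w))"
    unfolding eq
  proof (rule integral_continuous_on_param)
    have "continuous_on (U \<times> cbox 0 1) (\<lambda>p. (fst p, ?c (snd p)))"
      by (auto intro!: continuous_intros simp: circlepath)
    moreover have "(\<lambda>p. (fst p, ?c (snd p))) ` (U \<times> cbox 0 1) \<subseteq> U \<times> sphere 0 r"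
      using img by (auto simp: path_image_def)
    ultimately have "continuous_on (U \<times> cbox 0 1)
        (\<lambda>p. (\<lambda>(w, t). B w t) (fst p, ?c (snd p)))"
      by (rule continuous_on_compose2[OF cB])
    then show "continuous_on (U \<times> cbox 0 1)
        (\<lambda>(w, x). B w (?c x) * vector_derivative ?c (at x))"
      by (auto simp: case_prod_unfold vector_derivative_circlepath intro!: continuous_intros)
  qed
  moreover have "(\<lambda>t. contour_integral ?c (B (z + t *s v))) field_differentiable at 0"
    if z: "z \<in> U" for z v
  proof -
    let ?S = "{t. z + t *s v \<in> U}"
    let ?f = "\<lambda>s. contour_integral ?c (B (z + s *s v))"
    have oS: "open ?S" by (rule open_line[OF U])
    have cf: "continuous_on ?S ?f"
      by (rule continuous_on_compose2[OF cint]) (auto intro!: continuous_intros)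
    have "?f analytic_on ?S"
    proof (rule Morera_triangle[OF cf oS], intro impI)
      fix a b c assume abc: "convex hull {a, b, c} \<subseteq> ?S"
      have swap: "contour_integral (linepath x y) ?f
          = contour_integral ?c (\<lambda>t. contour_integral (linepath x y) (\<lambda>s. B (z + s *s v) t))"
        and ciS: "(\<lambda>t. contour_integral (linepath x y) (\<lambda>s. B (z + s *s v) t)) contour_integrable_on ?c"
        if xy: "closed_segment x y \<subseteq> ?S" for x y
      proof -
        have c1: "continuous_on (closed_segment x y \<times> sphere 0 r) (\<lambda>p. (z + fst p *s v, snd p))"
          by (intro continuous_intros)
        have c2: "continuous_on (closed_segment x y \<times> sphere 0 r)
            (\<lambda>p. (\<lambda>(w, t). B w t) (z + fst p *s v, snd p))"
          by (rule continuous_on_compose2[OF cB c1]) (use xy in auto)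
        show "contour_integral (linepath x y) ?f
          = contour_integral ?c (\<lambda>t. contour_integral (linepath x y) (\<lambda>s. B (z + s *s v) t))"
          by (rule contour_integral_swap)
            (use c2 r in \<open>auto simp: case_prod_unfold vector_derivative_circlepath intro!: continuous_intros\<close>)
        have "continuous_on (sphere 0 r) (\<lambda>t. integral (cbox 0 1)
            (\<lambda>u. B (z + linepath x y u *s v) t * (y - x)))"
        proof (rule integral_continuous_on_param)
          have "continuous_on (sphere 0 r \<times> cbox 0 1)
            (\<lambda>p. (\<lambda>p. (\<lambda>(w, t). B w t) (z + fst p *s v, snd p)) (linepath x y (snd p), fst p))"
            by (rule continuous_on_compose2[OF c2])
              (auto intro!: continuous_intros simp: linepath_def closed_segment_def)
          then show "continuous_on (sphere 0 r \<times> cbox 0 1)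
              (\<lambda>(t, u). B (z + linepath x y u *s v) t * (y - x))"
            by (auto simp: case_prod_unfold intro!: continuous_intros)
        qed
        then show "(\<lambda>t. contour_integral (linepath x y) (\<lambda>s. B (z + s *s v) t)) contour_integrable_on ?c"
          using r by (intro contour_integrable_continuous_circlepath) (auto simp: contour_integral_integral)
      qed
      have seg: "closed_segment a b \<subseteq> ?S" "closed_segment b c \<subseteq> ?S" "closed_segment c a \<subseteq> ?S"
        using abc by (auto simp: segment_convex_hull intro!: subset_trans[OF hull_mono abc])
      have tri: "contour_integral (linepath a b) (\<lambda>s. B (z + s *s v) t)
          + contour_integral (linepath b c) (\<lambda>s. B (z + s *s v) t)
          + contour_integral (linepath c a) (\<lambda>s. B (z + s *s v) t) = 0"
        if t: "t \<in> sphere 0 r" for t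
      proof -
        have h: "(\<lambda>s. B (z + s *s v) t) holomorphic_on ?S"
          using hol_line[OF hB[OF t]] .
        then have "((\<lambda>s. B (z + s *s v) t) has_contour_integral 0)
            (linepath a b +++ linepath b c +++ linepath c a)"
          by (intro Cauchy_theorem_triangle holomorphic_on_subset[OF h abc])
        moreover have "(\<lambda>s. B (z + s *s v) t) contour_integrable_on linepath x y"
          if "closed_segment x y \<subseteq> ?S" for x y
          using that h by (intro contour_integrable_continuous_linepath)
            (meson continuous_on_subset holomorphic_on_imp_continuous_on)
        ultimately show ?thesis
          using seg by (auto dest!: contour_integral_unique simp: contour_integrable_joinI add.assoc)
      qed
      show "contour_integral (linepath a b) ?f + contour_integral (linepath b c) ?f
          + contour_integral (linepath c a) ?f = 0"
        unfolding swap[OF seg(1)] swap[OF seg(2)] swap[OF seg(3)]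
          contour_integral_add[OF ciS[OF seg(1)] ciS[OF seg(2)], symmetric]
          contour_integral_add[OF contour_integrable_add[OF ciS[OF seg(1)] ciS[OF seg(2)]]
            ciS[OF seg(3)], symmetric]
        using contour_integral_eq[of ?c _ "\<lambda>_. 0"] tri img r by simp
    qed
    then show ?thesis
      using z by (simp add: analytic_on_imp_differentiable_at)
  qed
  ultimately show ?thesis by (simp add: hol_def)
qed


lemma hol_local:
  assumes "\<And>z. z \<in> U \<Longrightarrow> \<exists>V. open V \<and> z \<in> V \<and> hol V f"
  shows "hol U f"
  unfolding hol_def
proof (intro conjI ballI allI)
  show "continuous_on U f"
  proof (rule continuous_at_imp_continuous_on, rule ballI)
    fix z assume "z \<in> U"
    then obtain V where "open V" "z \<in> V" "hol V f" using assms by blast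
    then show "isCont f z"
      using continuous_on_eq_continuous_at[of V f] hol_continuous[of V f] by simp
  qed
next
  fix z v assume "z \<in> U"
  then obtain V where "open V" "z \<in> V" "hol V f" using assms by blast
  then show "(\<lambda>t. f (z + t *s v)) field_differentiable at 0"
    by (simp add: hol_def)
qed

section \<open>Directional derivatives and second-order estimates\<close>

lemma dird_Cauchy:
  assumes "hol U f" "r > 0" "\<And>t. norm t \<le> r \<Longrightarrow> w + t *s v \<in> U"
  shows "dird f v w = 1 / (2 * of_real pi * \<i>) *
    contour_integral (circlepath 0 r) (\<lambda>t. f (w + t *s v) / t\<^sup>2)"
proof -
  let ?f = "\<lambda>t. f (w + t *s v)"
  have h: "?f holomorphic_on cball 0 r"
    by (rule holomorphic_on_subset[OF hol_line[OF assms(1)]]) (use assms(3) in auto)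
  have "(?f has_field_derivative (1 / (2 * of_real pi * \<i>) *
      contour_integral (circlepath 0 r) (\<lambda>u. ?f u / (u-0)^2))) (at 0)"
    by (rule Cauchy_derivative_integral_circlepath)
      (use h assms(2) in \<open>auto intro: holomorphic_on_imp_continuous_on holomorphic_on_subset\<close>)
  then show ?thesis unfolding dird_def by (simp add: DERIV_imp_deriv)
qed

text \<open>Cauchy's formula on a circle of one fixed radius, valid for all nearby base points,
  writes the derivative as a contour integral whose integrand is holomorphic in the base
  point.\<close>

lemma hol_dird:
  assumes U: "open U" and f: "hol U f"
  shows "hol U (dird f v)"
proof (rule hol_local)
  fix z0 assume "z0 \<in> U"
  then obtain R where R: "R > 0" "cball z0 R \<subseteq> U" using U open_contains_cball by blast
  \<comment> \<open>Then \<open>r * norm v\<close> is at most \<open>R / 2\<close>, so discs of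
    radius \<open>r\<close> in direction \<open>v\<close> about points of the half ball stay in
    \<open>cball z0 R\<close>; the added 1 covers \<open>v = 0\<close>.\<close>
  define r where "r = R / (2 * (norm v + 1))"
  have pos: "norm v + 1 > 0" by (simp add: add_nonneg_pos)
  have r: "r > 0" using R(1) pos by (simp add: r_def)
  have "r * (norm v + 1) = R / 2" using pos unfolding r_def by (simp add: field_simps)
  then have rv: "r * norm v \<le> R / 2" using r by (simp add: distrib_left)
  have in_U: "w + t *s v \<in> U" if "w \<in> ball z0 (R/2)" "norm t \<le> r" for w t
  proof -
    have "norm (t *s v) \<le> R / 2"
      using mult_right_mono[OF that(2), of "norm v"] rv by (simp add: norm_vector_smult)
    then have "dist z0 (w + t *s v) \<le> R"
      using that(1) norm_triangle_ineq4[of "z0 - w" "t *s v"] by (simp add: dist_norm algebra_simps)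
    then show ?thesis using R(2) by auto
  qed
  let ?V = "ball z0 (R/2)"
  have "hol ?V (\<lambda>w. contour_integral (circlepath 0 r) (\<lambda>t. f (w + t *s v) / t\<^sup>2))"
  proof (rule hol_contour_integral)
    show "continuous_on (?V \<times> sphere 0 r) (\<lambda>(w, t). f (w + t *s v) / t\<^sup>2)"
      unfolding case_prod_unfold using r
      by (intro continuous_intros continuous_on_compose2[OF hol_continuous[OF f]])
        (auto intro!: in_U)
    fix t :: complex assume t: "t \<in> sphere 0 r"
    show "hol ?V (\<lambda>w. f (w + t *s v) / t\<^sup>2)"
      by (rule hol_divide[OF hol_affine[OF f, where L = "\<lambda>x. x"]])
        (use t r in \<open>auto intro!: in_U continuous_intros\<close>)
  qed (use r in auto)
  then have "hol ?V (\<lambda>w. 1 / (2 * of_real pi * \<i>) *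
      contour_integral (circlepath 0 r) (\<lambda>t. f (w + t *s v) / t\<^sup>2))"
    by (intro hol_mult) auto
  then have "hol ?V (dird f v)"
    by (rule hol_cong) (use dird_Cauchy[OF f r] in_U in auto)
  then show "\<exists>V. open V \<and> z0 \<in> V \<and> hol V (dird f v)"
    using R(1) by (intro exI[of _ ?V]) auto
qed

text \<open>Taylor's formula of first order. The constant is \<open>fact 2 * M / (r/4)^2\<close>,
  Cauchy's bound for the second derivative on circles of radius \<open>r/4\<close> about points of
  the half disc.\<close>

lemma holomorphic_second_order_bound:
  assumes h: "g holomorphic_on ball 0 r" and r: "r > 0"
    and M: "\<And>t. norm t < r \<Longrightarrow> norm (g t) \<le> M" and t: "norm t < r / 2"
  shows "norm (g t - g 0 - t * deriv g 0) \<le> 32 * M / r\<^sup>2 * (norm t)\<^sup>2"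
proof -
  have der: "((deriv ^^ i) g has_field_derivative (deriv ^^ Suc i) g x) (at x within ball 0 (r/2))"
    if "x \<in> ball 0 (r/2)" for i x
  proof -
    have "(deriv ^^ i) g holomorphic_on ball 0 r"
      by (rule holomorphic_higher_deriv[OF h]) simp
    then have "((deriv ^^ i) g has_field_derivative deriv ((deriv ^^ i) g) x) (at x)"
      by (rule holomorphic_derivI) (use that r in auto)
    then show ?thesis by (simp add: has_field_derivative_at_within)
  qed
  have bd: "norm ((deriv ^^ Suc 1) g x) \<le> 32 * M / r\<^sup>2" if x: "x \<in> ball 0 (r/2)" for x
  proof -
    have sub: "cball x (r/4) \<subseteq> ball 0 r"
    proof
      fix y assume "y \<in> cball x (r/4)"
      then show "y \<in> ball 0 r"
        using x r norm_triangle_ineq[of x "y - x"] by (simp add: dist_norm norm_minus_commute)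
    qed
    have "norm ((deriv ^^ 2) g x) \<le> fact 2 * M / (r/4)^2"
    proof (rule Cauchy_inequality)
      show "g holomorphic_on ball x (r/4)"
        using sub by (intro holomorphic_on_subset[OF h]) auto
      show "continuous_on (cball x (r/4)) g"
        using sub holomorphic_on_imp_continuous_on holomorphic_on_subset[OF h] by blast
      show "norm (g y) \<le> M" if "norm (x - y) = r/4" for y
        using sub that by (intro M) (auto simp: dist_norm)
    qed (use r in auto)
    also have "fact 2 * M / (r/4)^2 = 32 * M / r\<^sup>2" by (simp add: power_divide fact_numeral)
    finally show ?thesis by (simp add: numeral_2_eq_2)
  qed
  have "norm ((deriv ^^ 0) g t - (\<Sum>i\<le>1. (deriv ^^ i) g 0 * (t - 0)^i / fact i))
      \<le> 32 * M / r\<^sup>2 * norm (t - 0) ^ Suc 1 / fact 1"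
    by (rule complex_Taylor[of "ball 0 (r/2)" 1 "\<lambda>i. (deriv ^^ i) g"])
      (use der bd r t in auto)
  then show ?thesis by (simp add: power2_eq_square algebra_simps)
qed

lemma dird_scale: 
  assumes "hol U f" "z \<in> U"
  shows "dird f (c *s v) z = c * dird f v z"
proof -
  have "((\<lambda>t. f (z + t *s v)) has_field_derivative dird f v z) (at (c * 0))"
    using hol_line_deriv[OF assms(1), of z 0 v] assms(2) by simp
  then have "((\<lambda>t. f (z + (c * t) *s v)) has_field_derivative dird f v z * c) (at 0)"
    by (rule DERIV_chain2[where f = "\<lambda>t. f (z + t *s v)" and g = "\<lambda>t. c * t"])
      (auto intro!: derivative_eq_intros)
  then have "((\<lambda>t. f (z + t *s (c *s v))) has_field_derivative c * dird f v z) (at 0)"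
    by (simp add: vector_smult_assoc mult.commute)
  then show ?thesis
    unfolding dird_def[of f "c *s v"] by (rule DERIV_imp_deriv)
qed

text \<open>Holomorphy on lines yields only Gateaux derivatives. An error bound uniform in the base
  point and in the direction is what makes them additive in \<open>v\<close> and turns them into a
  Frechet derivative.\<close>

lemma hol_second_order_bound:
  fixes f :: "complex ^ 'n \<Rightarrow> complex"
  assumes U: "open U" and f: "hol U f" and z: "z \<in> U"
  obtains R C where "R > 0" "C \<ge> 0" "ball z (2 * R) \<subseteq> U"
    "\<And>y v. y \<in> ball z R \<Longrightarrow> norm v < R \<Longrightarrow> norm (f (y + v) - f y - dird f v y) \<le> C * (norm v)\<^sup>2"
proof -
  obtain R0 where R0: "R0 > 0" "cball z R0 \<subseteq> U" using U z open_contains_cball by blast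
  have "compact (f ` cball z R0)"
    by (intro compact_continuous_image continuous_on_subset[OF hol_continuous[OF f] R0(2)] compact_cball)
  then have "bounded (f ` cball z R0)" by (rule compact_imp_bounded)
  then obtain M where M: "\<And>y. y \<in> cball z R0 \<Longrightarrow> norm (f y) \<le> M"
    unfolding bounded_iff by blast
  \<comment> \<open>Points \<open>y + t *s u\<close> with \<open>y\<close> in
    \<open>ball z R\<close>, \<open>norm u = 1\<close> and \<open>norm t < 2 * R\<close> stay within
    \<open>3 * R < R0\<close> of \<open>z\<close>. The one-variable bound on the disc of radius
    \<open>2 * R\<close> then covers \<open>norm v < R\<close>.\<close>
  define R where "R = R0 / 4"
  have M0: "M \<ge> 0" using order_trans[OF norm_ge_zero M[of z]] R0(1) by simp
  show thesis
  proof (rule that[of R "32 * M / (2 * R)\<^sup>2"])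
    show "R > 0" "ball z (2 * R) \<subseteq> U" using R0 by (auto simp: R_def)
    show "32 * M / (2 * R)\<^sup>2 \<ge> 0" using M0 by simp
    fix y v :: "complex ^ 'n" assume y: "y \<in> ball z R" and v: "norm v < R"
    show "norm (f (y + v) - f y - dird f v y) \<le> 32 * M / (2 * R)\<^sup>2 * (norm v)\<^sup>2"
    proof (cases "v = 0")
      case True
      then show ?thesis by (simp add: dird_def)
    next
      case False
      define u where "u = of_real (1 / norm v) *s v"
      have u: "norm u = 1" "v = of_real (norm v) *s u"
        using False by (auto simp: u_def norm_vector_smult vector_smult_assoc norm_divide)
      have in_c: "y + t *s u \<in> cball z R0" if "norm t < 2 * R" for t
        using y that u(1) R0(1) norm_triangle_ineq4[of "z - y" "t *s u"]
        by (simp add: dist_norm norm_vector_smult R_def algebra_simps)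
      have yU: "y \<in> U" using in_c[of 0] R0 by (auto simp: R_def)
      have "norm (f (y + of_real (norm v) *s u) - f (y + 0 *s u)
          - of_real (norm v) * deriv (\<lambda>t. f (y + t *s u)) 0)
          \<le> 32 * M / (2 * R)\<^sup>2 * (norm (complex_of_real (norm v)))\<^sup>2"
      proof (rule holomorphic_second_order_bound)
        show "(\<lambda>t. f (y + t *s u)) holomorphic_on ball 0 (2 * R)"
          by (rule holomorphic_on_subset[OF hol_line[OF f]]) (use in_c R0(2) in auto)
        show "norm (f (y + t *s u)) \<le> M" if "norm t < 2 * R" for t
          by (rule M[OF in_c[OF that]])
      qed (use v R0 in \<open>auto simp: R_def\<close>)
      moreover have "of_real (norm v) * deriv (\<lambda>t. f (y + t *s u)) 0 = dird f v y"
        using dird_scale[OF f yU, of "of_real (norm v)" u] unfolding u(2)[symmetric] dird_def[of f u] by simp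
      ultimately show ?thesis unfolding u(2)[symmetric] by simp
    qed
  qed
qed

text \<open>The increment along \<open>t *s (v + w)\<close> passes through
  \<open>z + t *s v\<close>. The second leg starts at a moving point, where the uniform bound and
  the continuity of \<open>dird f w\<close> identify its slope.\<close>

lemma dird_add:
  fixes f :: "complex ^ 'n \<Rightarrow> complex"
  assumes U: "open U" and f: "hol U f" and z: "z \<in> U"
  shows "dird f (v + w) z = dird f v z + dird f w z"
proof -
  obtain R C where RC: "R > 0" "C \<ge> 0" "ball z (2 * R) \<subseteq> U"
    "\<And>y v. y \<in> ball z R \<Longrightarrow> norm v < R \<Longrightarrow> norm (f (y + v) - f y - dird f v y) \<le> C * (norm v)\<^sup>2"
    using hol_second_order_bound[OF assms] by metis
  let ?q = "\<lambda>t. (f (z + t *s (v + w)) - f (z + t *s v)) / t"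
  have lim_line: "(\<lambda>t. (f (z + t *s x) - f z) / t) \<midarrow>0\<rightarrow> dird f x z" for x
    using hol_line_deriv[OF f, of z 0 x] z by (simp add: DERIV_def)
  have "isCont (dird f w) z"
    using hol_continuous[OF hol_dird[OF U f]] U z by (simp add: continuous_on_eq_continuous_at)
  moreover have c0: "((\<lambda>t. z + t *s v) \<longlongrightarrow> z) (at 0)"
  proof -
    have "continuous_on UNIV (\<lambda>t. z + t *s v)" by (intro continuous_intros)
    then have "isCont (\<lambda>t. z + t *s v) 0" by (simp add: continuous_on_eq_continuous_at)
    then show ?thesis by (simp add: isCont_def)
  qed
  ultimately have 1: "((\<lambda>t. dird f w (z + t *s v)) \<longlongrightarrow> dird f w z) (at 0)"
    by (rule isCont_tendsto_compose)
  have c1: "((\<lambda>t. norm (t *s w)) \<longlongrightarrow> 0) (at 0)"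
    unfolding norm_vector_smult by (auto intro!: tendsto_eq_intros)
  have "\<forall>\<^sub>F t in at 0. z + t *s v \<in> ball z R"
    using c0 RC(1) by (auto simp: tendsto_iff dist_commute)
  moreover have "\<forall>\<^sub>F t in at 0. norm (t *s w) < R"
    using order_tendstoD(2)[OF c1 RC(1)] .
  moreover have "\<forall>\<^sub>F t in at (0::complex). t \<noteq> 0"
    by (simp add: eventually_at_filter)
  ultimately have "\<forall>\<^sub>F t in at 0. norm (?q t - dird f w (z + t *s v)) \<le> C * (norm w)\<^sup>2 * norm t"
  proof eventually_elim
    case (elim t)
    have zt: "z + t *s v \<in> U" using elim(1) RC(1,3) by (auto simp: subset_iff)
    have "norm (f (z + t *s v + t *s w) - f (z + t *s v) - dird f (t *s w) (z + t *s v))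
        \<le> C * (norm (t *s w))\<^sup>2"
      using RC(4) elim by blast
    then have "norm (f (z + t *s (v + w)) - f (z + t *s v) - t * dird f w (z + t *s v))
        \<le> norm t * (C * (norm w)\<^sup>2 * norm t)"
      by (simp add: dird_scale[OF f zt] vector_add_ldistrib add.assoc norm_vector_smult power2_eq_square algebra_simps)
    moreover have "?q t - dird f w (z + t *s v)
        = (f (z + t *s (v + w)) - f (z + t *s v) - t * dird f w (z + t *s v)) / t"
      using elim by (simp add: field_simps)
    ultimately show ?case
      using elim by (simp add: norm_divide field_simps)
  qed
  then have "((\<lambda>t. ?q t - dird f w (z + t *s v)) \<longlongrightarrow> 0) (at 0)"
    by (rule Lim_null_comparison) (auto intro!: tendsto_eq_intros)
  from tendsto_add[OF this 1] have "(?q \<longlongrightarrow> dird f w z) (at 0)" by simp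
  from tendsto_add[OF this lim_line[of v]]
  have "((\<lambda>t. ?q t + (f (z + t *s v) - f z) / t) \<longlongrightarrow> dird f w z + dird f v z) (at 0)" .
  moreover have "?q t + (f (z + t *s v) - f z) / t = (f (z + t *s (v + w)) - f z) / t" for t
    by (simp add: diff_divide_distrib)
  ultimately show ?thesis
    using tendsto_unique[OF _ lim_line[of "v + w"]] by (simp add: add.commute)
qed

section \<open>Complex linearity and the Frechet derivative\<close>

lemma linear_dird:
  assumes "open U" "hol U f" "z \<in> U"
  shows "linear (\<lambda>v. dird f v z)"
  by (rule linearI) (use dird_add[OF assms] dird_scale[OF assms(2,3)] in
    \<open>auto simp: of_real_vector_smult[symmetric] scaleR_conv_of_real\<close>)

lemma hol_has_derivative:
  fixes f :: "complex ^ 'n \<Rightarrow> complex"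
  assumes U: "open U" and f: "hol U f" and z: "z \<in> U"
  shows "(f has_derivative (\<lambda>v. dird f v z)) (at z)"
proof -
  obtain R C where RC: "R > 0" "C \<ge> 0"
    "\<And>y v. y \<in> ball z R \<Longrightarrow> norm v < R \<Longrightarrow> norm (f (y + v) - f y - dird f v y) \<le> C * (norm v)\<^sup>2"
    using hol_second_order_bound[OF assms] by metis
  have "\<forall>\<^sub>F v in at 0. norm v < R"
    using RC(1) by (auto simp: eventually_at dist_norm)
  then have "\<forall>\<^sub>F v in at 0. norm (norm (f (z + v) - f z - dird f v z) / norm v) \<le> C * norm v"
  proof eventually_elim
    case (elim v)
    then have "norm (f (z + v) - f z - dird f v z) \<le> C * norm v * norm v"
      using RC(3)[of z v] RC(1) by (simp add: power2_eq_square mult.assoc)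
    then show ?case
      by (cases "v = 0") (auto simp: divide_le_eq)
  qed
  then have "((\<lambda>v. norm (f (z + v) - f z - dird f v z) / norm v) \<longlongrightarrow> 0) (at 0)"
    by (rule Lim_null_comparison) (auto intro!: tendsto_eq_intros)
  then show ?thesis
    unfolding has_derivative_at using linear_dird[OF assms]
    by (simp add: linear_conv_bounded_linear)
qed

lemma holI_derivative:
  assumes "\<And>z. z \<in> U \<Longrightarrow> \<exists>D. (f has_derivative D) (at z) \<and> (\<forall>c v. D (c *s v) = c * D v)"
  shows "hol U f"
  unfolding hol_def
proof (intro conjI ballI allI)
  show "continuous_on U f"
    by (rule continuous_at_imp_continuous_on) (use assms has_derivative_continuous in blast)
  fix z v assume "z \<in> U"
  then obtain D where D: "(f has_derivative D) (at z)" "\<And>c v. D (c *s v) = c * D v"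
    using assms by blast
  have "((\<lambda>t. z + t *s v) has_derivative (\<lambda>t. t *s v)) (at 0)"
  proof -
    have "bounded_linear (\<lambda>t. t *s v)"
      by (rule bounded_linear_intro[where K = "norm v"])
        (auto simp: vector_sadd_rdistrib norm_vector_smult vec_eq_iff)
    then have "((\<lambda>t. t *s v) has_derivative (\<lambda>t. t *s v)) (at 0)"
      by (rule bounded_linear_imp_has_derivative)
    from has_derivative_add[OF has_derivative_const[of z] this] show ?thesis by simp
  qed
  moreover have "(f has_derivative D) (at (z + 0 *s v))" using D(1) by simp
  ultimately have "((\<lambda>t. f (z + t *s v)) has_derivative (\<lambda>t. D (t *s v))) (at 0)"
    by (rule has_derivative_compose)
  then have "((\<lambda>t. f (z + t *s v)) has_derivative ((*) (D v))) (at 0)"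
    by (simp add: D(2) mult.commute[of _ "D v"] cong: if_cong)
  then show "(\<lambda>t. f (z + t *s v)) field_differentiable at 0"
    unfolding field_differentiable_def has_field_derivative_def by blast
qed

lemma clinear_map_scale:
  assumes "clinear_map D"
  shows "D (c *s v) = c *s D v"
proof -
  interpret Vector_Spaces.linear "(*s)" "(*s)" D
    using assms by (simp add: clinear_map_def)
  show ?thesis by (rule scale)
qed

lemma hol_compose:
  fixes f :: "complex ^ 'n \<Rightarrow> complex" and \<psi> :: "complex ^ 'k \<Rightarrow> complex ^ 'n"
  assumes "open U" "hol U f" "holo_on \<psi> W" "\<psi> ` W \<subseteq> U"
  shows "hol W (\<lambda>w. f (\<psi> w))"
proof (rule holI_derivative)
  fix w assume w: "w \<in> W"
  then obtain D where D: "clinear_map D" "(\<psi> has_derivative D) (at w)"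
    using assms(3) by (auto simp: holo_on_def)
  have w': "\<psi> w \<in> U" using assms(4) w by auto
  have "((\<lambda>w. f (\<psi> w)) has_derivative (\<lambda>v. dird f (D v) (\<psi> w))) (at w)"
    by (rule has_derivative_compose[OF D(2) hol_has_derivative[OF assms(1,2) w']])
  moreover have "D (c *s v) = c *s D v" for c v
    by (rule clinear_map_scale[OF D(1)])
  ultimately show "\<exists>E. ((\<lambda>w. f (\<psi> w)) has_derivative E) (at w) \<and> (\<forall>c v. E (c *s v) = c * E v)"
    using dird_scale[OF assms(2) w'] by auto
qed

lemma holo_on_components:
  assumes "open U" "\<And>i. hol U (\<lambda>z. F z $ i)"
  shows "holo_on F U"
  unfolding holo_on_def
proof
  fix z assume z: "z \<in> U"
  let ?D = "\<lambda>v. \<chi> i. dird (\<lambda>z. F z $ i) v z"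
  have "(F has_derivative ?D) (at z)"
    unfolding has_derivative_componentwise_within[of F]
  proof
    fix b :: "complex ^ 'b" assume "b \<in> Basis"
    then obtain i c where b: "b = axis i c" by (auto simp: Basis_vec_def)
    show "((\<lambda>x. F x \<bullet> b) has_derivative (\<lambda>x. ?D x \<bullet> b)) (at z)"
      unfolding b inner_axis vec_lambda_beta
      by (intro has_derivative_inner_left hol_has_derivative[OF assms z])
  qed
  moreover have "clinear_map ?D"
    unfolding clinear_map_def
    by unfold_locales (auto simp: vec_eq_iff dird_add[OF assms z] dird_scale[OF assms(2) z] algebra_simps)
  ultimately show "\<exists>D. clinear_map D \<and> (F has_derivative D) (at z)" by blast
qed

lemma holo_on_hol_component:
  assumes "holo_on F U"
  shows "hol U (\<lambda>z. F z $ i)"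
proof (rule holI_derivative)
  fix z assume "z \<in> U"
  then obtain D where D: "clinear_map D" "(F has_derivative D) (at z)"
    using assms by (auto simp: holo_on_def)
  moreover have "((\<lambda>z. F z $ i) has_derivative (\<lambda>v. D v $ i)) (at z)"
    using D(2) by (rule bounded_linear.has_derivative[OF bounded_linear_vec_nth])
  ultimately show "\<exists>D. ((\<lambda>z. F z $ i) has_derivative D) (at z) \<and> (\<forall>c v. D (c *s v) = c * D v)"
    by (intro exI[of _ "\<lambda>v. D v $ i"]) (auto simp: clinear_map_scale)
qed

section \<open>Charts, regular points and the rank theorem\<close>

definition chart :: "(complex ^ 'n) set \<Rightarrow> (complex ^ 'n) set \<Rightarrow>
    (complex ^ 'n \<Rightarrow> complex ^ 'n) \<Rightarrow> (complex ^ 'n \<Rightarrow> complex ^ 'n) \<Rightarrow> bool" where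
  "chart U W \<phi> \<psi> \<longleftrightarrow> open U \<and> open W \<and> homeomorphism U W \<phi> \<psi> \<and> holo_on \<phi> U \<and> holo_on \<psi> W"

lemma chart_id: "open U \<Longrightarrow> chart U U (\<lambda>z. z) (\<lambda>z. z)"
  unfolding chart_def by (auto intro!: homeomorphismI holo_on_components hol_component)

lemma holo_on_subset: "holo_on F U \<Longrightarrow> V \<subseteq> U \<Longrightarrow> holo_on F V"
  by (auto simp: holo_on_def)

lemma holo_on_compose:
  assumes "open V" "open U" "holo_on F U" "holo_on G V" "G ` V \<subseteq> U"
  shows "holo_on (\<lambda>z. F (G z)) V"
  by (rule holo_on_components[OF assms(1)])
    (rule hol_compose[OF assms(2) holo_on_hol_component[OF assms(3)] assms(4,5)])

lemma chart_open_image: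
  assumes "chart U W \<phi> \<psi>" "W1 \<subseteq> W" "open W1"
  shows "open (\<psi> ` W1)" "\<psi> ` W1 = {z \<in> U. \<phi> z \<in> W1}"
proof -
  show *: "\<psi> ` W1 = {z \<in> U. \<phi> z \<in> W1}"
    using assms unfolding chart_def homeomorphism_def by force
  have "continuous_on U \<phi>" "open U" using assms by (auto simp: chart_def homeomorphism_def)
  then have "open (\<phi> -` W1 \<inter> U)" using assms(3) continuous_on_open_vimage by blast
  then show "open (\<psi> ` W1)" unfolding * by (simp add: vimage_def Int_def conj_commute)
qed

lemma chart_compose:
  assumes c: "chart U W \<phi> \<psi>" and d: "chart W1 W2 \<kappa> \<mu>" and sub: "W1 \<subseteq> W"
  shows "chart (\<psi> ` W1) W2 (\<lambda>z. \<kappa> (\<phi> z)) (\<lambda>w. \<psi> (\<mu> w))"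
proof -
  have oW1: "open W1" using d by (simp add: chart_def)
  note im = chart_open_image[OF c sub oW1]
  have h1: "homeomorphism (\<psi> ` W1) W1 \<phi> \<psi>"
  proof (rule homeomorphism_of_subsets[of U W])
    show "homeomorphism U W \<phi> \<psi>" using c by (simp add: chart_def)
    then have "\<phi> (\<psi> w) = w" if "w \<in> W1" for w
      using that sub by (auto simp: homeomorphism_def)
    then show "\<phi> ` \<psi> ` W1 = W1" by (force simp: image_image)
  qed (use im sub in auto)
  have h2: "homeomorphism W1 W2 \<kappa> \<mu>" using d by (simp add: chart_def)
  have "homeomorphism (\<psi> ` W1) W2 (\<lambda>z. \<kappa> (\<phi> z)) (\<lambda>w. \<psi> (\<mu> w))"
    using homeomorphism_compose[OF h1 h2] by (simp add: o_def)
  moreover have "holo_on (\<lambda>z. \<kappa> (\<phi> z)) (\<psi> ` W1)"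
    by (rule holo_on_compose[of _ W1])
      (use c d im in \<open>auto simp: chart_def intro: holo_on_subset[of \<phi> U]\<close>)
  moreover have "holo_on (\<lambda>w. \<psi> (\<mu> w)) W2"
    by (rule holo_on_compose[of _ W])
      (use c d sub in \<open>auto simp: chart_def homeomorphism_def\<close>)
  ultimately show ?thesis using d im by (simp add: chart_def)
qed

lemma dird_scaleR:
  assumes "hol U f" "z \<in> U"
  shows "dird f (r *\<^sub>R v) z = r *\<^sub>R dird f v z"
  using dird_scale[OF assms, of "of_real r" v]
  by (simp add: of_real_vector_smult scaleR_conv_of_real)

text \<open>The inverse function theorem is real; complex linearity of the derivative of the inverse
  map has to be recovered algebraically.\<close>

lemma clinear_map_inv:
  assumes "clinear_map f" "bij f"
  shows "clinear_map (inv f)"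
proof -
  interpret Vector_Spaces.linear "(*s)" "(*s)" f using assms(1) by (simp add: clinear_map_def)
  have e: "f (inv f y) = y" for y using assms(2) by (simp add: bij_is_surj surj_f_inv_f)
  have eq: "inv f x = y" if "f y = x" for x y
    using that assms(2) by (metis bij_inv_eq_iff)
  show ?thesis
    unfolding clinear_map_def by unfold_locales (auto intro!: eq simp: add scale e)
qed

text \<open>The derivative of the new coordinate map differs from the identity only in row
  \<open>l\<close>, whose diagonal entry at \<open>w0\<close> is the nonzero partial
  derivative.\<close>

lemma chart_replace_coordinate:
  fixes u :: "complex ^ 'n \<Rightarrow> complex"
  assumes W: "open W" and u: "hol W u" and w0: "w0 \<in> W" and nz: "dird u (axis l 1) w0 \<noteq> 0"
  obtains W1 W2 \<mu> where "w0 \<in> W1" "W1 \<subseteq> W"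
    "chart W1 W2 (\<lambda>w. \<chi> i. if i = l then u w else w $ i) \<mu>"
proof -
  let ?k = "\<lambda>w. \<chi> i. if i = l then u w else w $ i"
  define D where "D w = (\<lambda>v. \<chi> i. if i = l then dird u v w else v $ i)" for w
  have kh: "hol W (\<lambda>w. ?k w $ i)" for i
    by (cases "i = l") (auto intro: u)
  have kholo: "holo_on ?k W" by (rule holo_on_components[OF W kh])
  have Dl: "clinear_map (D w)" if "w \<in> W" for w
    unfolding clinear_map_def D_def
    by unfold_locales (auto simp: vec_eq_iff dird_add[OF W u that] dird_scale[OF u that] algebra_simps)
  have Dlin: "linear (D w)" if "w \<in> W" for w
    unfolding D_def
    by (intro linearI) (auto simp: vec_eq_iff dird_add[OF W u that] dird_scaleR[OF u that])
  have Dder: "(?k has_derivative D w) (at w)" if w: "w \<in> W" for w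
    unfolding has_derivative_componentwise_within[of ?k]
  proof
    fix b :: "complex ^ 'n" assume "b \<in> Basis"
    then obtain i c where b: "b = axis i c" by (auto simp: Basis_vec_def)
    have "((\<lambda>x. ?k x $ i) has_derivative (\<lambda>x. D w x $ i)) (at w)"
      by (cases "i = l") (auto simp: D_def hol_has_derivative[OF W u w]
        intro!: bounded_linear_imp_has_derivative bounded_linear_vec_nth)
    then show "((\<lambda>x. ?k x \<bullet> b) has_derivative (\<lambda>x. D w x \<bullet> b)) (at w)"
      unfolding b inner_axis by (rule has_derivative_inner_left)
  qed
  define B where "B w = Blinfun (D w)" for w
  have B: "blinfun_apply (B w) = D w" if "w \<in> W" for w
    unfolding B_def using Dlin[OF that] by (simp add: bounded_linear_Blinfun_apply linear_conv_bounded_linear)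
  have Bcont: "continuous_on W B"
  proof (rule continuous_on_blinfun_componentwise)
    fix v :: "complex ^ 'n" assume "v \<in> Basis"
    have "continuous_on W (\<lambda>w. D w v)"
      unfolding D_def
    proof (intro continuous_on_vec_lambda)
      show "continuous_on W (\<lambda>w. if i = l then dird u v w else v $ i)" for i
        using hol_continuous[OF hol_dird[OF W u]] by (cases "i = l") auto
    qed
    then show "continuous_on W (\<lambda>w. blinfun_apply (B w) v)"
      using B by (metis (no_types, lifting) continuous_on_cong)
  qed
  \<comment> \<open>The inverse of \<open>D w0\<close>: components other than \<open>l\<close> are
    unchanged, and the \<open>l\<close>-th is recovered by dividing by
    \<open>dird u (axis l 1) w0\<close>.\<close>
  define E where "E y = y + ((y $ l - dird u y w0) / dird u (axis l 1) w0) *s axis l 1" for y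
  have "linear E"
    unfolding E_def
    by (intro linearI)
      (auto simp: vec_eq_iff dird_add[OF W u w0] dird_scaleR[OF u w0] axis_def scaleR_conv_of_real[where 'a = complex]
        add_divide_distrib diff_divide_distrib algebra_simps)
  then have E: "blinfun_apply (Blinfun E) = E"
    by (simp add: bounded_linear_Blinfun_apply linear_conv_bounded_linear)
  have ED: "E (D w0 v) = v" for v
  proof -
    have e: "D w0 v = v + (dird u v w0 - v $ l) *s axis l 1"
      by (auto simp: D_def vec_eq_iff axis_def)
    have "dird u (D w0 v) w0 = dird u v w0 + (dird u v w0 - v $ l) * dird u (axis l 1) w0"
      by (simp only: e dird_add[OF W u w0] dird_scale[OF u w0])
    then show ?thesis
      using nz by (auto simp: E_def D_def vec_eq_iff axis_def)
  qed
  have "Blinfun E o\<^sub>L B w0 = id_blinfun"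
    by (rule blinfun_eqI) (simp add: E B[OF w0] ED)
  moreover have "\<And>x. x \<in> W \<Longrightarrow> (?k has_derivative blinfun_apply (B x)) (at x)"
    using Dder B by simp
  ultimately obtain W1 W2 g g' where g: "open W1" "W1 \<subseteq> W" "w0 \<in> W1" "open W2" "?k w0 \<in> W2"
    "homeomorphism W1 W2 ?k g"
    "\<And>y. y \<in> W2 \<Longrightarrow> (g has_derivative (g' y)) (at y)"
    "\<And>y. y \<in> W2 \<Longrightarrow> g' y = inv (blinfun_apply (B (g y)))"
    "\<And>y. y \<in> W2 \<Longrightarrow> bij (blinfun_apply (B (g y)))"
    using inverse_function_theorem[OF W _ Bcont w0, of ?k "Blinfun E"] by blast
  have "holo_on g W2"
    unfolding holo_on_def
  proof
    fix y assume y: "y \<in> W2"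
    have "g y \<in> W" using g(2,6) y by (auto simp: homeomorphism_def)
    then show "\<exists>D. clinear_map D \<and> (g has_derivative D) (at y)"
      using clinear_map_inv[OF Dl] g(7)[OF y] g(8)[OF y] g(9)[OF y] B by metis
  qed
  then show thesis
    using that[of W1 W2 g] g holo_on_subset[OF kholo] by (auto simp: chart_def)
qed

text \<open>All iterated derivatives in the direction \<open>v\<close> vanish at \<open>w0\<close>, so the power series on this line is
  zero.\<close>

lemma hol_zero_on_ball_of_derivs:
  fixes u :: "complex ^ 'n \<Rightarrow> complex"
  assumes W: "open W" and u: "hol W u" and ball: "ball w0 r \<subseteq> W"
    and fam: "\<And>f. hol W f \<Longrightarrow> (\<forall>w\<in>A. f w = 0) \<Longrightarrow> \<forall>w\<in>A. dird f v w = 0"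
    and uA: "\<forall>w\<in>A. u w = 0" and w0: "w0 \<in> A" and v: "norm v < r"
  shows "u (w0 + v) = 0"
proof -
  define I where "I k = ((\<lambda>f. dird f v) ^^ k) u" for k
  have I: "hol W (I k) \<and> (\<forall>w\<in>A. I k w = 0)" for k
    by (induction k) (auto simp: I_def u uA intro!: hol_dird W fam[rule_format])
  let ?S = "{t. w0 + t *s v \<in> W}"
  let ?g = "\<lambda>t. u (w0 + t *s v)"
  have oS: "open ?S" by (rule open_line[OF W])
  have D: "(deriv ^^ k) ?g t = I k (w0 + t *s v)" if "t \<in> ?S" for k t
    using that
  proof (induction k arbitrary: t)
    case 0
    then show ?case by (simp add: I_def)
  next
    case (Suc k)
    have "((\<lambda>t. I k (w0 + t *s v)) has_field_derivative I (Suc k) (w0 + t *s v)) (at t)"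
      using hol_line_deriv[of W "I k" w0 t v] I Suc.prems by (simp add: I_def)
    then have "((deriv ^^ k) ?g has_field_derivative I (Suc k) (w0 + t *s v)) (at t)"
      by (rule has_field_derivative_transform_within_open[OF _ oS]) (use Suc in auto)
    then show ?case by (simp add: DERIV_imp_deriv)
  qed
  have r: "r > 0" using v norm_ge_zero order_le_less_trans by blast
  define R where "R = r / (norm v + 1)"
  have nv: "norm v + 1 > 0" by (simp add: add_nonneg_pos)
  show ?thesis
  proof (cases "v = 0")
    case True
    then show ?thesis using uA w0 by simp
  next
    case False
    let ?B = "ball 0 (r / norm v) :: complex set"
    have sub: "?B \<subseteq> ?S"
      using ball False by (auto simp: dist_norm norm_vector_smult field_simps)
    have "?g holomorphic_on ?B"
      using hol_line[OF u] sub holomorphic_on_subset by blast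
    moreover have "(deriv ^^ k) ?g 0 = 0" for k
      using D[of 0 k] I subsetD[OF ball, of w0] r w0 by auto
    moreover have "1 \<in> ?B" using v False by simp
    ultimately have "?g 1 = 0"
      using holomorphic_fun_eq_0_on_ball[of ?g 0 "r / norm v" 1] by blast
    then show ?thesis by simp
  qed
qed

text \<open>Choose a chart at some point of \<open>V\<close> that puts \<open>V\<close> into a
  coordinate subspace of least possible dimension. By minimality no function vanishing on
  \<open>V\<close> can serve as a further coordinate, and this forces \<open>V\<close> to fill the
  subspace near the point.\<close>

lemma nonempty_common_zero_set_regular_point:
  fixes H :: "(complex ^ 'n \<Rightarrow> complex) set"
  assumes H: "\<And>h. h \<in> H \<Longrightarrow> hol UNIV h" and V: "V = {z. \<forall>h\<in>H. h z = 0}" and ne: "V \<noteq> {}"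
  shows "\<exists>d a. regular_point V d a"
proof -
  define P where "P k \<longleftrightarrow> (\<exists>U W \<phi> \<psi> q. \<exists>J :: 'n set. chart U W \<phi> \<psi> \<and> q \<in> V \<inter> U \<and> card J = k \<and>
      \<phi> ` (V \<inter> U) \<subseteq> {w. \<forall>j. j \<notin> J \<longrightarrow> w $ j = 0})" for k
  obtain q0 where "q0 \<in> V" using ne by blast
  have "P (card (UNIV :: 'n set))"
    unfolding P_def
  proof (intro exI conjI)
    show "chart UNIV UNIV (\<lambda>z :: complex ^ 'n. z) (\<lambda>z. z)" by (rule chart_id) simp
    show "q0 \<in> V \<inter> UNIV" using \<open>q0 \<in> V\<close> by simp
    show "(\<lambda>z. z) ` (V \<inter> UNIV) \<subseteq> {w. \<forall>j. j \<notin> UNIV \<longrightarrow> w $ j = 0}" by simp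
  qed simp
  then have PL: "P (LEAST k. P k)" by (rule LeastI)
  define k where "k = (LEAST k. P k)"
  have min: "\<not> P j" if "j < k" for j
    using that unfolding k_def by (rule not_less_Least)
  obtain U W \<phi> \<psi> q and J :: "'n set" where c: "chart U W \<phi> \<psi>" and q: "q \<in> V \<inter> U" and J: "card J = k"
    and sub: "\<phi> ` (V \<inter> U) \<subseteq> {w. \<forall>j. j \<notin> J \<longrightarrow> w $ j = 0}"
    using PL[unfolded k_def[symmetric], unfolded P_def] by blast
  have W: "open W" and hom: "homeomorphism U W \<phi> \<psi>" and hpsi: "holo_on \<psi> W"
    using c by (auto simp: chart_def)
  let ?A = "\<phi> ` (V \<inter> U)"
  have AW: "?A \<subseteq> W" using hom by (auto simp: homeomorphism_def)
  \<comment> \<open>If a function vanishing on the image of \<open>V\<close> had a nonzero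
    derivative along a coordinate \<open>l\<close> of \<open>J\<close>, it could replace that
    coordinate, and \<open>J - {l}\<close> would contradict minimality.\<close>
  have partial: "dird f (axis l 1) w = 0" if f: "hol W f" "\<forall>w\<in>?A. f w = 0" and l: "l \<in> J" and w: "w \<in> ?A" for f l w
  proof (rule ccontr)
    assume nz: "dird f (axis l 1) w \<noteq> 0"
    have "w \<in> W" using AW w by blast
    from chart_replace_coordinate[OF W f(1) this nz]
    obtain W1 W2 \<mu> where W1: "w \<in> W1" "W1 \<subseteq> W" and d: "chart W1 W2 (\<lambda>w. \<chi> i. if i = l then f w else w $ i) \<mu>"
      by blast
    have oW1: "open W1" using d by (simp add: chart_def)
    note im = chart_open_image[OF c W1(2) oW1]
    obtain z where z: "z \<in> V \<inter> U" "w = \<phi> z" using w by blast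
    have "P (card (J - {l}))"
      unfolding P_def
    proof (intro exI conjI)
      show "chart (\<psi> ` W1) W2 (\<lambda>z. (\<lambda>w. \<chi> i. if i = l then f w else w $ i) (\<phi> z)) (\<lambda>w. \<psi> (\<mu> w))"
        by (rule chart_compose[OF c d W1(2)])
      show "z \<in> V \<inter> \<psi> ` W1" unfolding im using z W1 by blast
      show "(\<lambda>z. (\<lambda>w. \<chi> i. if i = l then f w else w $ i) (\<phi> z)) ` (V \<inter> \<psi> ` W1)
          \<subseteq> {w. \<forall>j. j \<notin> J - {l} \<longrightarrow> w $ j = 0}"
        unfolding im using f(2) sub by auto
    qed simp
    moreover have "card (J - {l}) < k" using l J by (metis card_Diff1_less finite_class.finite_code finite)
    ultimately show False using min by blast
  qed
  let ?w0 = "\<phi> q"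
  have w0: "?w0 \<in> ?A" using q by blast
  obtain r where r: "r > 0" "ball ?w0 r \<subseteq> W" using W AW w0 open_contains_ball by blast
  \<comment> \<open>Hence the functions vanishing on the image are stable under differentiation
    along \<open>J\<close>, and the pulled-back \<open>h\<close> vanishes to infinite order in these
    directions.\<close>
  have zero: "h (\<psi> (?w0 + v)) = 0" if h: "h \<in> H" and v: "norm v < r" "\<And>j. j \<notin> J \<Longrightarrow> v $ j = 0" for h v
  proof (rule hol_zero_on_ball_of_derivs[OF W _ r(2) _ _ w0 v(1), of "\<lambda>w. h (\<psi> w)"])
    show "hol W (\<lambda>w. h (\<psi> w))"
      by (rule hol_compose[OF open_UNIV H[OF h] hpsi]) simp
    show "\<forall>w\<in>?A. h (\<psi> w) = 0"
      using hom h V by (auto simp: homeomorphism_def)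
    fix f assume f: "hol W f" "\<forall>w\<in>?A. f w = 0"
    show "\<forall>w\<in>?A. dird f v w = 0"
    proof
      fix w assume w: "w \<in> ?A"
      then have wW: "w \<in> W" using AW by blast
      have "dird f v w = dird f (\<Sum>i\<in>UNIV. (v $ i) *s axis i 1) w"
        by (simp add: basis_expansion)
      also have "\<dots> = (\<Sum>i\<in>UNIV. v $ i * dird f (axis i 1) w)"
        by (subst linear_sum[OF linear_dird[OF W f(1) wW]]) (simp add: dird_scale[OF f(1) wW])
      also have "\<dots> = 0"
        using partial[OF f _ w] v(2) by (intro sum.neutral) auto
      finally show "dird f v w = 0" .
    qed
  qed
  have "regular_point V k q"
    unfolding regular_point_def
  proof (intro conjI exI)
    note im = chart_open_image[OF c r(2) open_ball]
    have d: "chart (\<psi> ` ball ?w0 r) (ball ?w0 r) (\<lambda>z. \<phi> z) (\<lambda>w. \<psi> w)"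
      using chart_compose[OF c chart_id[OF open_ball] r(2)] by simp
    then show "open (\<psi> ` ball ?w0 r)" "open (ball ?w0 r)" "homeomorphism (\<psi> ` ball ?w0 r) (ball ?w0 r) \<phi> \<psi>"
      "holo_on \<phi> (\<psi> ` ball ?w0 r)" "holo_on \<psi> (ball ?w0 r)"
      by (auto simp: chart_def)
    show "q \<in> \<psi> ` ball ?w0 r" unfolding im using q r by auto
    show "q \<in> V" using q by blast
    show "card J = k" by (rule J)
    show "\<phi> ` (V \<inter> \<psi> ` ball ?w0 r) = {w \<in> ball ?w0 r. \<forall>j. j \<notin> J \<longrightarrow> w $ j = 0}"
    proof (intro equalityI subsetI)
      fix w assume "w \<in> \<phi> ` (V \<inter> \<psi> ` ball ?w0 r)"
      then show "w \<in> {w \<in> ball ?w0 r. \<forall>j. j \<notin> J \<longrightarrow> w $ j = 0}"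
        unfolding im using sub by auto
    next
      fix w assume w: "w \<in> {w \<in> ball ?w0 r. \<forall>j. j \<notin> J \<longrightarrow> w $ j = 0}"
      have "h (\<psi> (?w0 + (w - ?w0))) = 0" if "h \<in> H" for h
        by (rule zero[OF that]) (use w sub w0 in \<open>auto simp: dist_norm norm_minus_commute\<close>)
      then have "\<psi> w \<in> V" using V by simp
      moreover have "w \<in> W" using w r by auto
      then have "\<phi> (\<psi> w) = w" using hom by (simp add: homeomorphism_def)
      ultimately show "w \<in> \<phi> ` (V \<inter> \<psi> ` ball ?w0 r)" using w by force
    qed
  qed
  then show ?thesis by blast
qed

text \<open>A form of the rank theorem: as long as some \<open>h\<^sub>i\<close> depends on a coordinate outside \<open>J\<close>, it can replace
  that coordinate.\<close>

lemma rank_chart: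
  fixes h :: "'i \<Rightarrow> complex ^ 'n \<Rightarrow> complex"
  assumes "finite I" and O: "open O'" "O' \<noteq> {}" and h: "\<And>i. i \<in> I \<Longrightarrow> hol O' (h i)"
  shows "\<exists>U W \<phi> \<psi>. \<exists>J :: 'n set. chart U W \<phi> \<psi> \<and> U \<subseteq> O' \<and> U \<noteq> {} \<and> card J \<le> card I \<and>
    (\<forall>i\<in>I. \<forall>w\<in>W. \<forall>l. l \<notin> J \<longrightarrow> dird (\<lambda>w. h i (\<psi> w)) (axis l 1) w = 0)"
  using assms(1,4)
proof (induction I rule: finite_induct)
  case empty
  then show ?case
    using O by (intro exI[of _ O'] exI[of _ "\<lambda>z. z"] exI[of _ "{}"]) (simp add: chart_id)
next
  case (insert i I)
  then obtain U W \<phi> \<psi> and J :: "'n set" where c: "chart U W \<phi> \<psi>" and U: "U \<subseteq> O'" "U \<noteq> {}" and J: "card J \<le> card I"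
    and ind: "\<And>i w l. i \<in> I \<Longrightarrow> w \<in> W \<Longrightarrow> l \<notin> J \<Longrightarrow> dird (\<lambda>w. h i (\<psi> w)) (axis l 1) w = 0"
    by (metis insertI2)
  have W: "open W" and hom: "homeomorphism U W \<phi> \<psi>" and hpsi: "holo_on \<psi> W"
    using c by (auto simp: chart_def)
  have hW: "hol W (\<lambda>w. h j (\<psi> w))" if "j \<in> insert i I" for j
    by (rule hol_compose[OF O(1) insert.prems[OF that] hpsi]) (use hom U in \<open>auto simp: homeomorphism_def\<close>)
  show ?case
  proof (cases "\<forall>w\<in>W. \<forall>l. l \<notin> J \<longrightarrow> dird (\<lambda>w. h i (\<psi> w)) (axis l 1) w = 0")
    case True
    then show ?thesis
      using c U J ind insert.hyps
      by (intro exI[of _ U] exI[of _ W] exI[of _ \<phi>] exI[of _ \<psi>] exI[of _ J]) auto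
  next
    case False
    then obtain w l where w: "w \<in> W" and l: "l \<notin> J" and nz: "dird (\<lambda>w. h i (\<psi> w)) (axis l 1) w \<noteq> 0"
      by blast
    let ?k = "\<lambda>w. \<chi> j. if j = l then h i (\<psi> w) else w $ j"
    obtain W1 W2 \<mu> where W1: "w \<in> W1" "W1 \<subseteq> W" and d: "chart W1 W2 ?k \<mu>"
      using chart_replace_coordinate[OF W hW[OF insertI1] w nz] by blast
    have oW2: "open W2" using d by (simp add: chart_def)
    have \<mu>: "\<mu> x \<in> W1" "?k (\<mu> x) = x" if "x \<in> W2" for x
      using d that by (auto simp: chart_def homeomorphism_def)
    have hmu: "holo_on \<mu> W2" using d by (simp add: chart_def)
    have dep: "dird (\<lambda>x. h j (\<psi> (\<mu> x))) (axis l' 1) x = 0"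
      if j: "j \<in> insert i I" and x: "x \<in> W2" and l': "l' \<notin> insert l J" for j x l'
    proof (cases "j = i")
      case True
      have e: "h i (\<psi> (\<mu> y)) = y $ l" if "y \<in> W2" for y
        using arg_cong[OF \<mu>(2)[OF that], of "\<lambda>w. w $ l"] by simp
      have ev: "\<forall>\<^sub>F t in nhds 0. x + t *s axis l' 1 \<in> W2"
        using eventually_nhds_in_open[OF open_line[OF oW2, of x "axis l' 1"], of 0] x by simp
      have "dird (\<lambda>x. h j (\<psi> (\<mu> x))) (axis l' 1) x = deriv (\<lambda>t. (x + t *s axis l' 1) $ l) 0"
        unfolding dird_def
        by (rule deriv_cong_ev) (use ev e True in \<open>auto elim: eventually_mono\<close>)
      also have "(\<lambda>t. (x + t *s axis l' 1) $ l) = (\<lambda>t. x $ l)"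
        using l' by (auto simp: axis_def fun_eq_iff)
      finally show ?thesis by simp
    next
      case False
      then have jI: "j \<in> I" using j by blast
      obtain Dm where Dm: "clinear_map Dm" "(\<mu> has_derivative Dm) (at x)"
        using hmu x by (auto simp: holo_on_def)
      let ?f = "\<lambda>w. h j (\<psi> w)"
      have mW: "\<mu> x \<in> W" using \<mu>(1)[OF x] W1 by blast
      have "((\<lambda>x. ?f (\<mu> x)) has_derivative (\<lambda>v. dird ?f (Dm v) (\<mu> x))) (at x)"
        by (rule has_derivative_compose[OF Dm(2) hol_has_derivative[OF W hW[OF j] mW]])
      moreover have "((\<lambda>x. ?f (\<mu> x)) has_derivative (\<lambda>v. dird (\<lambda>x. ?f (\<mu> x)) v x)) (at x)"
        by (rule hol_has_derivative[OF oW2 hol_compose[OF W hW[OF j] hmu] x]) (use \<mu> W1 in auto)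
      ultimately have eq: "dird (\<lambda>x. ?f (\<mu> x)) v x = dird ?f (Dm v) (\<mu> x)" for v
        using has_derivative_unique by metis
      \<comment> \<open>The new chart keeps every coordinate \<open>m \<noteq> l\<close>, so a move
        along the axis \<open>l'\<close> fixes the coordinates in \<open>J\<close> to first order;
        along the remaining ones the earlier functions have zero derivative.\<close>
      have comp: "Dm (axis l' 1) $ m = 0" if m: "m \<in> J" for m
      proof -
        have ml: "m \<noteq> l" "m \<noteq> l'" using m l l' by auto
        have "((\<lambda>x. \<mu> x $ m) has_derivative (\<lambda>v. Dm v $ m)) (at x)"
          by (rule bounded_linear.has_derivative[OF bounded_linear_vec_nth Dm(2)])
        moreover have "((\<lambda>x. \<mu> x $ m) has_derivative (\<lambda>v. v $ m)) (at x)"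
        proof (rule has_derivative_transform_within_open[OF _ oW2 x])
          show "((\<lambda>x. x $ m) has_derivative (\<lambda>v. v $ m)) (at x)"
            by (intro bounded_linear_imp_has_derivative bounded_linear_vec_nth)
          show "y $ m = \<mu> y $ m" if "y \<in> W2" for y
            using arg_cong[OF \<mu>(2)[OF that], of "\<lambda>w. w $ m"] ml by simp
        qed
        ultimately have "(\<lambda>v. Dm v $ m) = (\<lambda>v. v $ m)" by (rule has_derivative_unique)
        then have "Dm (axis l' 1) $ m = axis l' 1 $ m" by metis
        then show ?thesis using ml by (simp add: axis_def)
      qed
      have "dird ?f (Dm (axis l' 1)) (\<mu> x) = dird ?f (\<Sum>m\<in>UNIV. (Dm (axis l' 1) $ m) *s axis m 1) (\<mu> x)"
        by (simp add: basis_expansion)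
      also have "\<dots> = (\<Sum>m\<in>UNIV. Dm (axis l' 1) $ m * dird ?f (axis m 1) (\<mu> x))"
        by (subst linear_sum[OF linear_dird[OF W hW[OF j] mW]]) (simp add: dird_scale[OF hW[OF j] mW])
      also have "\<dots> = 0"
        using comp ind[OF jI mW] by (intro sum.neutral) (metis mult_eq_0_iff)
      finally show ?thesis using eq by simp
    qed
    show ?thesis
    proof (intro exI conjI ballI allI impI)
      show "chart (\<psi> ` W1) W2 (\<lambda>z. ?k (\<phi> z)) (\<lambda>x. \<psi> (\<mu> x))"
        by (rule chart_compose[OF c d W1(2)])
      show "\<psi> ` W1 \<subseteq> O'"
        using image_mono[OF W1(2), of \<psi>] hom U(1) by (auto simp: homeomorphism_def)
      show "\<psi> ` W1 \<noteq> {}" using W1 by auto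
      show "card (insert l J) \<le> card (insert i I)" using J insert.hyps l by simp
    qed (rule dep)
  qed
qed

section \<open>Elimination of coordinates\<close>

text \<open>Newton's identities read as a recursion: the elementary symmetric polynomials in terms
  of the power sums \<open>p\<close>.\<close>

fun newton_e :: "(nat \<Rightarrow> complex) \<Rightarrow> nat \<Rightarrow> complex" where
  "newton_e p 0 = 1"
| "newton_e p (Suc n) = (\<Sum>i\<le>n. (-1) ^ i * newton_e p (n - i) * p (Suc i)) / of_nat (Suc n)"

definition roots_fps :: "complex list \<Rightarrow> complex fps" where
  "roots_fps xs = prod_list (map (\<lambda>x. 1 + fps_const x * fps_X) xs)"

text \<open>Logarithmic derivative of the generating function of the elementary symmetric
  polynomials: each factor contributes a geometric series, and these add up to the power sums.
  Comparing coefficients gives Newton's identities.\<close>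

lemma roots_fps_deriv:
  "fps_deriv (roots_fps xs) = roots_fps xs * Abs_fps (\<lambda>n. (-1) ^ n * (\<Sum>x\<leftarrow>xs. x ^ Suc n))"
proof (induction xs)
  case Nil
  then show ?case by (simp add: roots_fps_def fps_eq_iff)
next
  case (Cons x xs)
  let ?S = "\<lambda>xs. Abs_fps (\<lambda>n. (-1) ^ n * (\<Sum>x\<leftarrow>xs. x ^ Suc n)) :: complex fps"
  let ?l = "1 + fps_const x * fps_X :: complex fps"
  define G where "G = (Abs_fps (\<lambda>n. (-1) ^ n * x ^ Suc n) :: complex fps)"
  have G: "?l * G = fps_const x"
  proof (rule fps_ext)
    fix n
    show "fps_nth (?l * G) n = fps_nth (fps_const x) n"
      by (cases n) (simp_all add: G_def distrib_right mult.assoc)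
  qed
  have S: "?S (x # xs) = G + ?S xs"
    by (simp add: fps_eq_iff G_def distrib_left)
  define A where "A = roots_fps xs"
  have A: "roots_fps (x # xs) = ?l * A" by (simp add: roots_fps_def A_def)
  have l: "fps_deriv ?l = fps_const x" by simp
  have ring: "a * (b * c) + (a * d) * b = (a * b) * (d + c)" for a b c d :: "complex fps"
    by (simp add: algebra_simps)
  have "fps_deriv (roots_fps (x # xs)) = ?l * (A * ?S xs) + fps_const x * A"
    unfolding A fps_deriv_mult l Cons.IH[folded A_def] ..
  also have "\<dots> = ?l * (A * ?S xs) + (?l * G) * A"
    unfolding G ..
  also have "\<dots> = (?l * A) * (G + ?S xs)"
    by (rule ring)
  also have "\<dots> = roots_fps (x # xs) * ?S (x # xs)"
    unfolding S A ..
  finally show ?case .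
qed

lemma newton_e_roots:
  "newton_e (\<lambda>k. \<Sum>x\<leftarrow>xs. x ^ k) n = fps_nth (roots_fps xs) n"
proof (induction n rule: less_induct)
  case (less n)
  show ?case
  proof (cases n)
    case 0
    have "fps_nth (roots_fps xs) 0 = 1"
      by (induction xs) (auto simp: roots_fps_def)
    then show ?thesis using 0 by simp
  next
    case (Suc m)
    have "of_nat (Suc m) * fps_nth (roots_fps xs) (Suc m) = fps_nth (fps_deriv (roots_fps xs)) m"
      by (simp add: fps_deriv_nth)
    also have "\<dots> = (\<Sum>i=0..m. fps_nth (roots_fps xs) i * ((-1) ^ (m - i) * (\<Sum>x\<leftarrow>xs. x ^ Suc (m - i))))"
      by (simp add: roots_fps_deriv fps_mult_nth)
    also have "\<dots> = (\<Sum>i\<le>m. fps_nth (roots_fps xs) (m - i) * ((-1) ^ i * (\<Sum>x\<leftarrow>xs. x ^ Suc i)))"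
      by (rule sum.reindex_bij_witness[of _ "\<lambda>i. m - i" "\<lambda>i. m - i"]) auto
    also have "\<dots> = (\<Sum>i\<le>m. (-1) ^ i * newton_e (\<lambda>k. \<Sum>x\<leftarrow>xs. x ^ k) (m - i) * (\<Sum>x\<leftarrow>xs. x ^ Suc i))"
      using less Suc by (intro sum.cong) auto
    finally have e: "of_nat (Suc m) * fps_nth (roots_fps xs) (Suc m) = \<dots>" .
    show ?thesis unfolding Suc newton_e.simps e[symmetric] by (simp del: of_nat_Suc)
  qed
qed

lemma newton_e_length:
  "newton_e (\<lambda>k. \<Sum>x\<leftarrow>xs. x ^ k) (length xs) = prod_list xs"
proof -
  have "fps_nth (roots_fps xs) (length xs) = prod_list xs \<and> (\<forall>k>length xs. fps_nth (roots_fps xs) k = 0)"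
  proof (induction xs)
    case Nil
    then show ?case by (simp add: roots_fps_def)
  next
    case (Cons x xs)
    have "fps_nth (roots_fps (x # xs)) (Suc k) = fps_nth (roots_fps xs) (Suc k) + x * fps_nth (roots_fps xs) k" for k
      by (simp add: roots_fps_def distrib_right mult.assoc)
    then show ?case using Cons by (auto simp: Suc_less_eq2 less_SucI)
  qed
  then show ?thesis by (simp add: newton_e_roots)
qed

text \<open>The expression is the product of the values of \<open>q\<close> over \<open>Z\<close>
  with multiplicities \<open>\<mu>\<close>. Through power sums it depends on the roots only
  symmetrically, so it can be holomorphic in parameters even where single roots are not.\<close>

lemma newton_e_multiplicities:
  assumes "finite Z" "\<And>z. z \<in> Z \<Longrightarrow> \<mu> z > 0"
  shows "newton_e (\<lambda>k. \<Sum>z\<in>Z. of_nat (\<mu> z) * q z ^ k) (\<Sum>z\<in>Z. \<mu> z) = 0 \<longleftrightarrow> (\<exists>z\<in>Z. q z = 0)"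
proof -
  have "\<exists>xs. length xs = (\<Sum>z\<in>Z. \<mu> z) \<and> set xs = q ` Z \<and>
      (\<forall>k. (\<Sum>x\<leftarrow>xs. x ^ k) = (\<Sum>z\<in>Z. of_nat (\<mu> z) * q z ^ k))"
    using assms
  proof (induction Z rule: finite_induct)
    case empty
    then show ?case by (intro exI[of _ "[]"]) auto
  next
    case (insert z Z)
    then obtain xs where "length xs = (\<Sum>z\<in>Z. \<mu> z)" "set xs = q ` Z"
      "\<And>k. (\<Sum>x\<leftarrow>xs. x ^ k) = (\<Sum>z\<in>Z. of_nat (\<mu> z) * q z ^ k)" by auto
    then show ?case
      using insert.hyps insert.prems[of z]
      by (intro exI[of _ "replicate (\<mu> z) (q z) @ xs"])
        (auto simp: map_replicate sum_list_replicate)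
  qed
  then obtain xs where xs: "length xs = (\<Sum>z\<in>Z. \<mu> z)" "set xs = q ` Z"
    "\<And>k. (\<Sum>x\<leftarrow>xs. x ^ k) = (\<Sum>z\<in>Z. of_nat (\<mu> z) * q z ^ k)" by blast
  have "newton_e (\<lambda>k. \<Sum>z\<in>Z. of_nat (\<mu> z) * q z ^ k) (\<Sum>z\<in>Z. \<mu> z) = prod_list xs"
    using newton_e_length[of xs] xs by simp
  then show ?thesis using xs(2) by (auto simp: prod_list_zero_iff)
qed

lemma hol_newton_e:
  assumes "\<And>k. hol U (\<lambda>w. p w k)"
  shows "hol U (\<lambda>w. newton_e (p w) n)"
proof (induction n rule: less_induct)
  case (less n)
  show ?case
    by (cases n) (auto intro!: hol_divide hol_sum hol_mult assms less.IH simp del: of_nat_Suc)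
qed

section \<open>The argument principle with weights\<close>

lemma finite_zeros_in_cball:
  assumes g: "g holomorphic_on ball 0 r'" and t1: "t1 \<in> ball 0 r'" "g t1 \<noteq> 0" and R: "R < r'"
  shows "finite {t \<in> cball 0 R. g t = 0}"
proof (cases "g constant_on ball 0 r'")
  case True
  then have e: "{t \<in> cball 0 R. g t = 0} = {}"
    using t1 R by (fastforce simp: constant_on_def)
  show ?thesis unfolding e by simp
next
  case False
  then show ?thesis
    using R by (intro holomorphic_compact_finite_zeros[OF g]) auto
qed

text \<open>The argument principle with weights \<open>q\<^sup>k\<close> produces the power sums of the values of \<open>q\<close> at
  the zeros of \<open>g\<close>.\<close>

lemma power_sums_of_roots:
  assumes g: "g holomorphic_on ball 0 r'" and q: "q holomorphic_on ball 0 r'"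
    and r: "0 < r" "r < r'" and nz: "\<And>t. norm t = r \<Longrightarrow> g t \<noteq> 0"
  obtains \<mu> :: "complex \<Rightarrow> nat" where
    "finite {t \<in> ball 0 r. g t = 0}"
    "\<And>t. t \<in> ball 0 r \<Longrightarrow> g t = 0 \<Longrightarrow> \<mu> t > 0"
    "\<And>k. 1 / (2 * of_real pi * \<i>) * contour_integral (circlepath 0 r) (\<lambda>t. deriv g t * q t ^ k / g t)
       = (\<Sum>t\<in>{t \<in> ball 0 r. g t = 0}. of_nat (\<mu> t) * q t ^ k)"
proof -
  define R where "R = (r + r') / 2"
  have R: "r < R" "R < r'" using r by (auto simp: R_def)
  \<comment> \<open>\<open>?P\<close> has the form used in the argument principle, with
    \<open>{}\<close> for the poles; the larger radius \<open>R\<close> puts the circle inside an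
    open disc with finitely many zeros.\<close>
  let ?Z = "{t \<in> ball 0 r. g t = 0}" and ?P = "{t \<in> ball 0 R. g t = 0 \<or> t \<in> {}}"
  have sub: "ball 0 R \<subseteq> ball (0::complex) r'" using R by auto
  have finP: "finite ?P"
    by (rule finite_subset[OF _ finite_zeros_in_cball[OF g _ nz R(2), of "of_real r"]]) (use r in auto)
  have finZ: "finite ?Z" by (rule finite_subset[OF _ finP]) (use R in auto)
  have zo: "zorder g t > 0" if "t \<in> ?Z" for t
  proof -
    have "\<exists>w\<in>ball 0 R. g w \<noteq> 0"
      using nz[of "of_real r"] r R by (intro bexI[of _ "of_real r"]) auto
    moreover have "t \<in> ball 0 R" using that R by auto
    ultimately show ?thesis
      using zorder_exist_zero[of g "ball 0 R" t] holomorphic_on_subset[OF g sub] that by auto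
  qed
  show thesis
  proof (rule that[of "\<lambda>t. nat (zorder g t)"])
    show "finite ?Z" by (rule finZ)
    show "nat (zorder g t) > 0" if "t \<in> ball 0 r" "g t = 0" for t using zo that by simp
    fix k
    have "contour_integral (circlepath 0 r) (\<lambda>x. deriv g x * q x ^ k / g x) = 2 * pi * \<i> *
          (\<Sum>p\<in>?P. winding_number (circlepath 0 r) p * q p ^ k * zorder g p)"
    proof (rule argument_principle)
      show "g holomorphic_on ball 0 R - {}" using holomorphic_on_subset[OF g sub] by simp
      show "(\<lambda>x. q x ^ k) holomorphic_on ball 0 R"
        by (intro holomorphic_intros holomorphic_on_subset[OF q sub])
      show "path_image (circlepath 0 r) \<subseteq> ball 0 R - ?P"
        using r R nz by auto
      show "\<forall>z. z \<notin> ball 0 R \<longrightarrow> winding_number (circlepath 0 r) z = 0"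
        using r R by (intro allI impI winding_number_zero_outside[of _ "cball 0 r"]) auto
    qed (use finP in auto)
    also have "(\<Sum>p\<in>?P. winding_number (circlepath 0 r) p * q p ^ k * zorder g p)
        = (\<Sum>p\<in>?Z. winding_number (circlepath 0 r) p * q p ^ k * zorder g p)"
    proof (rule sum.mono_neutral_right[OF finP])
      show "?Z \<subseteq> ?P" using R by auto
      show "\<forall>i\<in>?P - ?Z. winding_number (circlepath 0 r) i * q i ^ k * zorder g i = 0"
      proof
        fix i assume i: "i \<in> ?P - ?Z"
        then have "i \<notin> cball 0 r" using nz[of i] by (auto simp: le_less)
        then have "winding_number (circlepath 0 r) i = 0"
          using r by (intro winding_number_zero_outside[of _ "cball 0 r"]) auto
        then show "winding_number (circlepath 0 r) i * q i ^ k * zorder g i = 0" by simp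
      qed
    qed
    also have "\<dots> = (\<Sum>t\<in>?Z. of_nat (nat (zorder g t)) * q t ^ k)"
    proof (rule sum.cong)
      fix t assume t: "t \<in> ?Z"
      then have "winding_number (circlepath 0 r) t = 1"
        by (intro winding_number_circlepath) simp
      moreover have "of_int (zorder g t) = (of_nat (nat (zorder g t)) :: complex)"
        using zo[OF t] by simp
      ultimately show "winding_number (circlepath 0 r) t * q t ^ k * zorder g t
          = of_nat (nat (zorder g t)) * q t ^ k" by simp
    qed simp
    finally show "1 / (2 * of_real pi * \<i>) * contour_integral (circlepath 0 r) (\<lambda>t. deriv g t * q t ^ k / g t)
       = (\<Sum>t\<in>?Z. of_nat (nat (zorder g t)) * q t ^ k)" by simp
  qed
qed

section \<open>Replacing one coordinate\<close>

definition upd :: "complex ^ 'k \<Rightarrow> 'k \<Rightarrow> complex \<Rightarrow> complex ^ 'k" where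
  "upd w j c = (\<chi> i. if i = j then c else w $ i)"

lemma upd_nth: "upd w j c $ i = (if i = j then c else w $ i)"
  by (simp add: upd_def)

lemma upd_upd [simp]: "upd (upd w j c) j d = upd w j d"
  by (simp add: vec_eq_iff upd_nth)

lemma upd_line: "upd w j (a + t) = upd w j a + t *s axis j 1"
  by (simp add: vec_eq_iff upd_nth axis_def)

lemma norm_axis_smult: "norm (t *s axis j 1 :: complex ^ 'k) = norm t"
  by (simp add: norm_vector_smult norm_axis_1)

lemma norm_upd_diff: "norm (upd w j c - upd P j c) \<le> norm (w - P)"
  by (rule norm_le_componentwise_cart) (simp add: upd_nth)

lemma dist_upd: "dist P (upd w j (P $ j + t)) \<le> dist P w + norm t"
proof -
  have e: "upd w j (P $ j + t) - P = (upd w j (P $ j) - upd P j (P $ j)) + t *s axis j 1"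
    by (simp add: vec_eq_iff upd_nth axis_def)
  have "norm (upd w j (P $ j + t) - P) \<le> norm (w - P) + norm t"
    unfolding e using norm_triangle_ineq[of "upd w j (P $ j) - upd P j (P $ j)" "t *s axis j 1"]
      norm_upd_diff[of w j "P $ j" P] unfolding norm_axis_smult by linarith
  then show ?thesis by (simp add: dist_norm norm_minus_commute)
qed

lemma continuous_on_upd [continuous_intros]:
  assumes "continuous_on S f" "continuous_on S c"
  shows "continuous_on S (\<lambda>x. upd (f x) j (c x))"
  unfolding upd_def
proof (rule continuous_on_vec_lambda)
  show "continuous_on S (\<lambda>x. if i = j then c x else f x $ i)" for i
    by (cases "i = j") (auto intro!: continuous_intros assms)
qed

lemma hol_upd:
  assumes "hol U f" "(\<lambda>w. upd w j c) ` V \<subseteq> U"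
  shows "hol V (\<lambda>w. f (upd w j c))"
  by (rule hol_affine[OF assms(1) _ assms(2), where L = "\<lambda>v. upd v j 0"])
    (auto intro!: continuous_intros simp: vec_eq_iff upd_nth)

text \<open>If every \<open>t\<close> had a nonzero \<open>h t i\<close>, the polynomial with these
  coefficients would vanish at no more than \<open>M\<close> of the integers \<open>k\<close>, and
  all of \<open>Z\<close> would account for at most \<open>N * M\<close> of them. This trades a
  common zero of several functions for zeros of single linear combinations.\<close>

lemma poly_zero_pigeonhole:
  fixes h :: "'a \<Rightarrow> nat \<Rightarrow> complex"
  assumes Z: "finite Z" "card Z \<le> N"
    and ex: "\<And>k. k < N * M + 1 \<Longrightarrow> \<exists>t\<in>Z. (\<Sum>i<M. of_nat k ^ i * h t i) = 0"
  shows "\<exists>t\<in>Z. \<forall>i<M. h t i = 0"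
proof (rule ccontr)
  assume "\<not> ?thesis"
  then have neg: "\<And>t. t \<in> Z \<Longrightarrow> \<exists>i<M. h t i \<noteq> 0" by blast
  define A where "A t = {k. k < N * M + 1 \<and> (\<Sum>i<M. of_nat k ^ i * h t i) = 0}" for t
  have "card (A t) \<le> M" if t: "t \<in> Z" for t
  proof -
    define p where "p = (\<Sum>i<M. monom (h t i) i)"
    have c: "coeff p i = (if i < M then h t i else 0)" for i
      by (simp add: p_def coeff_sum if_distrib cong: if_cong)
    then have "p \<noteq> 0" using neg[OF t] by (metis coeff_0)
    moreover have "degree p \<le> M"
      by (rule degree_le) (simp add: c)
    ultimately have "card {x. poly p x = 0} \<le> M" "finite {x. poly p x = 0}"
      using card_poly_roots_bound[of p] poly_roots_finite[of p] by auto
    moreover have "of_nat ` A t \<subseteq> {x. poly p x = 0}"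
      by (auto simp: A_def p_def poly_sum poly_monom mult.commute)
    ultimately have "card (of_nat ` A t :: complex set) \<le> M"
      by (meson card_mono order_trans)
    then show ?thesis by (simp add: card_image inj_on_def)
  qed
  then have "(\<Sum>t\<in>Z. card (A t)) \<le> card Z * M"
    using sum_bounded_above[of Z "\<lambda>t. card (A t)" M] by simp
  also have "\<dots> \<le> N * M" using Z by simp
  finally have "card (\<Union>t\<in>Z. A t) \<le> N * M"
    using card_UN_le[OF Z(1), of A] by linarith
  moreover have "{..<N * M + 1} \<subseteq> (\<Union>t\<in>Z. A t)"
    using ex by (auto simp: A_def)
  moreover have "finite (\<Union>t\<in>Z. A t)" using Z(1) by (auto simp: A_def)
  ultimately have "card {..<N * M + 1} \<le> N * M" by (meson card_mono order_trans)
  then show False by simp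
qed

lemma dird_independent:
  assumes "\<And>w c. f (upd w j c) = f w"
  shows "dird f v (upd z j c) = dird f v z"
proof -
  have "f (upd z j c + t *s v) = f (z + t *s v)" for t
  proof -
    have "upd z j c + t *s v = upd (z + t *s v) j (c + t * v $ j)"
      by (simp add: vec_eq_iff upd_nth)
    then show ?thesis using assms by simp
  qed
  then show ?thesis by (simp add: dird_def)
qed

text \<open>A resultant: for each integer \<open>k\<close>, the values of the combination
  \<open>q k\<close> of all \<open>h i\<close> are multiplied over the zeros of \<open>h i0\<close>
  in the disc. The product vanishes exactly when \<open>q k\<close> and \<open>h i0\<close> have a
  common zero there, and sufficiently many \<open>k\<close> detect a common zero of all
  \<open>h i\<close>. Coordinates on which no \<open>h i\<close> depends stay absent, so the
  procedure can be iterated.\<close>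

lemma eliminate_coordinate:
  fixes h :: "nat \<Rightarrow> complex ^ 'k \<Rightarrow> complex"
  assumes h: "\<And>i. i < M \<Longrightarrow> hol (ball P \<rho>0) (h i)" and i0: "i0 < M" and r: "0 < r" "r < \<rho>0"
    and nz: "\<And>t. norm t = r \<Longrightarrow> h i0 (upd P j (P $ j + t)) \<noteq> 0"
  obtains \<rho> and K :: nat and R where "0 < \<rho>" "\<rho> + r < \<rho>0" "\<And>k. k < K \<Longrightarrow> hol (ball P \<rho>) (R k)"
    "\<And>k w c. R k (upd w j c) = R k w"
    "\<And>k j' w c. (\<And>i w c. i < M \<Longrightarrow> h i (upd w j' c) = h i w) \<Longrightarrow> R k (upd w j' c) = R k w"
    "\<And>w. w \<in> ball P \<rho> \<Longrightarrow>
      (\<forall>k<K. R k w = 0) \<longleftrightarrow> (\<exists>t. norm t < r \<and> (\<forall>i<M. h i (upd w j (P $ j + t)) = 0))"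
proof -
  define g where "g = h i0"
  have g: "hol (ball P \<rho>0) g" using h i0 by (simp add: g_def)
  define q where "q k z = (\<Sum>i<M. of_nat k ^ i * h i z)" for k :: nat and z
  have q: "hol (ball P \<rho>0) (q k)" for k
    unfolding q_def by (intro hol_sum hol_mult h) auto
  define r' where "r' = (r + \<rho>0) / 2"
  define \<rho>1 where "\<rho>1 = \<rho>0 - r'"
  have r': "r < r'" "r' < \<rho>0" "\<rho>1 > 0" using r by (auto simp: r'_def \<rho>1_def field_simps)
  let ?p = "\<lambda>w t. upd w j (P $ j + t)"
  have gc: "continuous_on (ball P \<rho>0) g" using hol_continuous[OF g] .
  \<comment> \<open>A lower bound for \<open>g\<close> on the circle over \<open>P\<close>. Uniform
    continuity carries nonvanishing over to all \<open>w\<close> within \<open>\<rho>\<close> of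
    \<open>P\<close>, so no zero crosses the boundary of the disc.\<close>
  obtain c where c: "c > 0" "\<And>t. norm t = r \<Longrightarrow> norm (g (?p P t)) \<ge> c"
  proof -
    have "\<exists>t0\<in>sphere 0 r. \<forall>t\<in>sphere 0 r. norm (g (?p P t0)) \<le> norm (g (?p P t))"
      by (intro continuous_attains_inf continuous_intros continuous_on_compose2[OF gc])
        (use r le_less_trans[OF dist_upd[of P P j]] in auto)
    then obtain t0 where t0: "t0 \<in> sphere 0 r" "\<And>t. t \<in> sphere 0 r \<Longrightarrow> norm (g (?p P t0)) \<le> norm (g (?p P t))"
      by blast
    show thesis
      by (rule that[of "norm (g (?p P t0))"]) (use t0 nz in \<open>auto simp: g_def\<close>)
  qed
  have "uniformly_continuous_on (cball P (\<rho>1 / 2 + r)) g"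
    by (intro compact_uniformly_continuous continuous_on_subset[OF gc])
      (use r' in \<open>auto simp: \<rho>1_def r'_def field_simps\<close>)
  then obtain \<delta> where \<delta>: "\<delta> > 0" "\<And>x y. x \<in> cball P (\<rho>1 / 2 + r) \<Longrightarrow> y \<in> cball P (\<rho>1 / 2 + r) \<Longrightarrow>
      dist y x < \<delta> \<Longrightarrow> dist (g y) (g x) < c"
    using c(1) unfolding uniformly_continuous_on_def by metis
  define \<rho> where "\<rho> = min (\<rho>1 / 2) \<delta>"
  have \<rho>: "\<rho> > 0" "\<rho> \<le> \<rho>1 / 2" "\<rho> \<le> \<delta>" using r' \<delta> by (auto simp: \<rho>_def)
  have in_ball: "?p w t \<in> ball P \<rho>0" if "w \<in> ball P \<rho>" "norm t < r'" for w t
    using that dist_upd[of P w j t] \<rho> r' by (auto simp: \<rho>1_def)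
  have gnz: "g (?p w t) \<noteq> 0" if "w \<in> ball P \<rho>" "norm t = r" for w t
  proof -
    have "dist (?p w t) (?p P t) < \<delta>"
      using norm_upd_diff[of w j "P $ j + t" P] that(1) \<rho>(3) by (simp add: dist_norm norm_minus_commute)
    then have "dist (g (?p w t)) (g (?p P t)) < c"
      using that dist_upd[of P w j t] dist_upd[of P P j t] \<rho> r' by (intro \<delta>(2)) auto
    then show ?thesis using c(2)[OF that(2)] by (auto simp: dist_norm)
  qed
  have line: "?p w t = upd w j (P $ j) + t *s axis j 1" for w t by (rule upd_line)
  define PS where "PS k m w = 1 / (2 * of_real pi * \<i>) * contour_integral (circlepath 0 r)
      (\<lambda>t. dird g (axis j 1) (?p w t) * q k (?p w t) ^ m / g (?p w t))" for k m w
  have PShol: "hol (ball P \<rho>) (PS k m)" for k m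
    unfolding PS_def
  proof (intro hol_mult hol_const hol_contour_integral)
    have cc: "continuous_on (ball P \<rho> \<times> sphere 0 r) (\<lambda>x. f (?p (fst x) (snd x)))"
      if "hol (ball P \<rho>0) f" for f
      by (rule continuous_on_compose2[OF hol_continuous[OF that]])
        (use in_ball r' in \<open>auto intro!: continuous_intros\<close>)
    show "continuous_on (ball P \<rho> \<times> sphere 0 r)
        (\<lambda>(w, t). dird g (axis j 1) (?p w t) * q k (?p w t) ^ m / g (?p w t))"
      unfolding case_prod_unfold using gnz
      by (intro continuous_intros cc g q hol_dird) auto
    fix t :: complex assume t: "t \<in> sphere 0 r"
    have "hol (ball P \<rho>) (\<lambda>w. f (?p w t))" if "hol (ball P \<rho>0) f" for f
      by (rule hol_upd[OF that]) (use in_ball t r' in auto)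
    then show "hol (ball P \<rho>) (\<lambda>w. dird g (axis j 1) (?p w t) * q k (?p w t) ^ m / g (?p w t))"
      using gnz t by (intro hol_divide hol_mult hol_power hol_dird g q) (auto intro: hol_dird g q)
  qed (use r in auto)
  have roots: "\<exists>\<mu> :: complex \<Rightarrow> nat. finite {t \<in> ball 0 r. g (?p w t) = 0} \<and>
      (\<forall>t. t \<in> ball 0 r \<longrightarrow> g (?p w t) = 0 \<longrightarrow> \<mu> t > 0) \<and>
      (\<forall>m. PS k m w = (\<Sum>t\<in>{t \<in> ball 0 r. g (?p w t) = 0}. of_nat (\<mu> t) * q k (?p w t) ^ m))"
    if w: "w \<in> ball P \<rho>" for w k
  proof -
    have hl: "(\<lambda>t. f (?p w t)) holomorphic_on ball 0 r'" if "hol (ball P \<rho>0) f" for f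
      unfolding line
      by (rule holomorphic_on_subset[OF hol_line[OF that]]) (use in_ball[OF w] line in auto)
    obtain \<mu> :: "complex \<Rightarrow> nat" where \<mu>: "finite {t \<in> ball 0 r. g (?p w t) = 0}"
      "\<And>t. t \<in> ball 0 r \<Longrightarrow> g (?p w t) = 0 \<Longrightarrow> \<mu> t > 0"
      "\<And>m. 1 / (2 * of_real pi * \<i>) * contour_integral (circlepath 0 r)
          (\<lambda>t. deriv (\<lambda>t. g (?p w t)) t * q k (?p w t) ^ m / g (?p w t))
       = (\<Sum>t\<in>{t \<in> ball 0 r. g (?p w t) = 0}. of_nat (\<mu> t) * q k (?p w t) ^ m)"
      using power_sums_of_roots[OF hl[OF g] hl[OF q] r(1) r'(1) gnz[OF w]] by blast
    have "deriv (\<lambda>t. g (?p w t)) t = dird g (axis j 1) (?p w t)" if "norm t = r" for t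
    proof -
      have "((\<lambda>t. g (upd w j (P $ j) + t *s axis j 1)) has_field_derivative
          dird g (axis j 1) (upd w j (P $ j) + t *s axis j 1)) (at t)"
        by (rule hol_line_deriv[OF g]) (use in_ball[OF w, of t] line that r' in auto)
      then show ?thesis unfolding line by (rule DERIV_imp_deriv)
    qed
    then have "PS k m w = 1 / (2 * of_real pi * \<i>) * contour_integral (circlepath 0 r)
          (\<lambda>t. deriv (\<lambda>t. g (?p w t)) t * q k (?p w t) ^ m / g (?p w t))" for m
      unfolding PS_def using r by (intro arg_cong2[of _ _ _ _ "(*)"] contour_integral_eq) auto
    then show ?thesis using \<mu> by (intro exI[of _ \<mu>]) simp
  qed
  have PS0: "PS k 0 w = PS 0 0 w" for k w by (simp add: PS_def)
  have nat_val: "\<exists>N. PS 0 0 w = of_nat N" if w: "w \<in> ball P \<rho>" for w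
  proof -
    obtain \<mu> :: "complex \<Rightarrow> nat" where
      "PS 0 0 w = (\<Sum>t\<in>{t \<in> ball 0 r. g (?p w t) = 0}. of_nat (\<mu> t) * q 0 (?p w t) ^ 0)"
      using roots[OF w, of 0] by blast
    then have "PS 0 0 w = of_nat (\<Sum>t\<in>{t \<in> ball 0 r. g (?p w t) = 0}. \<mu> t)" by simp
    then show ?thesis by blast
  qed
  \<comment> \<open>The number of zeros with multiplicity is an integer and continuous in
    \<open>w\<close>. It has to be constant because the product of all root values is the elementary
    symmetric polynomial of exactly this index.\<close>
  have "PS 0 0 constant_on ball P \<rho>"
  proof (rule continuous_discrete_range_constant)
    show "continuous_on (ball P \<rho>) (PS 0 0)" by (rule hol_continuous[OF PShol])
    fix x assume x: "x \<in> ball P \<rho>"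
    show "\<exists>e>0. \<forall>y. y \<in> ball P \<rho> \<and> PS 0 0 y \<noteq> PS 0 0 x \<longrightarrow> e \<le> norm (PS 0 0 y - PS 0 0 x)"
    proof (intro exI[of _ 1] conjI allI impI)
      fix y assume y: "y \<in> ball P \<rho> \<and> PS 0 0 y \<noteq> PS 0 0 x"
      obtain a b where ab: "PS 0 0 x = of_nat a" "PS 0 0 y = of_nat b" using nat_val x y by metis
      have "norm (PS 0 0 y - PS 0 0 x) = \<bar>real b - real a\<bar>"
        unfolding ab by (metis norm_of_real of_real_diff of_real_of_nat_eq)
      then show "1 \<le> norm (PS 0 0 y - PS 0 0 x)" using y ab by auto
    qed simp
  qed simp
  then obtain N where N: "\<And>w. w \<in> ball P \<rho> \<Longrightarrow> PS 0 0 w = of_nat N"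
    using nat_val[of P] \<rho>(1) unfolding constant_on_def by (metis centre_in_ball)
  define R where "R k w = newton_e (\<lambda>m. PS k m w) N" for k w
  have key: "(R k w = 0 \<longleftrightarrow> (\<exists>t\<in>{t \<in> ball 0 r. g (?p w t) = 0}. q k (?p w t) = 0)) \<and>
      finite {t \<in> ball 0 r. g (?p w t) = 0} \<and> card {t \<in> ball 0 r. g (?p w t) = 0} \<le> N"
    if w: "w \<in> ball P \<rho>" for k w
  proof -
    let ?Z = "{t \<in> ball 0 r. g (?p w t) = 0}"
    obtain \<mu> :: "complex \<Rightarrow> nat" where \<mu>: "finite ?Z" "\<And>t. t \<in> ?Z \<Longrightarrow> \<mu> t > 0"
      "\<And>m. PS k m w = (\<Sum>t\<in>?Z. of_nat (\<mu> t) * q k (?p w t) ^ m)"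
      using roots[OF w, of k] by auto
    have "of_nat (\<Sum>t\<in>?Z. \<mu> t) = (of_nat N :: complex)"
      using \<mu>(3)[of 0] N[OF w] PS0[of k w] by simp
    then have sum: "(\<Sum>t\<in>?Z. \<mu> t) = N" using of_nat_eq_iff by blast
    have "card ?Z = (\<Sum>t\<in>?Z. 1)" by simp
    also have "\<dots> \<le> (\<Sum>t\<in>?Z. \<mu> t)"
      by (rule sum_mono) (use \<mu>(2) in \<open>force simp: Suc_le_eq\<close>)
    finally have "card ?Z \<le> N" using sum by simp
    moreover have "R k w = 0 \<longleftrightarrow> (\<exists>t\<in>?Z. q k (?p w t) = 0)"
      unfolding R_def \<mu>(3) sum[symmetric]
      by (rule newton_e_multiplicities) (use \<mu> in auto)
    ultimately show ?thesis using \<mu>(1) by blast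
  qed
  show thesis
  proof (rule that[of \<rho> "N * M + 1" R])
    show "0 < \<rho>" "\<rho> + r < \<rho>0" using \<rho> r' by (auto simp: \<rho>1_def)
    show "hol (ball P \<rho>) (R k)" for k
      unfolding R_def by (rule hol_newton_e[OF PShol])
    show "R k (upd w j c) = R k w" for k w c
      by (simp add: R_def PS_def)
    show "R k (upd w j' c) = R k w" if ind: "\<And>i w c. i < M \<Longrightarrow> h i (upd w j' c) = h i w" for k j' w c
    proof (cases "j' = j")
      case False
      have comm: "?p (upd w j' c) t = upd (?p w t) j' c" for t
        using False by (auto simp: vec_eq_iff upd_nth)
      have "g (upd z j' c) = g z" "q k (upd z j' c) = q k z" for z c
        using ind i0 by (auto simp: g_def q_def)
      then show ?thesis
        using dird_independent[of g j' "axis j 1"] by (simp add: R_def PS_def comm)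
    qed (simp add: R_def PS_def)
    fix w assume w: "w \<in> ball P \<rho>"
    show "(\<forall>k<N * M + 1. R k w = 0) \<longleftrightarrow> (\<exists>t. norm t < r \<and> (\<forall>i<M. h i (?p w t) = 0))"
    proof
      assume L: "\<forall>k<N * M + 1. R k w = 0"
      have "\<exists>t\<in>{t \<in> ball 0 r. g (?p w t) = 0}. \<forall>i<M. h i (?p w t) = 0"
        by (rule poly_zero_pigeonhole[where N = N]) (use key[OF w] L in \<open>auto simp: q_def\<close>)
      then show "\<exists>t. norm t < r \<and> (\<forall>i<M. h i (?p w t) = 0)" by auto
    next
      assume "\<exists>t. norm t < r \<and> (\<forall>i<M. h i (?p w t) = 0)"
      then obtain t where "norm t < r" "\<forall>i<M. h i (?p w t) = 0" by blast
      then have "t \<in> {t \<in> ball 0 r. g (?p w t) = 0}" "q k (?p w t) = 0" for k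
        using i0 by (auto simp: g_def q_def)
      then show "\<forall>k<N * M + 1. R k w = 0" using key[OF w] by blast
    qed
  qed
qed

text \<open>Near \<open>P\<close>, the common zero set of \<open>R\<close> is the projection along the coordinates \<open>J\<close> of that of \<open>h\<close>.\<close>

definition eliminates :: "'k set \<Rightarrow> complex ^ 'k \<Rightarrow> real \<Rightarrow> nat \<Rightarrow> (nat \<Rightarrow> complex ^ 'k \<Rightarrow> complex) \<Rightarrow>
    real \<Rightarrow> ('k \<Rightarrow> real) \<Rightarrow> nat \<Rightarrow> (nat \<Rightarrow> complex ^ 'k \<Rightarrow> complex) \<Rightarrow> bool" where
  "eliminates J P \<rho>0 M h \<rho> \<epsilon> M' R \<longleftrightarrow> 0 < \<rho> \<and> (\<forall>i. 0 < \<epsilon> i) \<and> (\<forall>i<M'. hol (ball P \<rho>) (R i)) \<and>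
    (\<forall>i<M'. \<forall>j\<in>J. \<forall>w c. R i (upd w j c) = R i w) \<and>
    (\<forall>w\<in>ball P \<rho>. (\<forall>i<M'. R i w = 0) \<longleftrightarrow> (\<exists>z\<in>ball P \<rho>0. (\<forall>i<M. h i z = 0) \<and>
       (\<forall>i. i \<notin> J \<longrightarrow> z $ i = w $ i) \<and> (\<forall>i\<in>J. norm (z $ i - P $ i) < \<epsilon> i)))"

lemma eliminatesD:
  assumes "eliminates J P \<rho>0 M h \<rho> \<epsilon> M' R"
  shows "0 < \<rho>" "0 < \<epsilon> i" "i' < M' \<Longrightarrow> hol (ball P \<rho>) (R i')"
    "i' < M' \<Longrightarrow> j \<in> J \<Longrightarrow> R i' (upd w j c) = R i' w"
    "w \<in> ball P \<rho> \<Longrightarrow> (\<forall>i<M'. R i w = 0) \<longleftrightarrow> (\<exists>z\<in>ball P \<rho>0. (\<forall>i<M. h i z = 0) \<and>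
       (\<forall>i. i \<notin> J \<longrightarrow> z $ i = w $ i) \<and> (\<forall>i\<in>J. norm (z $ i - P $ i) < \<epsilon> i))"
proof -
  note a = assms[unfolded eliminates_def]
  show "0 < \<rho>" "0 < \<epsilon> i" using a by (elim conjE; simp)+
  show "hol (ball P \<rho>) (R i')" if "i' < M'" using conjunct1[OF conjunct2[OF conjunct2[OF a]]] that by simp
  show "R i' (upd w j c) = R i' w" if "i' < M'" "j \<in> J"
    using conjunct1[OF conjunct2[OF conjunct2[OF conjunct2[OF a]]]] that by simp
  show "(\<forall>i<M'. R i w = 0) \<longleftrightarrow> (\<exists>z\<in>ball P \<rho>0. (\<forall>i<M. h i z = 0) \<and>
       (\<forall>i. i \<notin> J \<longrightarrow> z $ i = w $ i) \<and> (\<forall>i\<in>J. norm (z $ i - P $ i) < \<epsilon> i))" if "w \<in> ball P \<rho>"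
    by (rule bspec[OF conjunct2[OF conjunct2[OF conjunct2[OF conjunct2[OF a]]]] that])
qed

text \<open>Each elimination needs a function that does not vanish identically along the coordinate
  to be removed. It comes from \<open>iso\<close>, because the coordinate \<open>s\<close> is never
  removed and \<open>P\<close> is the only common zero in its fibre.\<close>

lemma eliminate_coordinates:
  fixes h :: "nat \<Rightarrow> complex ^ 'k \<Rightarrow> complex"
  assumes "finite J" and s: "s \<notin> J" and \<rho>0: "\<rho>0 > 0"
    and h: "\<And>i. i < M \<Longrightarrow> hol (ball P \<rho>0) (h i)"
    and iso: "\<And>z. z \<in> ball P \<rho>0 \<Longrightarrow> \<forall>i<M. h i z = 0 \<Longrightarrow> z $ s = P $ s \<Longrightarrow> z = P"
  shows "\<exists>\<rho> \<epsilon> M' R. eliminates J P \<rho>0 M h \<rho> \<epsilon> M' R"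
  using assms(1,2)
proof (induction J rule: finite_induct)
  case empty
  show ?case
    unfolding eliminates_def
  proof (intro exI conjI)
    show "0 < \<rho>0" by (rule \<rho>0)
    show "\<forall>i :: 'k. 0 < (\<lambda>_. 1 :: real) i" by simp
    show "\<forall>i<M. hol (ball P \<rho>0) (h i)" using h by blast
  qed (auto simp flip: vec_eq_iff)
next
  case (insert j J)
  then have js: "j \<noteq> s" "s \<notin> J" by auto
  obtain \<rho> \<epsilon> M' R where el: "eliminates J P \<rho>0 M h \<rho> \<epsilon> M' R"
    using insert.IH[OF js(2)] by (elim exE)
  note \<rho> = eliminatesD(1)[OF el] and \<epsilon> = eliminatesD(2)[OF el] and R = eliminatesD(3)[OF el]
    and ind = eliminatesD(4)[OF el] and eqv = eliminatesD(5)[OF el]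
  let ?p = "\<lambda>w t. upd w j (P $ j + t)"
  let ?t1 = "of_real (\<rho> / 2) :: complex"
  have pb: "?p P t \<in> ball P \<rho>" if "norm t < \<rho>" for t
    using dist_upd[of P P j t] that by simp
  \<comment> \<open>A common zero here would lift to a zero of all \<open>h i\<close> with the
    \<open>s\<close>-coordinate of \<open>P\<close>, hence to \<open>P\<close> itself, whose
    \<open>j\<close>-coordinate is not shifted by \<open>\<rho> / 2\<close>.\<close>
  have "\<not> (\<forall>i<M'. R i (?p P ?t1) = 0)"
  proof
    assume "\<forall>i<M'. R i (?p P ?t1) = 0"
    moreover have "?p P ?t1 \<in> ball P \<rho>" using \<rho> by (intro pb) simp
    ultimately obtain z where z: "z \<in> ball P \<rho>0" "\<forall>i<M. h i z = 0" "\<forall>i. i \<notin> J \<longrightarrow> z $ i = ?p P ?t1 $ i"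
      using eqv by blast
    have "z = P" using iso[OF z(1,2)] z(3) js by (simp add: upd_nth)
    then show False using z(3)[rule_format, OF insert.hyps(2)] \<rho> by (simp add: upd_nth)
  qed
  then obtain i0 where i0: "i0 < M'" "R i0 (?p P ?t1) \<noteq> 0" by blast
  have "(\<lambda>t. R i0 (?p P t)) holomorphic_on ball 0 \<rho>"
    unfolding upd_line
    by (rule holomorphic_on_subset[OF hol_line[OF R[OF i0(1)]]]) (use pb upd_line in \<open>auto simp flip: upd_line\<close>)
  then have "finite {t \<in> cball 0 (\<rho> / 2). R i0 (?p P t) = 0}"
    by (rule finite_zeros_in_cball[of _ _ ?t1]) (use i0 \<rho> in auto)
  then have "finite (norm ` {t \<in> cball 0 (\<rho> / 2). R i0 (?p P t) = 0})" by simp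
  moreover have "infinite {0<..<\<rho> / 2}" using \<rho> by simp
  ultimately have "\<not> {0<..<\<rho> / 2} \<subseteq> norm ` {t \<in> cball 0 (\<rho> / 2). R i0 (?p P t) = 0}"
    using finite_subset by blast
  then obtain r where r01: "r \<in> {0<..<\<rho> / 2}"
    and r4: "r \<notin> norm ` {t \<in> cball 0 (\<rho> / 2). R i0 (?p P t) = 0}"
    by blast
  then have r: "0 < r" "r < \<rho> / 2" by auto
  have nz: "R i0 (?p P t) \<noteq> 0" if "norm t = r" for t
    using r r4 that by auto
  have rr: "r < \<rho>" using r \<rho> by simp
  obtain \<rho>' and K :: nat and R' where \<rho>': "0 < \<rho>'" "\<rho>' + r < \<rho>" "\<And>k. k < K \<Longrightarrow> hol (ball P \<rho>') (R' k)"
    "\<And>k w c. R' k (upd w j c) = R' k w"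
    "\<And>k j' w c. (\<And>i w c. i < M' \<Longrightarrow> R i (upd w j' c) = R i w) \<Longrightarrow> R' k (upd w j' c) = R' k w"
    "\<And>w. w \<in> ball P \<rho>' \<Longrightarrow>
      (\<forall>k<K. R' k w = 0) \<longleftrightarrow> (\<exists>t. norm t < r \<and> (\<forall>i<M'. R i (?p w t) = 0))"
    by (rule eliminate_coordinate[of M' P \<rho> R i0 r j, OF R i0(1) r(1) rr nz]) blast+
  show ?case
    unfolding eliminates_def
  proof (intro exI conjI ballI allI impI)
    show "0 < \<rho>'" by (rule \<rho>'(1))
    show "0 < (\<epsilon>(j := r)) i" for i using \<epsilon> r by auto
    show "hol (ball P \<rho>') (R' i)" if "i < K" for i using \<rho>'(3) that .
    show "R' i (upd w j' c) = R' i w" if "j' \<in> insert j J" for i j' w c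
      using that \<rho>'(4) \<rho>'(5) ind by blast
    fix w assume w: "w \<in> ball P \<rho>'"
    have pw: "?p w t \<in> ball P \<rho>" if "norm t < r" for t
      using dist_upd[of P w j t] that w \<rho>'(2) by simp
    have "(\<forall>k<K. R' k w = 0) \<longleftrightarrow> (\<exists>t. norm t < r \<and> (\<exists>z\<in>ball P \<rho>0. (\<forall>i<M. h i z = 0) \<and>
       (\<forall>i. i \<notin> J \<longrightarrow> z $ i = ?p w t $ i) \<and> (\<forall>i\<in>J. norm (z $ i - P $ i) < \<epsilon> i)))"
      unfolding \<rho>'(6)[OF w] using eqv[OF pw] by blast
    also have "\<dots> \<longleftrightarrow> (\<exists>z\<in>ball P \<rho>0. (\<forall>i<M. h i z = 0) \<and> (\<forall>i. i \<notin> insert j J \<longrightarrow> z $ i = w $ i) \<and>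
       (\<forall>i\<in>insert j J. norm (z $ i - P $ i) < (\<epsilon>(j := r)) i))" (is "?A \<longleftrightarrow> ?B")
    proof
      assume ?A
      then obtain t z where z: "norm t < r" "z \<in> ball P \<rho>0" "\<forall>i<M. h i z = 0"
        "\<forall>i. i \<notin> J \<longrightarrow> z $ i = ?p w t $ i" "\<forall>i\<in>J. norm (z $ i - P $ i) < \<epsilon> i" by blast
      have zj: "z $ j = P $ j + t" using z(4) insert.hyps(2) by (simp add: upd_nth)
      show ?B
        by (rule bexI[of _ z]) (use z zj insert.hyps(2) in \<open>auto simp: upd_nth\<close>)
    next
      assume ?B
      then obtain z where z: "z \<in> ball P \<rho>0" "\<forall>i<M. h i z = 0" "\<forall>i. i \<notin> insert j J \<longrightarrow> z $ i = w $ i"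
        "\<forall>i\<in>insert j J. norm (z $ i - P $ i) < (\<epsilon>(j := r)) i" by blast
      have "\<forall>i\<in>J. norm (z $ i - P $ i) < \<epsilon> i"
      proof
        fix i assume "i \<in> J"
        then show "norm (z $ i - P $ i) < \<epsilon> i"
          using bspec[OF z(4), of i] insert.hyps(2) by (cases "i = j") auto
      qed
      moreover have "norm (z $ j - P $ j) < r" using z(4) by auto
      ultimately show ?A
        using z by (intro exI[of _ "z $ j - P $ j"]) (auto simp: upd_nth intro!: bexI[of _ z])
    qed
    finally show "(\<forall>k<K. R' k w = 0) \<longleftrightarrow> (\<exists>z\<in>ball P \<rho>0. (\<forall>i<M. h i z = 0) \<and> (\<forall>i. i \<notin> insert j J \<longrightarrow> z $ i = w $ i) \<and>
       (\<forall>i\<in>insert j J. norm (z $ i - P $ i) < (\<epsilon>(j := r)) i))" .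
  qed
qed

section \<open>The maximum principle on analytic sets\<close>

definition common_zeros :: "(complex ^ 'n) set \<Rightarrow> (complex ^ 'n \<Rightarrow> complex) set \<Rightarrow> (complex ^ 'n) set" where
  "common_zeros U H = {z \<in> U. \<forall>h\<in>H. h z = 0}"

text \<open>The additional coordinate \<open>None\<close> will carry the value of \<open>q\<close>;
  the graph of \<open>q\<close> lives in this larger space.\<close>

definition proj_some :: "complex ^ ('n :: finite) option \<Rightarrow> complex ^ 'n" where
  "proj_some w = (\<chi> i. w $ Some i)"

definition lift_some :: "complex ^ 'n \<Rightarrow> complex \<Rightarrow> complex ^ ('n :: finite) option" where
  "lift_some z s = (\<chi> o'. case o' of None \<Rightarrow> s | Some i \<Rightarrow> z $ i)"

lemma lift_some_simps [simp]:
  "lift_some z s $ None = s" "lift_some z s $ Some i = z $ i" "proj_some (lift_some z s) = z"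
  "proj_some w $ i = w $ Some i" "lift_some (proj_some w) (w $ None) = w"
  by (auto simp: lift_some_def proj_some_def vec_eq_iff split: option.split)

lemma norm_vec_power2: "(norm v)\<^sup>2 = (\<Sum>i\<in>UNIV. (norm (v $ i))\<^sup>2)" for v :: "complex ^ 'k"
  unfolding norm_vec_def L2_set_def by (rule real_sqrt_pow2) (simp add: sum_nonneg)

lemma norm_option_vec:
  fixes w :: "complex ^ ('n :: finite) option"
  shows "(norm w)\<^sup>2 = (norm (w $ None))\<^sup>2 + (norm (proj_some w))\<^sup>2"
proof -
  have "sum f UNIV = f None + (\<Sum>i\<in>UNIV. f (Some i))" for f :: "'n option \<Rightarrow> real"
  proof -
    have "sum f UNIV = sum f (insert None (range Some))"
      by (simp only: UNIV_option_conv[symmetric])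
    also have "\<dots> = f None + sum f (range Some)" by (rule sum.insert) auto
    also have "sum f (range Some) = (\<Sum>i\<in>UNIV. f (Some i))" by (subst sum.reindex) auto
    finally show ?thesis .
  qed
  from this[of "\<lambda>i. (norm (w $ i))\<^sup>2"] show ?thesis
    unfolding norm_vec_power2[of w] norm_vec_power2[of "proj_some w"] by simp
qed

lemma norm_proj_some_le: "norm (proj_some w) \<le> norm w"
  using norm_option_vec[of w] by (auto intro: power2_le_imp_le[of "norm (proj_some w)"])

lemma norm_lift_some_le: "norm (lift_some z s) \<le> norm z + norm s"
  using norm_option_vec[of "lift_some z s"] by (auto simp: power2_sum intro: power2_le_imp_le[of "norm (lift_some z s)"])

lemma countable_isolated:
  fixes A :: "'a :: second_countable_topology set"
  shows "countable {z \<in> A. \<not> z islimpt A}"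
proof -
  obtain B :: "'a set set" where B: "countable B" "topological_basis B"
    using ex_countable_basis by blast
  let ?I = "{z \<in> A. \<not> z islimpt A}"
  have "\<exists>b\<in>B. z \<in> b \<and> b \<inter> A \<subseteq> {z}" if z: "z \<in> ?I" for z
  proof -
    obtain T where T: "open T" "z \<in> T" "\<forall>y\<in>A. y \<in> T \<longrightarrow> y = z"
      using z by (auto simp: islimpt_def)
    obtain b where "b \<in> B" "z \<in> b" "b \<subseteq> T"
      using topological_basisE[OF B(2) T(1,2)] by blast
    then show ?thesis using T(3) by blast
  qed
  then have "\<forall>z\<in>?I. \<exists>b. b \<in> B \<and> z \<in> b \<and> b \<inter> A \<subseteq> {z}" by auto
  from bchoice[OF this] obtain f
    where "\<forall>z\<in>?I. f z \<in> B \<and> z \<in> f z \<and> f z \<inter> A \<subseteq> {z}" ..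
  then have f: "f z \<in> B \<and> z \<in> f z \<and> f z \<inter> A \<subseteq> {z}" if "z \<in> ?I" for z
    using that by (rule bspec)
  have "inj_on f ?I"
  proof (rule inj_onI)
    fix x y assume xy: "x \<in> ?I" "y \<in> ?I" "f x = f y"
    have "y \<in> f x \<inter> A" using f[OF xy(2)] xy(2,3) by simp
    then show "x = y" using f[OF xy(1)] by auto
  qed
  moreover have "countable (f ` ?I)"
  proof (rule countable_subset[OF _ B(1)])
    show "f ` ?I \<subseteq> B" using f by (simp add: image_subset_iff)
  qed
  ultimately show ?thesis by (rule countable_image_inj_on[rotated])
qed

text \<open>The graph of \<open>q\<close> over the common zeros is projected to the axis of values of \<open>q\<close>; the image is
  the zero set of functions of one variable, hence discrete or everything.\<close>

lemma values_near_isolated_zero: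
  fixes H :: "(complex ^ 'n \<Rightarrow> complex) set"
  assumes fin: "finite H" and U: "open U" and H: "\<And>h. h \<in> H \<Longrightarrow> hol U h" and q: "hol U q"
    and p: "p \<in> U" "q p = 0" and lim: "p islimpt common_zeros U H"
    and r0: "r0 > 0" and iso: "\<And>z. z \<in> common_zeros U H \<Longrightarrow> dist p z < r0 \<Longrightarrow> q z = 0 \<Longrightarrow> z = p"
    and r: "r > 0"
  shows "\<exists>\<eta>>0. \<forall>s. norm s < \<eta> \<longrightarrow> (\<exists>z\<in>common_zeros U H \<inter> ball p r. q z = s)"
proof -
  obtain \<rho>1 where \<rho>1: "\<rho>1 > 0" "ball p \<rho>1 \<subseteq> U" using U p open_contains_ball by blast
  define \<rho>0 where "\<rho>0 = min \<rho>1 (min r0 r)"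
  have \<rho>0: "\<rho>0 > 0" "ball p \<rho>0 \<subseteq> U" "\<rho>0 \<le> r0" "\<rho>0 \<le> r"
    using \<rho>1 r0 r by (auto simp: \<rho>0_def)
  define P where "P = lift_some p 0"
  obtain e N where e: "H = e ` {i. i < (N::nat)}"
    using finite_imp_nat_seg_image_inj_on[OF fin] by blast
  \<comment> \<open>Equations of the graph of \<open>q\<close> over the common zeros of
    \<open>H\<close>: indices below \<open>N\<close> enumerate \<open>H\<close>, and the index
    \<open>N\<close> is the graph equation.\<close>
  define h where "h i w = (if i < N then e i (proj_some w) else q (proj_some w) - w $ None)" for i w
  have pr: "dist p (proj_some w) \<le> dist P w" for w
    using norm_proj_some_le[of "P - w"] by (simp add: dist_norm P_def proj_some_def vec_eq_iff minus_vec_def)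
  have comp: "hol (ball P \<rho>0) (\<lambda>w. f (proj_some w))" if "hol U f" for f
  proof (rule hol_affine[OF that, where L = proj_some])
    show "continuous_on (ball P \<rho>0) proj_some"
      unfolding proj_some_def by (intro continuous_intros)
    show "proj_some ` ball P \<rho>0 \<subseteq> U" using le_less_trans[OF pr] \<rho>0(2) by (force simp: subset_iff)
  qed (simp add: vec_eq_iff)
  have hh: "hol (ball P \<rho>0) (h i)" for i
    unfolding h_def by (cases "i < N") (auto intro!: comp H q hol_diff hol_component simp: e)
  have zeros: "(\<forall>i<N + 1. h i w = 0) \<longleftrightarrow> (\<forall>f\<in>H. f (proj_some w) = 0) \<and> q (proj_some w) = w $ None" for w
    unfolding e h_def by (auto simp: less_Suc_eq)
  have "\<exists>\<rho> \<epsilon> M' R. eliminates (range Some) P \<rho>0 (N + 1) h \<rho> \<epsilon> M' R"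
  proof (rule eliminate_coordinates[where s = None])
    fix w assume w: "w \<in> ball P \<rho>0" "\<forall>i<N + 1. h i w = 0" "w $ None = P $ None"
    then have "dist p (proj_some w) < \<rho>0" using le_less_trans[OF pr] by simp
    moreover from this have "proj_some w \<in> U" using \<rho>0(2) by auto
    moreover have "q (proj_some w) = 0" "\<forall>f\<in>H. f (proj_some w) = 0"
      using w zeros by (auto simp: P_def)
    ultimately have wp: "proj_some w = p"
      using \<rho>0(3) by (intro iso) (auto simp: common_zeros_def)
    have "w = lift_some (proj_some w) (w $ None)" by simp
    also have "\<dots> = P" unfolding wp w(3) by (simp add: P_def)
    finally show "w = P" .
  qed (use \<rho>0 hh in auto)
  then obtain \<rho> \<epsilon> M' R where el: "eliminates (range Some) P \<rho>0 (N + 1) h \<rho> \<epsilon> M' R"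
    by (elim exE)
  note \<rho> = eliminatesD(1)[OF el] and \<epsilon> = eliminatesD(2)[OF el] and R = eliminatesD(3)[OF el]
    and eqv = eliminatesD(5)[OF el]
  let ?w = "\<lambda>s. P + s *s axis None 1"
  have wN: "?w s $ None = s" for s by (simp add: P_def axis_def)
  have wb: "?w s \<in> ball P \<rho>" if "norm s < \<rho>" for s
    using that by (simp add: dist_norm norm_axis_smult)
  have hl: "(\<lambda>s. R i (?w s)) holomorphic_on ball 0 \<rho>" if "i < M'" for i
    by (rule holomorphic_on_subset[OF hol_line[OF R[OF that]]]) (use wb in auto)
  define S where "S = {s \<in> ball 0 \<rho>. \<forall>i<M'. R i (?w s) = 0}"
  \<comment> \<open>Common zeros accumulate at \<open>p\<close>, and near \<open>p\<close> none of
    them except \<open>p\<close> has value 0, so \<open>q\<close> attains nonzero values arbitrarily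
    close to 0.\<close>
  have limS: "0 islimpt S"
    unfolding islimpt_approachable
  proof (intro allI impI)
    fix e' :: real assume e': "e' > 0"
    define em where "em = Min (range (\<lambda>i. \<epsilon> (Some i)))"
    have em: "em > 0" "\<And>i. em \<le> \<epsilon> (Some i)" using \<epsilon> by (auto simp: em_def)
    define e1 where "e1 = min e' (min \<rho> (\<rho>0 / 2))"
    have e1: "e1 > 0" "e1 \<le> e'" "e1 \<le> \<rho>" "e1 \<le> \<rho>0 / 2" using e' \<rho> \<rho>0 by (auto simp: e1_def)
    have "isCont q p" using hol_continuous[OF q] U p(1) by (simp add: continuous_on_eq_continuous_at)
    then obtain d where d: "d > 0" "\<And>z. dist z p < d \<Longrightarrow> dist (q z) (q p) < e1"
      using e1(1) unfolding continuous_at_eps_delta by blast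
    define d1 where "d1 = min d (min em (\<rho>0 / 2))"
    have d1: "d1 > 0" "d1 \<le> d" "d1 \<le> em" "d1 \<le> \<rho>0 / 2" using d em \<rho>0 by (auto simp: d1_def)
    obtain z where z: "z \<in> common_zeros U H" "z \<noteq> p" "dist z p < d1"
      using lim d1(1) unfolding islimpt_approachable by blast
    have s1: "norm (q z) < e1" using d(2)[of z] z(3) d1(2) p(2) by simp
    have "q z \<noteq> 0"
      using iso[OF z(1)] z(2,3) d1(4) \<rho>0 by (auto simp: dist_commute)
    moreover have "q z \<in> S"
    proof -
      have "norm (lift_some (z - p) (q z)) < \<rho>0"
        using norm_lift_some_le[of "z - p" "q z"] z(3) s1 d1(4) e1(4) by (simp add: dist_norm)
      moreover have "lift_some (z - p) (q z) = lift_some z (q z) - P"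
        by (auto simp: P_def vec_eq_iff lift_some_def split: option.split)
      ultimately have "lift_some z (q z) \<in> ball P \<rho>0" by (simp add: dist_norm norm_minus_commute)
      moreover have "norm (z $ i - p $ i) < \<epsilon> (Some i)" for i
        using Finite_Cartesian_Product.norm_nth_le[of "z - p" i] z(3) d1(3) em(2)[of i] by (simp add: dist_norm)
      ultimately have "\<exists>Z\<in>ball P \<rho>0. (\<forall>i<N + 1. h i Z = 0) \<and>
       (\<forall>i. i \<notin> range Some \<longrightarrow> Z $ i = ?w (q z) $ i) \<and> (\<forall>i\<in>range Some. norm (Z $ i - P $ i) < \<epsilon> i)"
        using z(1) zeros
        by (intro bexI[of _ "lift_some z (q z)"])
          (auto simp: common_zeros_def P_def axis_def notin_range_Some)
      then show ?thesis
        using eqv[OF wb[of "q z"]] s1 e1(3) by (simp add: S_def)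
    qed
    ultimately show "\<exists>x'\<in>S. x' \<noteq> 0 \<and> dist x' 0 < e'"
      using s1 e1(2) by (intro bexI[of _ "q z"]) auto
  qed
  have Rz: "R i (?w s) = 0" if "i < M'" "norm s < \<rho>" for i s
    by (rule analytic_continuation[OF hl[OF that(1)] open_ball _ _ _ limS])
      (use that \<rho> in \<open>auto simp: S_def\<close>)
  show ?thesis
  proof (intro exI[of _ \<rho>] conjI allI impI)
    fix s :: complex assume s: "norm s < \<rho>"
    have "\<forall>i<M'. R i (?w s) = 0" using Rz s by blast
    then obtain Z where Z: "Z \<in> ball P \<rho>0" "\<forall>i<N + 1. h i Z = 0" "\<forall>i. i \<notin> range Some \<longrightarrow> Z $ i = ?w s $ i"
      using eqv[OF wb[OF s]] by blast
    have "Z $ None = s" using Z(3)[rule_format, of None] wN by auto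
    moreover have d: "dist p (proj_some Z) < \<rho>0" using le_less_trans[OF pr] Z(1) by simp
    moreover have "proj_some Z \<in> U" using d \<rho>0(2) by auto
    ultimately show "\<exists>z\<in>common_zeros U H \<inter> ball p r. q z = s"
      using Z(2) zeros \<rho>0(4) by (intro bexI[of _ "proj_some Z"]) (auto simp: common_zeros_def)
  qed (rule \<rho>)
qed

lemma inner_hprod: "x \<bullet> y = Re (hprod x y)"
  by (simp add: inner_vec_def hprod_def inner_complex_def)

lemma hol_hprod: "hol U (\<lambda>z. hprod (z - p) c)"
  unfolding hprod_def by (intro hol_sum hol_mult) (auto intro!: hol_diff hol_component)

text \<open>Countably many real hyperplanes form a negligible set. Avoiding real orthogonality is
  enough, since the inner product is the real part of \<open>hprod\<close>.\<close>

lemma exists_nonorthogonal_to_countable: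
  assumes "countable D" "0 \<notin> D"
  shows "\<exists>c :: complex ^ 'n. \<forall>v\<in>D. hprod v c \<noteq> 0"
proof -
  have "negligible (\<Union>v\<in>D. {c. v \<bullet> c = 0})"
    using assms by (intro negligible_countable_Union) (auto intro!: negligible_hyperplane)
  then have "(\<Union>v\<in>D. {c :: complex ^ 'n. v \<bullet> c = 0}) \<noteq> UNIV"
    by (metis non_negligible_UNIV)
  then obtain c where "c \<notin> (\<Union>v\<in>D. {c :: complex ^ 'n. v \<bullet> c = 0})" by blast
  then show ?thesis by (intro exI[of _ c]) (auto simp: inner_hprod)
qed

text \<open>A maximum principle with peak function \<open>e\<^sup>q\<close>: near \<open>p\<close> the function \<open>q\<close> takes all small values on the
  analytic set, but it can take positive ones only at isolated points, which are countably many.\<close>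

lemma no_strict_peak_on_derived_set:
  fixes H :: "(complex ^ 'n \<Rightarrow> complex) set"
  assumes fin: "finite H" and U: "open U" and H: "\<And>h. h \<in> H \<Longrightarrow> hol U h" and q: "hol U q"
    and p: "p \<in> U" "q p = 0" and lim: "p islimpt common_zeros U H"
    and r: "r > 0" and peak: "\<And>z. z \<in> ball p r \<Longrightarrow> z islimpt common_zeros U H \<Longrightarrow> z \<noteq> p \<Longrightarrow> Re (q z) < 0"
  shows False
proof -
  let ?V = "common_zeros U H"
  obtain r1 where r1: "r1 > 0" "ball p r1 \<subseteq> U" "r1 \<le> r"
  proof -
    obtain \<rho>1 where "\<rho>1 > 0" "ball p \<rho>1 \<subseteq> U" using U p open_contains_ball by blast
    then show thesis using r by (intro that[of "min \<rho>1 r"]) auto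
  qed
  \<comment> \<open>The point \<open>p\<close> must first be isolated in the fibre
    \<open>q = 0\<close>. Otherwise \<open>peak\<close> leaves \<open>p\<close> as the only possible
    limit point of that fibre near \<open>p\<close>, so the fibre is countable there. A linear
    function that vanishes at none of its other points would then take an open set of values on
    it.\<close>
  have "\<exists>r0>0. \<forall>z\<in>?V. dist p z < r0 \<longrightarrow> q z = 0 \<longrightarrow> z = p"
  proof (rule ccontr)
    assume neg: "\<not> ?thesis"
    let ?V2 = "common_zeros (ball p r1) (insert q H)"
    have sub: "?V2 \<subseteq> ?V" using r1 by (auto simp: common_zeros_def)
    have lim2: "p islimpt ?V2"
      unfolding islimpt_approachable
    proof (intro allI impI)
      fix e :: real assume "e > 0"
      then have "min e r1 > 0" using r1 by simp
      then obtain z where z: "z \<in> ?V" "dist p z < min e r1" "q z = 0" "z \<noteq> p" using neg by blast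
      then show "\<exists>x'\<in>?V2. x' \<noteq> p \<and> dist x' p < e"
        by (intro bexI[of _ z]) (auto simp: common_zeros_def dist_commute)
    qed
    have "?V2 - {p} \<subseteq> {z \<in> ?V2. \<not> z islimpt ?V2}"
    proof
      fix z assume z: "z \<in> ?V2 - {p}"
      have "\<not> z islimpt ?V2"
      proof
        assume "z islimpt ?V2"
        then have "z islimpt ?V" using islimpt_subset sub by blast
        then have "Re (q z) < 0" using z r1 by (intro peak) (auto simp: common_zeros_def)
        then show False using z by (auto simp: common_zeros_def)
      qed
      then show "z \<in> {z \<in> ?V2. \<not> z islimpt ?V2}" using z by blast
    qed
    then have "countable (?V2 - {p})"
      using countable_isolated countable_subset by blast
    then have cV2: "countable ?V2" by simp
    then have "countable ((\<lambda>z. z - p) ` (?V2 - {p}))" by simp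
    then have "\<exists>c. \<forall>v\<in>(\<lambda>z. z - p) ` (?V2 - {p}). hprod v c \<noteq> 0"
      by (rule exists_nonorthogonal_to_countable) auto
    then obtain c where c: "\<And>v. v \<in> (\<lambda>z. z - p) ` (?V2 - {p}) \<Longrightarrow> hprod v c \<noteq> 0" by blast
    let ?q = "\<lambda>z. hprod (z - p) c"
    have "\<exists>\<eta>>0. \<forall>s. norm s < \<eta> \<longrightarrow> (\<exists>z\<in>?V2 \<inter> ball p 1. ?q z = s)"
    proof (rule values_near_isolated_zero[where r0 = 1])
      show "finite (insert q H)" using fin by simp
      show "hol (ball p r1) h" if "h \<in> insert q H" for h
        using that q H hol_subset[OF _ r1(2)] by auto
      show "?q p = 0" by (simp add: hprod_def)
      show "z = p" if "z \<in> ?V2" "?q z = 0" for z using c that by blast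
    qed (use r1 lim2 in \<open>auto simp: hol_hprod\<close>)
    then obtain \<eta> where "\<eta> > 0" "\<And>s. norm s < \<eta> \<Longrightarrow> s \<in> ?q ` ?V2" by blast
    then have "ball 0 \<eta> \<subseteq> ?q ` ?V2" by auto
    moreover have "countable (?q ` ?V2)" using cV2 by simp
    ultimately show False
      using uncountable_ball[OF \<open>\<eta> > 0\<close>, of "0 :: complex"] countable_subset by blast
  qed
  then obtain r0 where r0: "r0 > 0" "\<And>z. z \<in> ?V \<Longrightarrow> dist p z < r0 \<Longrightarrow> q z = 0 \<Longrightarrow> z = p" by blast
  obtain \<eta> where \<eta>: "\<eta> > 0" "\<And>s. norm s < \<eta> \<Longrightarrow> \<exists>z\<in>?V \<inter> ball p r. q z = s"
    using values_near_isolated_zero[OF fin U H q p lim r0 r] by blast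
  have "complex_of_real ` {0<..<\<eta>} \<subseteq> q ` {z \<in> ?V. \<not> z islimpt ?V}"
  proof
    fix s assume "s \<in> complex_of_real ` {0<..<\<eta>}"
    then obtain x where x: "s = of_real x" "0 < x" "x < \<eta>" by auto
    then obtain z where z: "z \<in> ?V" "z \<in> ball p r" "q z = s" using \<eta>(2)[of s] by auto
    have "z \<noteq> p" using z(3) p(2) x by auto
    then have "\<not> z islimpt ?V" using peak[of z] z x by auto
    then show "s \<in> q ` {z \<in> ?V. \<not> z islimpt ?V}" using z by blast
  qed
  then have "countable (complex_of_real ` {0<..<\<eta>})"
    by (rule countable_subset[OF _ countable_image[OF countable_isolated]])
  then have "countable {0<..<\<eta>}"
    by (rule countable_image_inj_on) (simp add: inj_on_def)
  then show False using \<eta>(1) uncountable_open_interval by blast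
qed

text \<open>If \<open>p\<close> were isolated, all nearby fibres of \<open>H\<close> would be compact; but at a generic point the fibre
  contains a curve, and a point of its derived set farthest from \<open>p\<close> contradicts the maximum principle.\<close>

lemma islimpt_common_zeros:
  fixes H :: "(complex ^ 'n \<Rightarrow> complex) set"
  assumes fin: "finite H" and card: "card H < CARD('n)" and U: "open U"
    and H: "\<And>h. h \<in> H \<Longrightarrow> hol U h" and p: "p \<in> common_zeros U H"
  shows "p islimpt common_zeros U H"
proof (rule ccontr)
  assume "\<not> ?thesis"
  then obtain e where e: "e > 0" "\<And>z. z \<in> common_zeros U H \<Longrightarrow> dist z p < e \<Longrightarrow> z = p"
    unfolding islimpt_approachable by blast
  have pU: "p \<in> U" "\<And>h. h \<in> H \<Longrightarrow> h p = 0" using p by (auto simp: common_zeros_def)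
  obtain r1 where r1: "r1 > 0" "cball p r1 \<subseteq> U" using U pU open_contains_cball by blast
  define r where "r = min r1 (e / 2)"
  have r: "r > 0" "cball p r \<subseteq> U" "r < e" using r1 e by (auto simp: r_def)
  define N where "N z = (\<Sum>h\<in>H. norm (h z))" for z
  have Nc: "continuous_on (cball p r) N"
    unfolding N_def using r(2)
    by (intro continuous_intros continuous_on_subset[OF hol_continuous[OF H]]) auto
  have "\<exists>z0\<in>sphere p r. \<forall>z\<in>sphere p r. N z0 \<le> N z"
    using r by (intro continuous_attains_inf continuous_on_subset[OF Nc]) auto
  then obtain z0 where z0: "z0 \<in> sphere p r" "\<And>z. z \<in> sphere p r \<Longrightarrow> N z0 \<le> N z" by blast
  define \<delta> where "\<delta> = N z0"
  have \<delta>: "\<delta> > 0"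
  proof (rule ccontr)
    assume "\<not> \<delta> > 0"
    moreover have "N z0 \<ge> 0" by (simp add: N_def sum_nonneg)
    ultimately have "N z0 = 0" by (simp add: \<delta>_def)
    then have "\<forall>h\<in>H. h z0 = 0" using fin by (simp add: N_def sum_nonneg_eq_0_iff)
    then have "z0 \<in> common_zeros U H" using z0(1) r(2) by (auto simp: common_zeros_def)
    then have "z0 = p" using e(2) z0(1) r(3) by (simp add: dist_commute)
    then show False using z0(1) r(1) by simp
  qed
  \<comment> \<open>\<open>N\<close> is constant on each fibre of \<open>H\<close>. A fibre through
    a point of \<open>O'\<close> lies below the minimum \<open>\<delta>\<close> of \<open>N\<close>
    on the sphere, so it never reaches the sphere.\<close>
  define O' where "O' = {z \<in> ball p r. N z < \<delta>}"
  have "open O'"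
  proof -
    have "continuous_on (ball p r) N" by (rule continuous_on_subset[OF Nc]) auto
    then have "open (N -` {..<\<delta>} \<inter> ball p r)" by (intro continuous_on_open_vimage[THEN iffD1, rule_format]) auto
    then show ?thesis by (simp add: O'_def vimage_def Int_def conj_commute)
  qed
  moreover have "N p = 0" unfolding N_def by (rule sum.neutral) (use pU in auto)
  then have "p \<in> O'" using \<delta> r by (simp add: O'_def)
  moreover have OU: "O' \<subseteq> U" using r by (auto simp: O'_def)
  \<comment> \<open>The rank of \<open>H\<close> may drop at \<open>p\<close>, so the chart is taken
    wherever in \<open>O'\<close> the rank theorem provides one; a fibre through any point of
    \<open>O'\<close> is confined in the same way.\<close>
  ultimately have "\<exists>U W \<phi> \<psi>. \<exists>J :: 'n set. chart U W \<phi> \<psi> \<and> U \<subseteq> O' \<and> U \<noteq> {} \<and> card J \<le> card H \<and>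
    (\<forall>h\<in>H. \<forall>w\<in>W. \<forall>l. l \<notin> J \<longrightarrow> dird (\<lambda>w. h (\<psi> w)) (axis l 1) w = 0)"
    by (intro rank_chart[OF fin]) (auto intro: hol_subset[OF H])
  then obtain U1 W \<phi> \<psi> and J :: "'n set" where c: "chart U1 W \<phi> \<psi>" and U1: "U1 \<subseteq> O'" "U1 \<noteq> {}"
    and J: "card J \<le> card H"
    and dz: "\<And>h w l. h \<in> H \<Longrightarrow> w \<in> W \<Longrightarrow> l \<notin> J \<Longrightarrow> dird (\<lambda>w. h (\<psi> w)) (axis l 1) w = 0"
    by (elim exE conjE) blast
  have W: "open W" and hom: "homeomorphism U1 W \<phi> \<psi>" and hpsi: "holo_on \<psi> W"
    using c by (auto simp: chart_def)
  \<comment> \<open>Fewer functions than coordinates leave a direction \<open>l\<close> along which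
    all functions of \<open>H\<close> are constant in the chart; it gives the curve through
    \<open>b\<close>.\<close>
  have "J \<noteq> UNIV" using J card by auto
  then obtain l where l: "l \<notin> J" by blast
  obtain b where b: "b \<in> U1" using U1 by blast
  define Vc where "Vc = common_zeros (ball p r) ((\<lambda>h z. h z - h b) ` H)"
  have Vc: "z \<in> Vc \<longleftrightarrow> z \<in> ball p r \<and> (\<forall>h\<in>H. h z = h b)" for z
    by (auto simp: Vc_def common_zeros_def)
  have bb: "b \<in> ball p r" "N b < \<delta>" using b U1 by (auto simp: O'_def)
  have w0: "\<phi> b \<in> W" "\<psi> (\<phi> b) = b" using hom b by (auto simp: homeomorphism_def)
  obtain \<rho> where \<rho>: "\<rho> > 0" "ball (\<phi> b) \<rho> \<subseteq> W" using W w0 open_contains_ball by blast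
  let ?c = "\<lambda>t. \<phi> b + t *s axis l 1"
  have cW: "?c t \<in> W" if "norm t < \<rho>" for t
    using that \<rho>(2) by (auto simp: dist_norm norm_axis_smult subset_iff)
  have curve: "\<psi> (?c t) \<in> Vc" if t: "norm t < \<rho>" for t
  proof -
    have "\<psi> (?c t) \<in> U1" using cW[OF t] hom by (auto simp: homeomorphism_def)
    moreover have "h (\<psi> (?c t)) = h b" if h: "h \<in> H" for h
    proof -
      have hW: "hol W (\<lambda>w. h (\<psi> w))"
        by (rule hol_compose[OF U H[OF h] hpsi]) (use hom U1 OU in \<open>auto simp: homeomorphism_def\<close>)
      have "((\<lambda>t. h (\<psi> (?c t))) has_field_derivative 0) (at x within ball 0 \<rho>)" if "x \<in> ball 0 \<rho>" for x
        using hol_line_deriv[OF hW, of "\<phi> b" x "axis l 1"] cW[of x] dz[OF h _ l] that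
        by (auto intro: has_field_derivative_at_within)
      then have "\<exists>k. \<forall>t\<in>ball 0 \<rho>. h (\<psi> (?c t)) = k"
        by (intro has_field_derivative_zero_constant) auto
      then obtain k where k: "\<And>t. t \<in> ball 0 \<rho> \<Longrightarrow> h (\<psi> (?c t)) = k" by blast
      have "h (\<psi> (?c t)) = h (\<psi> (?c 0))" using k[of t] k[of 0] t \<rho>(1) by simp
      then show ?thesis using w0 by simp
    qed
    ultimately show ?thesis using U1 by (auto simp: Vc O'_def)
  qed
  have blim: "b islimpt Vc"
    unfolding islimpt_approachable
  proof (intro allI impI)
    fix e' :: real assume e': "e' > 0"
    have "continuous_on W \<psi>" using hom by (simp add: homeomorphism_def)
    then obtain d where d: "d > 0" "\<And>w. w \<in> W \<Longrightarrow> dist w (\<phi> b) < d \<Longrightarrow> dist (\<psi> w) (\<psi> (\<phi> b)) < e'"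
      using w0(1) e' unfolding continuous_on_iff by blast
    define t where "t = complex_of_real (min d \<rho> / 2)"
    have t: "norm t < \<rho>" "norm t < d" "t \<noteq> 0" using d \<rho> by (auto simp: t_def)
    have "dist (?c t) (\<phi> b) < d" using t(2) by (simp add: dist_norm norm_axis_smult)
    then have "dist (\<psi> (?c t)) b < e'" using d(2)[OF cW[OF t(1)]] w0 by simp
    moreover have "\<psi> (?c t) \<noteq> b"
    proof
      assume "\<psi> (?c t) = b"
      then have "?c t = \<phi> b" using cW[OF t(1)] hom by (metis homeomorphism_apply2)
      then show False using t(3) by (simp add: axis_eq_0_iff)
    qed
    ultimately show "\<exists>x'\<in>Vc. x' \<noteq> b \<and> dist x' b < e'" using curve[OF t(1)] by blast
  qed
  define D where "D = {z \<in> cball p r. z islimpt Vc}"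
  have D: "z \<in> ball p r" if "z \<in> D" for z
  proof -
    define F where "F = {z \<in> cball p r. N z = N b}"
    have clF: "closed F"
      using continuous_closed_preimage_constant[OF Nc] by (simp add: F_def vimage_def Int_def)
    have "Vc \<subseteq> F" by (auto simp: F_def Vc N_def intro!: sum.cong arg_cong[of _ _ norm])
    then have "z islimpt F" using that islimpt_subset by (auto simp: D_def)
    then have "z \<in> F" using clF closed_limpt[of F] by simp
    then have "z \<in> {z \<in> cball p r. N z = N b}" by (simp only: F_def)
    then have "z \<in> cball p r" "N z < \<delta>" using bb by auto
    then show ?thesis using z0(2)[of z] by (auto simp: \<delta>_def le_less)
  qed
  have "compact D"
  proof -
    have "D = cball p r \<inter> {z. z islimpt Vc}" by (auto simp: D_def)
    then show ?thesis by (simp add: compact_Int_closed closed_limpts)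
  qed
  moreover have "b \<in> D" using blim bb by (simp add: D_def less_imp_le)
  then have "D \<noteq> {}" by blast
  moreover have "continuous_on D (dist p)" by (intro continuous_intros)
  ultimately obtain a where a: "a \<in> D" "\<And>z. z \<in> D \<Longrightarrow> dist p z \<le> dist p a"
    using continuous_attains_sup[of D "dist p"] by blast
  have ab: "a \<in> ball p r" using D a by blast
  then obtain r2 where r2: "r2 > 0" "ball a r2 \<subseteq> ball p r" using open_contains_ball[of "ball p r"] by blast
  \<comment> \<open>\<open>a\<close> is farthest from \<open>p\<close> in the derived set. Expanding
    \<open>(norm (z - p))\<^sup>2\<close> about \<open>a\<close> turns this into a negative real
    part of a linear function, strictly because of the term
    \<open>(norm (z - a))\<^sup>2\<close>.\<close>
  show False
  proof (rule no_strict_peak_on_derived_set[where q = "\<lambda>z. hprod (z - a) (a - p)"])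
    show "finite ((\<lambda>h z. h z - h b) ` H)" using fin by simp
    have br: "ball p r \<subseteq> U" using r(2) ball_subset_cball[of p r] by blast
    show "hol (ball p r) h" if h: "h \<in> (\<lambda>h z. h z - h b) ` H" for h
    proof -
      obtain g where g: "g \<in> H" "h = (\<lambda>z. g z - g b)" using h by blast
      show ?thesis unfolding g(2) by (intro hol_diff hol_const hol_subset[OF H[OF g(1)] br])
    qed
    show "a islimpt common_zeros (ball p r) ((\<lambda>h z. h z - h b) ` H)"
      using a(1) by (simp add: D_def Vc_def)
    fix z assume z: "z \<in> ball a r2" "z islimpt common_zeros (ball p r) ((\<lambda>h z. h z - h b) ` H)" "z \<noteq> a"
    then have "z \<in> D" using r2 by (auto simp: D_def Vc_def)
    then have "(norm (z - p))\<^sup>2 \<le> (norm (a - p))\<^sup>2"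
      using a(2)[of z] by (simp add: dist_norm norm_minus_commute)
    moreover have "(norm (z - p))\<^sup>2 = (norm (z - a))\<^sup>2 + 2 * ((z - a) \<bullet> (a - p)) + (norm (a - p))\<^sup>2"
      unfolding power2_norm_eq_inner by (simp add: inner_diff inner_commute algebra_simps)
    moreover have "(norm (z - a))\<^sup>2 > 0" using z(3) by simp
    ultimately have "(z - a) \<bullet> (a - p) < 0" by linarith
    then show "Re (hprod (z - a) (a - p)) < 0" by (simp add: inner_hprod)
  next
    show "hprod (a - a) (a - p) = 0" by (simp add: hprod_def)
  qed (use r2 ab in \<open>auto intro: hol_hprod\<close>)
qed

section \<open>Imaginary parts of zeros of exponential sums\<close>

definition imv :: "complex ^ 'n \<Rightarrow> real ^ 'n" where
  "imv z = (\<chi> j. Im (z $ j))"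

lemma norm_expo: "norm (expo l z) = exp (- (imv z \<bullet> l))"
  by (simp add: expo_def hprod_def cvec_def imv_def inner_vec_def sum_negf norm_exp_eq_Re)

text \<open>The sum of absolute values is a norm on \<open>T\<close>, and compactness of the unit
  sphere of \<open>T\<close> compares it with the given one.\<close>

lemma bounded_by_separating_functionals:
  fixes T :: "'a :: euclidean_space set"
  assumes T: "subspace T" and E: "finite E"
    and sep: "\<And>x. x \<in> T \<Longrightarrow> \<forall>e\<in>E. x \<bullet> e = 0 \<Longrightarrow> x = 0"
  obtains C where "C \<ge> 0" "\<And>x. x \<in> T \<Longrightarrow> norm x \<le> C * (\<Sum>e\<in>E. \<bar>x \<bullet> e\<bar>)"
proof -
  let ?f = "\<lambda>x. \<Sum>e\<in>E. \<bar>x \<bullet> e\<bar>"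
  let ?K = "T \<inter> sphere 0 1"
  have K: "x /\<^sub>R norm x \<in> ?K" if "x \<in> T" "x \<noteq> 0" for x
    using that T by (simp add: subspace_scale)
  show thesis
  proof (cases "?K = {}")
    case True
    then have "x = 0" if "x \<in> T" for x using K that by blast
    then show ?thesis by (intro that[of 0]) auto
  next
    case False
    have "compact ?K" using T by (simp add: closed_subspace closed_Int_compact)
    moreover have "continuous_on ?K ?f" by (intro continuous_intros)
    ultimately obtain x0 where x0: "x0 \<in> ?K" "\<And>x. x \<in> ?K \<Longrightarrow> ?f x0 \<le> ?f x"
      using continuous_attains_inf[of ?K ?f] False by blast
    have pos: "?f x0 > 0"
    proof (rule ccontr)
      assume "\<not> ?f x0 > 0"
      moreover have "?f x0 \<ge> 0" by (simp add: sum_nonneg)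
      ultimately have "?f x0 = 0" by simp
      then have "\<forall>e\<in>E. x0 \<bullet> e = 0" using E by (simp add: sum_nonneg_eq_0_iff)
      then have "x0 = 0" using sep x0(1) by blast
      then show False using x0(1) by simp
    qed
    show ?thesis
    proof (rule that[of "1 / ?f x0"])
      show "1 / ?f x0 \<ge> 0" using pos by simp
      fix x assume x: "x \<in> T"
      show "norm x \<le> 1 / ?f x0 * ?f x"
      proof (cases "x = 0")
        case False
        have "?f x0 \<le> ?f (x /\<^sub>R norm x)" using x0(2) K[OF x False] by blast
        also have "\<dots> = ?f x / norm x"
          by (simp add: abs_mult sum_distrib_left[symmetric] divide_inverse mult.commute)
        finally show ?thesis using pos False by (simp add: field_simps)
      qed simp
    qed
  qed
qed

text \<open>A generic \<open>e\<close> is orthogonal to none of finitely many vectors, one chosen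
  from each nonzero subspace. Its hyperplane therefore lowers all positive dimensions at once, and
  \<open>k\<close> rounds suffice.\<close>

lemma exists_separating_set:
  fixes \<T> :: "(real ^ 'n) set set"
  assumes "finite \<T>" "\<And>T. T \<in> \<T> \<Longrightarrow> subspace T \<and> dim T \<le> k"
  shows "\<exists>E. finite E \<and> card E \<le> k \<and> (\<forall>T\<in>\<T>. \<forall>x\<in>T. (\<forall>e\<in>E. x \<bullet> e = 0) \<longrightarrow> x = 0)"
  using assms
proof (induction k arbitrary: \<T>)
  case 0
  then have "\<forall>T\<in>\<T>. T \<subseteq> {0}" by (metis dim_eq_0 le_zero_eq)
  then show ?case by (intro exI[of _ "{}"]) auto
next
  case (Suc k)
  let ?N = "{T \<in> \<T>. \<not> T \<subseteq> {0}}"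
  have "\<forall>T\<in>?N. \<exists>x. x \<in> T \<and> x \<noteq> 0" by blast
  from bchoice[OF this] obtain w where w: "\<forall>T\<in>?N. w T \<in> T \<and> w T \<noteq> 0" ..
  have "negligible (\<Union>T\<in>?N. {e. w T \<bullet> e = 0})"
    using Suc.prems(1) w by (intro negligible_Union) (auto intro!: negligible_hyperplane)
  then have "(\<Union>T\<in>?N. {e. w T \<bullet> e = 0}) \<noteq> UNIV" by (metis non_negligible_UNIV)
  then obtain e where e: "e \<notin> (\<Union>T\<in>?N. {e. w T \<bullet> e = 0})" by blast
  let ?r = "\<lambda>T. T \<inter> {x. x \<bullet> e = 0}"
  have sub_e: "subspace {x. x \<bullet> e = 0}"
    using subspace_hyperplane[of e] by (simp add: inner_commute)
  have "\<exists>E. finite E \<and> card E \<le> k \<and> (\<forall>T\<in>?r ` \<T>. \<forall>x\<in>T. (\<forall>e\<in>E. x \<bullet> e = 0) \<longrightarrow> x = 0)"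
  proof (rule Suc.IH)
    show "finite (?r ` \<T>)" using Suc.prems(1) by simp
    fix T' assume "T' \<in> ?r ` \<T>"
    then obtain T where T: "T \<in> \<T>" "T' = ?r T" by blast
    have sT: "subspace T" "dim T \<le> Suc k" using Suc.prems(2) T(1) by auto
    have sT': "subspace T'" unfolding T(2) by (intro subspace_inter sT sub_e)
    moreover have "dim T' \<le> k"
    proof (cases "T \<subseteq> {0}")
      case True
      then have "dim T' = 0" using T(2) by (subst dim_eq_0) auto
      then show ?thesis by linarith
    next
      case False
      then have "w T \<in> T" "w T \<notin> T'" using w e T by auto
      then have "span T' \<subset> span T"
        using T(2) sT sT' by (simp add: span_eq_iff[THEN iffD2] psubset_eq) blast
      then have "dim T' < dim T" by (rule dim_psubset)
      then show ?thesis using sT(2) by simp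
    qed
    ultimately show "subspace T' \<and> dim T' \<le> k" by blast
  qed
  then obtain E where E: "finite E" "card E \<le> k"
    "\<forall>T\<in>?r ` \<T>. \<forall>x\<in>T. (\<forall>e\<in>E. x \<bullet> e = 0) \<longrightarrow> x = 0" by (elim exE conjE)
  have "x = 0" if "T \<in> \<T>" "x \<in> T" "\<forall>e\<in>insert e E. x \<bullet> e = 0" for T x
    using bspec[OF bspec[OF E(3), of "?r T"], of x] that by simp
  moreover have "card (insert e E) \<le> Suc k" using E(1,2) by (simp add: card_insert_if)
  ultimately show ?case using E(1) by (intro exI[of _ "insert e E"]) blast
qed

text \<open>Both alternatives pass to subsequences, so the sequences can be treated one at a
  time.\<close>

lemma subsequence_bounded_or_at_top:
  fixes \<delta> :: "'q \<Rightarrow> nat \<Rightarrow> real"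
  assumes "finite Q"
  shows "\<exists>r. strict_mono r \<and> (\<forall>q\<in>Q. (\<exists>B. \<forall>j. \<delta> q (r j) \<le> B) \<or> filterlim (\<lambda>j. \<delta> q (r j)) at_top sequentially)"
  using assms
proof (induction Q rule: finite_induct)
  case empty
  then show ?case by (intro exI[of _ "\<lambda>j. j"]) (simp add: strict_mono_def)
next
  case (insert q Q)
  then obtain r where r: "strict_mono r"
    "\<And>q. q \<in> Q \<Longrightarrow> (\<exists>B. \<forall>j. \<delta> q (r j) \<le> B) \<or> filterlim (\<lambda>j. \<delta> q (r j)) at_top sequentially" by blast
  show ?case
  proof (cases "\<exists>B. \<forall>j. \<delta> q (r j) \<le> B")
    case True
    then show ?thesis using r by blast
  next
    case False
    have big: "\<exists>j>N. \<delta> q (r j) \<ge> B" for N B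
    proof (rule ccontr)
      assume "\<not> ?thesis"
      then have "\<delta> q (r j) \<le> max B (Max ((\<lambda>j. \<delta> q (r j)) ` {..N}))" for j
        by (cases "j \<le> N") (auto simp: le_max_iff_disj not_le less_imp_le)
      then show False using False by blast
    qed
    have "\<exists>s. \<forall>j. \<delta> q (r (s j)) \<ge> real j \<and> s j < s (Suc j)"
      by (rule dependent_nat_choice[where P = "\<lambda>j x. \<delta> q (r x) \<ge> real j" and Q = "\<lambda>j x y. x < y"])
        (use big in blast)+
    then obtain s where s: "\<And>j. \<delta> q (r (s j)) \<ge> real j" "strict_mono s"
      by (auto simp: strict_mono_Suc_iff)
    have top: "filterlim (\<lambda>j. \<delta> q (r (s j))) at_top sequentially"
      by (rule filterlim_at_top_mono[OF filterlim_real_sequentially]) (simp add: s)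
    have "(\<exists>B. \<forall>j. \<delta> q' (r (s j)) \<le> B) \<or> filterlim (\<lambda>j. \<delta> q' (r (s j))) at_top sequentially"
      if "q' \<in> Q" for q'
      using r(2)[OF that]
    proof
      assume "filterlim (\<lambda>j. \<delta> q' (r j)) at_top sequentially"
      then show ?thesis
        using filterlim_compose[OF _ filterlim_subseq[OF s(2)], of "\<lambda>j. \<delta> q' (r j)"] by blast
    qed blast
    moreover have "strict_mono (r \<circ> s)" using r(1) s(2) by (rule strict_mono_o)
    ultimately show ?thesis
      using top by (intro exI[of _ "r \<circ> s"]) (auto simp: o_def)
  qed
qed

text \<open>For nonempty \<open>S k\<close> these differences span the direction space of the
  Minkowski sum of the convex hulls of the \<open>S k\<close>, so their \<open>dim\<close> is the
  dimension of that sum.\<close>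

definition exponent_diffs :: "('k \<Rightarrow> (real ^ 'n) set) \<Rightarrow> (real ^ 'n) set" where
  "exponent_diffs S = (\<Union>k. (\<lambda>(l, l'). l - l') ` (S k \<times> S k))"

lemma finite_exponent_diffs: "(\<And>k. finite (S k)) \<Longrightarrow> finite (exponent_diffs (S :: 'k :: finite \<Rightarrow> _))"
  by (auto simp: exponent_diffs_def)

lemma exponent_diffsI: "l \<in> S k \<Longrightarrow> l' \<in> S k \<Longrightarrow> l - l' \<in> exponent_diffs S"
  by (force simp: exponent_diffs_def)

text \<open>The exponents whose exponentials dominate when the imaginary part points along
  \<open>b\<close>; minima appear because of the sign in \<open>norm_expo\<close>.\<close>

definition minimizers :: "(real ^ 'n) set \<Rightarrow> real ^ 'n \<Rightarrow> (real ^ 'n) set" where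
  "minimizers L b = {l \<in> L. \<forall>l'\<in>L. b \<bullet> l \<le> b \<bullet> l'}"

text \<open>Along a sequence of zeros with imaginary parts tending to infinity, the exponents whose weights
  stay within bounded distance of the dominant one form a face. If the face has dimension less
  than \<open>m\<close>, the lower bound of the truncated system is violated in the limit; otherwise the
  imaginary parts are trapped, because the hyperplanes \<open>E\<close> meet the orthogonal complement of
  the face in the origin only.\<close>

lemma bounded_imaginary_parts_of_zeros:
  fixes L :: "'m :: finite \<Rightarrow> (real ^ 'n) set" and a :: "'m \<Rightarrow> real ^ 'n \<Rightarrow> complex"
  assumes L: "\<And>k. finite (L k)" "\<And>k. L k \<noteq> {}" and E: "finite E"
    and lower: "\<And>b. dim (exponent_diffs (\<lambda>k. minimizers (L k) b)) < CARD('m) \<Longrightarrow>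
      \<exists>\<epsilon>>0. \<forall>z l. (\<forall>k. l k \<in> minimizers (L k) b) \<longrightarrow>
        \<epsilon> \<le> (\<Sum>k\<in>UNIV. exp (imv z \<bullet> l k) * norm (\<Sum>l\<in>minimizers (L k) b. a k l * expo l z))"
    and sep: "\<And>S x. (\<And>k. S k \<subseteq> L k) \<Longrightarrow> CARD('m) \<le> dim (exponent_diffs S) \<Longrightarrow>
      \<forall>v\<in>exponent_diffs S. x \<bullet> v = 0 \<Longrightarrow> \<forall>e\<in>E. x \<bullet> e = 0 \<Longrightarrow> x = 0"
  shows "\<exists>R. \<forall>z. (\<forall>k. (\<Sum>l\<in>L k. a k l * expo l z) = 0) \<longrightarrow> (\<forall>e\<in>E. imv z \<bullet> e = c e) \<longrightarrow> norm (imv z) \<le> R"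
proof (rule ccontr)
  assume "\<not> ?thesis"
  then have "\<forall>j::nat. \<exists>z. (\<forall>k. (\<Sum>l\<in>L k. a k l * expo l z) = 0) \<and> (\<forall>e\<in>E. imv z \<bullet> e = c e) \<and> \<not> norm (imv z) \<le> real j"
    by blast
  then obtain z where z: "\<And>j k. (\<Sum>l\<in>L k. a k l * expo l (z j)) = 0" "\<And>j e. e \<in> E \<Longrightarrow> imv (z j) \<bullet> e = c e"
    "\<And>j. \<not> norm (imv (z j)) \<le> real j" by metis
  \<comment> \<open>The logarithm of the ratio of the largest exponential modulus in component
    \<open>k\<close> at \<open>z j\<close> to that of \<open>l\<close>.\<close>
  define \<delta> where "\<delta> = (\<lambda>(k, l) j. imv (z j) \<bullet> l - Min ((\<bullet>) (imv (z j)) ` L k))"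
  have "finite (SIGMA k:UNIV. L k)" by (intro finite_SigmaI) (auto simp: L(1))
  from subsequence_bounded_or_at_top[OF this, of \<delta>] obtain r where r: "strict_mono r"
    and dich: "\<And>k l. l \<in> L k \<Longrightarrow> (\<exists>B. \<forall>j. \<delta> (k, l) (r j) \<le> B) \<or> filterlim (\<lambda>j. \<delta> (k, l) (r j)) at_top sequentially"
    by (elim exE conjE) auto
  define y where "y j = imv (z (r j))" for j
  define d where "d k l j = \<delta> (k, l) (r j)" for k l j
  have d: "d k l j = y j \<bullet> l - Min ((\<bullet>) (y j) ` L k)" for k l j by (simp add: d_def \<delta>_def y_def)
  have d0: "d k l j \<ge> 0" if "l \<in> L k" for k l j
    using that L(1) by (simp add: d)
  define S where "S k = {l \<in> L k. \<exists>B. \<forall>j. d k l j \<le> B}" for k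
  have S: "S k \<subseteq> L k" for k by (auto simp: S_def)
  have top: "filterlim (d k l) at_top sequentially" if "l \<in> L k - S k" for k l
  proof -
    have "filterlim (\<lambda>j. d k l j) at_top sequentially" using dich[of l k] that by (auto simp: S_def d_def)
    then show ?thesis by simp
  qed
  have Sne: "S k \<noteq> {}" for k
  proof
    assume "S k = {}"
    then have "\<forall>l\<in>L k. \<forall>\<^sub>F j in sequentially. d k l j > 0"
      using top[of _ k] by (auto simp: filterlim_at_top_dense)
    then have "\<forall>\<^sub>F j in sequentially. \<forall>l\<in>L k. d k l j > 0"
      by (rule eventually_ball_finite[OF L(1)])
    from eventually_happens'[OF sequentially_bot this] obtain j where j: "\<forall>l\<in>L k. d k l j > 0" ..
    have "Min ((\<bullet>) (y j) ` L k) \<in> (\<bullet>) (y j) ` L k" using L by (intro Min_in) auto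
    then obtain l where "l \<in> L k" "Min ((\<bullet>) (y j) ` L k) = y j \<bullet> l" by auto
    then have "l \<in> L k" "d k l j = 0" by (auto simp: d)
    then show False using j by force
  qed
  have finS: "finite (exponent_diffs S)" using finite_exponent_diffs[of S] finite_subset[OF S L(1)] by blast
  let ?N = "span (exponent_diffs S)"
  \<comment> \<open>Split \<open>y j\<close> into a part \<open>u j\<close> in the direction space
    of the selected exponents and a part \<open>v j\<close> orthogonal to it. The first is bounded
    because weights within each \<open>S k\<close> stay at bounded distance, so passing from
    \<open>y j\<close> to \<open>v j\<close> changes weight differences by bounded amounts
    only.\<close>
  have "\<exists>u v. u \<in> ?N \<and> (\<forall>w\<in>?N. orthogonal v w) \<and> y j = u + v" for j
    by (rule orthogonal_subspace_decomp_exists[of "exponent_diffs S" "y j"]) blast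
  then obtain u v where uv: "\<And>j. u j \<in> ?N" "\<And>j w. w \<in> ?N \<Longrightarrow> orthogonal (v j) w" "\<And>j. y j = u j + v j"
    by metis
  have vd: "v j \<bullet> w = 0" if "w \<in> exponent_diffs S" for j w
    using uv(2)[of w j] span_base[OF that] by (simp add: orthogonal_def)
  have "\<exists>B. \<forall>j. \<bar>u j \<bullet> w\<bar> \<le> B" if w: "w \<in> exponent_diffs S" for w
  proof -
    obtain k l l' where ll: "l \<in> S k" "l' \<in> S k" "w = l - l'" using w by (auto simp: exponent_diffs_def)
    then obtain B B' where B: "\<And>j. d k l j \<le> B" "\<And>j. d k l' j \<le> B'" by (auto simp: S_def)
    have "\<bar>u j \<bullet> w\<bar> \<le> B + B'" for j
    proof -
      have "u j \<bullet> w = y j \<bullet> w" using vd[OF w] uv(3) by (simp add: inner_add_left)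
      also have "\<dots> = d k l j - d k l' j" by (simp add: d ll inner_diff_right)
      finally show ?thesis using B[of j] d0[of l k j] d0[of l' k j] ll S by force
    qed
    then show ?thesis by blast
  qed
  then obtain B where B: "\<And>w j. w \<in> exponent_diffs S \<Longrightarrow> \<bar>u j \<bullet> w\<bar> \<le> B w" by metis
  obtain C where C: "C \<ge> 0" "\<And>x. x \<in> ?N \<Longrightarrow> norm x \<le> C * (\<Sum>w\<in>exponent_diffs S. \<bar>x \<bullet> w\<bar>)"
  proof (rule bounded_by_separating_functionals[OF subspace_span finS])
    fix x assume x: "x \<in> ?N" "\<forall>w\<in>exponent_diffs S. x \<bullet> w = 0"
    have "x \<bullet> x = 0" by (rule span_induct[OF x(1)]) (use x(2) in \<open>auto simp: subspace_def inner_add_right\<close>)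
    then show "x = 0" by simp
  qed blast
  define A where "A = C * (\<Sum>w\<in>exponent_diffs S. B w)"
  have A: "norm (u j) \<le> A" for j
  proof -
    have "norm (u j) \<le> C * (\<Sum>w\<in>exponent_diffs S. \<bar>u j \<bullet> w\<bar>)" by (rule C(2)[OF uv(1)])
    also have "\<dots> \<le> A" unfolding A_def using B C(1) by (intro mult_left_mono sum_mono) auto
    finally show ?thesis .
  qed
  show False
  proof (cases "dim (exponent_diffs S) < CARD('m)")
    case True
    have "\<forall>\<^sub>F j in sequentially. \<forall>k. \<forall>l\<in>S k. \<forall>\<mu>\<in>L k - S k. v j \<bullet> l < v j \<bullet> \<mu>"
    proof -
      have "\<forall>\<^sub>F j in sequentially. v j \<bullet> l < v j \<bullet> \<mu>" if l: "l \<in> S k" and \<mu>: "\<mu> \<in> L k - S k" for k l \<mu>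
      proof -
        obtain B' where B': "\<And>j. d k l j \<le> B'" using l by (auto simp: S_def)
        have "\<forall>\<^sub>F j in sequentially. d k \<mu> j > B' + A * norm (\<mu> - l)"
          using top[OF \<mu>] by (simp add: filterlim_at_top_dense)
        then show ?thesis
        proof eventually_elim
          case (elim j)
          have "v j \<bullet> \<mu> - v j \<bullet> l = d k \<mu> j - d k l j - u j \<bullet> (\<mu> - l)"
            using uv(3)[of j] by (simp add: d inner_diff_right inner_add_left)
          moreover have "u j \<bullet> (\<mu> - l) \<le> A * norm (\<mu> - l)"
            using norm_cauchy_schwarz[of "u j" "\<mu> - l"] mult_right_mono[OF A[of j], of "norm (\<mu> - l)"] by simp
          ultimately show ?case using elim B'[of j] by linarith
        qed
      qed
      then have "\<forall>k l. l \<in> S k \<longrightarrow> (\<forall>\<^sub>F j in sequentially. \<forall>\<mu>\<in>L k - S k. v j \<bullet> l < v j \<bullet> \<mu>)"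
        using L(1) by (intro allI impI eventually_ball_finite) auto
      then have "\<forall>k. \<forall>\<^sub>F j in sequentially. \<forall>l\<in>S k. \<forall>\<mu>\<in>L k - S k. v j \<bullet> l < v j \<bullet> \<mu>"
        using finite_subset[OF S L(1)] by (intro allI eventually_ball_finite) auto
      then show ?thesis by (simp add: eventually_all_finite)
    qed
    from eventually_happens'[OF sequentially_bot this]
    obtain j where j: "\<And>k l \<mu>. l \<in> S k \<Longrightarrow> \<mu> \<in> L k - S k \<Longrightarrow> v j \<bullet> l < v j \<bullet> \<mu>" by blast
    have eqS: "v j \<bullet> l = v j \<bullet> l'" if "l \<in> S k" "l' \<in> S k" for k l l'
      using vd[OF exponent_diffsI[of l S k l'], of j] that by (simp add: inner_diff_right)
    \<comment> \<open>Orthogonality makes the weights of \<open>v j\<close> equal on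
      \<open>S k\<close>, and those off \<open>S k\<close> are strictly larger. So this one
      \<open>v j\<close> exposes the selected exponents, and \<open>lower\<close> applies.\<close>
    have min: "minimizers (L k) (v j) = S k" for k
    proof (intro equalityI subsetI)
      fix l assume l: "l \<in> minimizers (L k) (v j)"
      obtain l' where l': "l' \<in> S k" using Sne[of k] by blast
      show "l \<in> S k"
      proof (rule ccontr)
        assume "l \<notin> S k"
        then have "v j \<bullet> l' < v j \<bullet> l" using l l' by (intro j) (auto simp: minimizers_def)
        moreover have "v j \<bullet> l \<le> v j \<bullet> l'" using l l' S by (auto simp: minimizers_def)
        ultimately show False by simp
      qed
    next
      fix l assume l: "l \<in> S k"
      have "v j \<bullet> l \<le> v j \<bullet> l'" if "l' \<in> L k" for l'
        using eqS[OF l, of l'] j[OF l, of l'] that by (cases "l' \<in> S k") auto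
      then show "l \<in> minimizers (L k) (v j)" using l S by (auto simp: minimizers_def)
    qed
    have "\<forall>k. \<exists>l. l \<in> S k" using Sne by blast
    then obtain l where l: "\<And>k. l k \<in> S k" by metis
    obtain \<epsilon> where \<epsilon>: "\<epsilon> > 0" "\<And>x. \<epsilon> \<le> (\<Sum>k\<in>UNIV. exp (imv x \<bullet> l k) * norm (\<Sum>l\<in>S k. a k l * expo l x))"
      using lower[of "v j"] True l unfolding min by blast
    \<comment> \<open>At a zero the truncated sum is minus the remaining terms. Relative to the
      weight of \<open>l k\<close> these decay, since \<open>d k (l k)\<close> is bounded while
      \<open>d k \<mu>\<close> tends to infinity off \<open>S k\<close>.\<close>
    define T where "T i = (\<Sum>k\<in>UNIV. \<Sum>\<mu>\<in>L k - S k. norm (a k \<mu>) * exp (d k (l k) i - d k \<mu> i))" for i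
    have le: "\<epsilon> \<le> T i" for i
    proof -
      have "exp (y i \<bullet> l k) * norm (\<Sum>l\<in>S k. a k l * expo l (z (r i)))
          \<le> (\<Sum>\<mu>\<in>L k - S k. norm (a k \<mu>) * exp (d k (l k) i - d k \<mu> i))" for k
      proof -
        have "(\<Sum>l\<in>S k. a k l * expo l (z (r i))) = - (\<Sum>l\<in>L k - S k. a k l * expo l (z (r i)))"
          using z(1)[of k "r i"] sum.subset_diff[OF S L(1), of "\<lambda>l. a k l * expo l (z (r i))"]
          by (simp add: add_eq_0_iff)
        then have "norm (\<Sum>l\<in>S k. a k l * expo l (z (r i))) \<le> (\<Sum>\<mu>\<in>L k - S k. norm (a k \<mu> * expo \<mu> (z (r i))))"
          using norm_sum[of "\<lambda>l. a k l * expo l (z (r i))" "L k - S k"] by simp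
        then have "exp (y i \<bullet> l k) * norm (\<Sum>l\<in>S k. a k l * expo l (z (r i)))
            \<le> exp (y i \<bullet> l k) * (\<Sum>\<mu>\<in>L k - S k. norm (a k \<mu>) * exp (- (y i \<bullet> \<mu>)))"
          by (intro mult_left_mono) (auto simp: norm_mult norm_expo y_def)
        also have "\<dots> = (\<Sum>\<mu>\<in>L k - S k. norm (a k \<mu>) * exp (d k (l k) i - d k \<mu> i))"
          unfolding sum_distrib_left
          by (intro sum.cong) (auto simp: d exp_diff exp_minus field_simps)
        finally show ?thesis .
      qed
      then have "(\<Sum>k\<in>UNIV. exp (y i \<bullet> l k) * norm (\<Sum>l\<in>S k. a k l * expo l (z (r i)))) \<le> T i"
        unfolding T_def by (rule sum_mono)
      then show ?thesis using \<epsilon>(2)[of "z (r i)"] by (simp add: y_def)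
    qed
    have "T \<longlonglongrightarrow> (\<Sum>k\<in>UNIV. \<Sum>\<mu>\<in>L k - S k. 0)"
      unfolding T_def
    proof (intro tendsto_sum)
      fix k \<mu> assume \<mu>: "\<mu> \<in> L k - S k"
      obtain B' where B': "\<And>i. d k (l k) i \<le> B'" using l[of k] by (auto simp: S_def)
      have "filterlim (\<lambda>i. - B' + d k \<mu> i) at_top sequentially"
        by (rule filterlim_tendsto_add_at_top[OF tendsto_const top[OF \<mu>]])
      then have "filterlim (\<lambda>i. B' + - d k \<mu> i) at_bot sequentially"
        by (simp add: filterlim_uminus_at_bot)
      then have "(\<lambda>i. exp (B' + - d k \<mu> i)) \<longlonglongrightarrow> 0"
        by (rule filterlim_compose[OF exp_at_bot])
      then have "(\<lambda>i. norm (a k \<mu>) * exp (B' + - d k \<mu> i)) \<longlonglongrightarrow> 0"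
        by (rule tendsto_mult_right_zero)
      then show "(\<lambda>i. norm (a k \<mu>) * exp (d k (l k) i - d k \<mu> i)) \<longlonglongrightarrow> 0"
        by (rule Lim_null_comparison[rotated])
          (auto intro!: always_eventually mult_left_mono simp: abs_mult B')
    qed
    then have "\<epsilon> \<le> 0" using LIMSEQ_le_const[of T 0 \<epsilon>] le by simp
    then show False using \<epsilon>(1) by simp
  next
    case False
    \<comment> \<open>All \<open>v j\<close> lie in \<open>?T\<close>, where by \<open>sep\<close>
      the functionals in \<open>E\<close> vanish jointly only at 0. As
      \<open>imv z \<bullet> e\<close> is prescribed and \<open>u j\<close> is bounded,
      \<open>v j\<close> is bounded too.\<close>
    let ?T = "{x. \<forall>w\<in>exponent_diffs S. x \<bullet> w = 0}"
    have sT: "subspace ?T" by (auto simp: subspace_def inner_add_left)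
    obtain C' where C': "C' \<ge> 0" "\<And>x. x \<in> ?T \<Longrightarrow> norm x \<le> C' * (\<Sum>e\<in>E. \<bar>x \<bullet> e\<bar>)"
    proof (rule bounded_by_separating_functionals[OF sT E])
      fix x assume "x \<in> ?T" "\<forall>e\<in>E. x \<bullet> e = 0"
      then show "x = 0" using sep[of S x] S False by auto
    qed blast
    define A' where "A' = A + C' * (\<Sum>e\<in>E. \<bar>c e\<bar> + A * norm e)"
    have "norm (y j) \<le> A'" for j
    proof -
      have "\<bar>v j \<bullet> e\<bar> \<le> \<bar>c e\<bar> + A * norm e" if e: "e \<in> E" for e
      proof -
        have "v j \<bullet> e = c e - u j \<bullet> e"
          using z(2)[OF e, of "r j"] uv(3)[of j] by (simp add: y_def[symmetric] inner_add_left)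
        moreover have "\<bar>u j \<bullet> e\<bar> \<le> A * norm e"
          using Cauchy_Schwarz_ineq2[of "u j" e] mult_right_mono[OF A[of j], of "norm e"] by simp
        ultimately show ?thesis by linarith
      qed
      then have "C' * (\<Sum>e\<in>E. \<bar>v j \<bullet> e\<bar>) \<le> C' * (\<Sum>e\<in>E. \<bar>c e\<bar> + A * norm e)"
        using C'(1) by (intro mult_left_mono sum_mono)
      moreover have "norm (v j) \<le> C' * (\<Sum>e\<in>E. \<bar>v j \<bullet> e\<bar>)" using C'(2) vd by blast
      ultimately show ?thesis
        using norm_triangle_ineq[of "u j" "v j"] A[of j] uv(3)[of j] by (simp add: A'_def)
    qed
    moreover obtain j where j: "A' \<le> real j" using real_arch_simple by blast
    moreover have "real j \<le> real (r j)" using seq_suble[OF r, of j] by simp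
    ultimately have "norm (imv (z (r j))) \<le> real (r j)" by (metis y_def order_trans)
    then show False using z(3) by blast
  qed
qed

section \<open>Limits of translates and faces\<close>

lemma exp_sum_expansion:
  assumes "exp_sum f"
  shows "finite (Sp f)" "Sp f \<noteq> {}" "f = (\<lambda>z. \<Sum>l\<in>Sp f. exp_coeff f l * expo l z)"
proof -
  obtain c where c: "exp_rep c f" using assms by (auto simp: exp_sum_def)
  have "exp_coeff f = c" by (rule exp_coeff_eq[OF c])
  then show "finite (Sp f)" "Sp f \<noteq> {}" "f = (\<lambda>z. \<Sum>l\<in>Sp f. exp_coeff f l * expo l z)"
    using c by (auto simp: exp_rep_def Sp_def)
qed

lemma imv_cvec: "imv (z + cvec t) = imv z"
  by (simp add: imv_def cvec_def vec_eq_iff)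

lemma norm_expo_cvec: "norm (expo l (cvec t)) = 1"
  unfolding norm_expo by (simp add: imv_def cvec_def inner_vec_def)

lemma bounded_finite_family_subsequence:
  fixes e :: "'l \<Rightarrow> nat \<Rightarrow> complex"
  assumes "finite \<Lambda>" "\<And>l j. norm (e l j) \<le> 1"
  shows "\<exists>r \<theta>. strict_mono r \<and> (\<forall>l\<in>\<Lambda>. (\<lambda>j. e l (r j)) \<longlonglongrightarrow> \<theta> l)"
  using assms(1)
proof (induction \<Lambda> rule: finite_induct)
  case empty
  then show ?case by (intro exI[of _ "\<lambda>j. j"]) (simp add: strict_mono_def)
next
  case (insert l \<Lambda>)
  then obtain r \<theta> where r: "strict_mono r" "\<forall>l\<in>\<Lambda>. (\<lambda>j. e l (r j)) \<longlonglongrightarrow> \<theta> l" by (elim exE conjE)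
  have "bounded (range (\<lambda>j. e l (r j)))"
    using assms(2) by (auto simp: bounded_iff)
  then obtain x s where s: "strict_mono s" "((\<lambda>j. e l (r j)) \<circ> s) \<longlonglongrightarrow> x"
    using bounded_imp_convergent_subsequence by blast
  have "(\<lambda>j. e l' (r (s j))) \<longlonglongrightarrow> \<theta> l'" if "l' \<in> \<Lambda>" for l'
    using LIMSEQ_subseq_LIMSEQ[OF bspec[OF r(2) that] s(1)] by (simp add: o_def)
  moreover have "strict_mono (r \<circ> s)" using r(1) s(1) by (rule strict_mono_o)
  ultimately show ?case
    using s(2) insert.hyps
    by (intro exI[of _ "r \<circ> s"] exI[of _ "\<theta>(l := x)"]) (auto simp: o_def)
qed

text \<open>Tubes over balls of radius \<open>j\<close> exhaust the space, so approximation there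
  within \<open>1 / real (Suc j)\<close> gives pointwise convergence of translates. A subsequence
  makes the unimodular factors that translation puts on the coefficients converge as well.\<close>

lemma translates_closure_limit:
  fixes F :: "complex ^ 'n \<Rightarrow> complex ^ 'm"
  assumes F: "F \<in> Exp_maps" and G: "G \<in> translates_closure F"
  obtains t \<theta> where "\<And>k l. l \<in> Sp (\<lambda>z. F z $ k) \<Longrightarrow> (\<lambda>j. expo l (cvec (t j))) \<longlonglongrightarrow> \<theta> l"
    "\<And>z. (\<lambda>j. F (z + cvec (t j))) \<longlonglongrightarrow> G z"
proof -
  have "\<exists>t. \<forall>z\<in>tube (cball 0 (real j)). norm (F (z + cvec t) - G z) < 1 / real (Suc j)" for j
  proof -
    have "\<exists>H\<in>translates F. H \<in> tube_nbhd G (cball 0 (real j)) (1 / real (Suc j))"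
      using G unfolding in_closure_of_tube_topology by simp
    then show ?thesis by (auto simp: translates_def tube_nbhd_def)
  qed
  then obtain t where t: "\<And>j z. z \<in> tube (cball 0 (real j)) \<Longrightarrow> norm (F (z + cvec (t j)) - G z) < 1 / real (Suc j)"
    by metis
  have lim: "(\<lambda>j. F (z + cvec (t j))) \<longlonglongrightarrow> G z" for z
  proof -
    obtain N where N: "norm (imv z) \<le> real N" using real_arch_simple by blast
    have "\<forall>\<^sub>F j in sequentially. norm (F (z + cvec (t j)) - G z) \<le> 1 / real (Suc j)"
      using eventually_ge_at_top[of N]
    proof eventually_elim
      case (elim j)
      then have "z \<in> tube (cball 0 (real j))" using N by (simp add: tube_def imv_def)
      then show ?case using t less_imp_le by blast
    qed
    then have "(\<lambda>j. F (z + cvec (t j)) - G z) \<longlonglongrightarrow> 0"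
      by (rule Lim_null_comparison) (rule LIMSEQ_Suc[OF lim_1_over_n])
    then show ?thesis by (simp add: LIM_zero_iff)
  qed
  have fin: "finite (\<Union>k. Sp (\<lambda>z. F z $ k))"
    using F exp_sum_expansion(1) by (auto simp: Exp_maps_def)
  obtain r \<theta> where r: "strict_mono r"
    "\<forall>l\<in>(\<Union>k. Sp (\<lambda>z. F z $ k)). (\<lambda>j. expo l (cvec (t (r j)))) \<longlonglongrightarrow> \<theta> l"
    using bounded_finite_family_subsequence[OF fin, of "\<lambda>l j. expo l (cvec (t j))"]
    by (auto simp: norm_expo_cvec)
  show thesis
  proof (rule that[of "\<lambda>j. t (r j)" \<theta>])
    show "(\<lambda>j. expo l (cvec (t (r j)))) \<longlonglongrightarrow> \<theta> l" if "l \<in> Sp (\<lambda>z. F z $ k)" for k l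
      using r(2) that by blast
    show "(\<lambda>j. F (z + cvec (t (r j)))) \<longlonglongrightarrow> G z" for z
      using LIMSEQ_subseq_LIMSEQ[OF lim r(1)] by (simp add: o_def)
  qed
qed

section \<open>Newton polytopes and their exposed faces\<close>

definition newt_point :: "real ^ 'n \<Rightarrow> complex ^ 'n" where
  "newt_point l = - \<i> *s cvec l"

lemma linear_newt_point: "linear newt_point"
  by (rule linearI) (auto simp: newt_point_def cvec_def vec_eq_iff scaleR_conv_of_real[where 'a = complex] algebra_simps)

lemma hprod_newt_point: "Re (hprod z (newt_point l)) = - (imv z \<bullet> l)"
  by (simp add: hprod_def newt_point_def cvec_def imv_def inner_vec_def sum_negf)

lemma newt_point_preimage: "cvec l \<in> (\<lambda>u. \<i> *s u) ` D \<longleftrightarrow> newt_point l \<in> D"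
proof -
  have 1: "cvec l = \<i> *s newt_point l" by (simp add: newt_point_def vec_eq_iff)
  have "u = newt_point l" if "cvec l = \<i> *s u" for u
    using that unfolding 1 by simp
  then show ?thesis using 1 by blast
qed

lemma Newt_eq: "Newt f = convex hull (newt_point ` Sp f)"
  by (simp add: Newt_def newt_point_def[abs_def])

lemma minimizers_nonempty: "finite L \<Longrightarrow> L \<noteq> {} \<Longrightarrow> minimizers L b \<noteq> {}"
proof -
  assume L: "finite L" "L \<noteq> {}"
  then have "Min ((\<bullet>) b ` L) \<in> (\<bullet>) b ` L" by (intro Min_in) auto
  then obtain l where l: "l \<in> L" "Min ((\<bullet>) b ` L) = b \<bullet> l" by auto
  then have "l \<in> minimizers L b" using Min_le[of "(\<bullet>) b ` L"] L(1) by (auto simp: minimizers_def)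
  then show ?thesis by blast
qed

text \<open>A real vector \<open>b\<close> exposes a face of each Newton polytope, and the Minkowski
  sum of these faces is the face it exposes in the sum. Replacing the support function by the weight
  of any single exponent on the face only enlarges the terms, so the regularity bound carries
  over.\<close>

lemma face_lower_bound:
  fixes F :: "complex ^ 'n \<Rightarrow> complex ^ 'm"
  assumes F: "F \<in> Exp_maps" and K: "kazarnovskii_regular F"
  defines "S \<equiv> \<lambda>b k. minimizers (Sp (\<lambda>z. F z $ k)) b"
  assumes dim: "dim (exponent_diffs (S b)) < CARD('m)"
  shows "\<exists>\<epsilon>>0. \<forall>z l. (\<forall>k. l k \<in> S b k) \<longrightarrow>
    \<epsilon> \<le> (\<Sum>k\<in>UNIV. exp (imv z \<bullet> l k) * norm (\<Sum>l\<in>S b k. exp_coeff (\<lambda>z. F z $ k) l * expo l z))"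
proof -
  let ?f = "\<lambda>k z. F z $ k"
  define L where "L k = Sp (?f k)" for k
  have L: "finite (L k)" "L k \<noteq> {}" for k
    using F exp_sum_expansion[of "?f k"] by (auto simp: Exp_maps_def L_def)
  have Sk: "S b k = minimizers (L k) b" for k by (simp add: S_def L_def)
  have SL: "S b k \<subseteq> L k" for k by (auto simp: Sk minimizers_def)
  have "\<forall>k. \<exists>l. l \<in> S b k"
    using minimizers_nonempty[OF L] by (auto simp: Sk ex_in_conv)
  then obtain l0 where l0: "\<And>k. l0 k \<in> S b k" by metis
  \<comment> \<open>Multiplication by \<open>\<i>\<close> turns minimizing \<open>b\<close> over
    exponents into maximizing \<open>A\<close> over points of the Newton polytopes.\<close>
  define A where "A = \<i> *s cvec b"
  have Ap: "A \<bullet> newt_point l = - (b \<bullet> l)" for l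
  proof -
    have "imv A = b" by (simp add: A_def imv_def cvec_def vec_eq_iff)
    then show ?thesis by (simp add: inner_hprod hprod_newt_point)
  qed
  define \<beta> where "\<beta> k = b \<bullet> l0 k" for k
  have Smem: "l \<in> S b k \<longleftrightarrow> l \<in> L k \<and> b \<bullet> l = \<beta> k" for l k
    using l0[of k] unfolding Sk \<beta>_def minimizers_def by fastforce
  have Newt: "Newt (?f k) = convex hull (newt_point ` L k)" for k by (simp add: Newt_eq L_def)
  have le: "A \<bullet> u \<le> - \<beta> k" if "u \<in> Newt (?f k)" for u k
  proof -
    have "convex hull (newt_point ` L k) \<subseteq> {u. A \<bullet> u \<le> - \<beta> k}"
      using l0[of k] by (intro hull_minimal convex_halfspace_le) (auto simp: Ap Sk \<beta>_def minimizers_def)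
    then show ?thesis using that Newt by blast
  qed
  define D where "D k = Newt (?f k) \<inter> {u. A \<bullet> u = - \<beta> k}" for k
  have Dface: "D k face_of Newt (?f k)" for k
    unfolding D_def by (rule face_of_Int_supporting_hyperplane_le) (use le in \<open>auto simp: Newt\<close>)
  define \<Delta> where "\<Delta> = (\<Sum>k\<in>UNIV. D k)"
  \<comment> \<open>A sum attains the total bound of the functional only if each summand attains its
    own bound \<open>- \<beta> k\<close>.\<close>
  have \<Delta>_eq: "\<Delta> = Newt_map F \<inter> {u. A \<bullet> u = - (\<Sum>k\<in>UNIV. \<beta> k)}"
  proof (intro equalityI subsetI)
    fix u assume "u \<in> \<Delta>"
    then obtain s where s: "u = (\<Sum>k\<in>UNIV. s k)" "\<And>k. s k \<in> D k"
      unfolding \<Delta>_def by (auto simp: set_sum_alt)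
    then show "u \<in> Newt_map F \<inter> {u. A \<bullet> u = - (\<Sum>k\<in>UNIV. \<beta> k)}"
      by (auto simp: Newt_map_def set_sum_alt D_def inner_sum_right sum_negf)
  next
    fix u assume u: "u \<in> Newt_map F \<inter> {u. A \<bullet> u = - (\<Sum>k\<in>UNIV. \<beta> k)}"
    then obtain s where s: "u = (\<Sum>k\<in>UNIV. s k)" "\<And>k. s k \<in> Newt (?f k)"
      by (auto simp: Newt_map_def set_sum_alt)
    have "(\<Sum>k\<in>UNIV. - \<beta> k - A \<bullet> s k) = 0"
      using u by (simp add: s(1) sum_subtractf inner_sum_right sum_negf)
    then have "\<forall>k\<in>UNIV. - \<beta> k - A \<bullet> s k = 0"
      using le[OF s(2)] by (subst (asm) sum_nonneg_eq_0_iff) auto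
    then have "s k \<in> D k" for k using s(2)[of k] by (simp add: D_def)
    then show "u \<in> \<Delta>" unfolding \<Delta>_def by (auto simp: set_sum_alt s(1))
  qed
  have \<Delta>face: "\<Delta> face_of Newt_map F"
    unfolding \<Delta>_eq
  proof (rule face_of_Int_supporting_hyperplane_le)
    show "convex (Newt_map F)"
      unfolding Newt_map_def by (rule convex_set_sum) (simp add: Newt)
    fix u assume "u \<in> Newt_map F"
    then obtain s where s: "u = (\<Sum>k\<in>UNIV. s k)" "\<And>k. s k \<in> Newt (?f k)"
      by (auto simp: Newt_map_def set_sum_alt)
    show "A \<bullet> u \<le> - (\<Sum>k\<in>UNIV. \<beta> k)"
      unfolding s(1) inner_sum_right sum_negf[symmetric] by (rule sum_mono) (rule le[OF s(2)])
  qed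
  have pD: "newt_point l \<in> D k \<longleftrightarrow> l \<in> S b k" if "l \<in> L k" for l k
    using that by (auto simp: D_def Newt Ap Smem intro!: hull_inc)
  have \<Delta>ne: "\<Delta> \<noteq> {}"
  proof -
    have "(\<Sum>k\<in>UNIV. newt_point (l0 k)) \<in> \<Delta>"
      unfolding \<Delta>_def using pD l0 SL by (force simp: set_sum_alt)
    then show ?thesis by blast
  qed
  let ?N = "newt_point ` span (exponent_diffs (S b))"
  have sN: "subspace ?N" by (intro linear_subspace_image linear_newt_point subspace_span)
  \<comment> \<open>A face of the hull of finitely many points is the hull of some of them, here
    minimizers by \<open>pD\<close>. This bounds the dimension of the face by that of the exponent
    differences.\<close>
  have Dsub: "D k \<subseteq> (+) (newt_point (l0 k)) ` ?N" for k
  proof -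
    obtain s' where s': "s' \<subseteq> newt_point ` L k" "D k = convex hull s'"
      by (rule face_of_convex_hull_subset[OF _ Dface[unfolded Newt, of k]]) (use L in \<open>auto simp: finite_imp_compact\<close>)
    have "s' \<subseteq> (+) (newt_point (l0 k)) ` ?N"
    proof
      fix x assume x: "x \<in> s'"
      then obtain l where l: "x = newt_point l" "l \<in> L k" using s' by blast
      have "x \<in> D k" unfolding s'(2) using x by (rule hull_inc)
      then have "l \<in> S b k" using pD l by blast
      then have "l - l0 k \<in> span (exponent_diffs (S b))" using l0[of k] by (intro span_base exponent_diffsI)
      moreover have "x = newt_point (l0 k) + newt_point (l - l0 k)"
        unfolding l(1) by (simp add: linear_diff[OF linear_newt_point])
      ultimately show "x \<in> (+) (newt_point (l0 k)) ` ?N" by blast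
    qed
    then show ?thesis
      unfolding s'(2) by (intro hull_minimal convex_translation subspace_imp_convex sN)
  qed
  have "\<Delta> \<subseteq> (+) (\<Sum>k\<in>UNIV. newt_point (l0 k)) ` ?N"
  proof
    fix u assume "u \<in> \<Delta>"
    then obtain s where s: "u = (\<Sum>k\<in>UNIV. s k)" "\<And>k. s k \<in> D k"
      unfolding \<Delta>_def by (auto simp: set_sum_alt)
    have "\<forall>k. \<exists>v\<in>?N. s k = newt_point (l0 k) + v" using s(2) Dsub by blast
    then obtain v where v: "\<And>k. v k \<in> ?N" "\<And>k. s k = newt_point (l0 k) + v k" by metis
    have "(\<Sum>k\<in>UNIV. v k) \<in> ?N" by (rule subspace_sum[OF sN v(1)])
    moreover have "u = (\<Sum>k\<in>UNIV. newt_point (l0 k)) + (\<Sum>k\<in>UNIV. v k)"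
      by (simp add: s(1) v(2) sum.distrib)
    ultimately show "u \<in> (+) (\<Sum>k\<in>UNIV. newt_point (l0 k)) ` ?N" by blast
  qed
  then have "aff_dim \<Delta> \<le> aff_dim ?N"
    using aff_dim_subset aff_dim_translation_eq by metis
  also have "\<dots> = int (dim ?N)" by (rule aff_dim_subspace[OF sN])
  also have "\<dots> \<le> int (dim (exponent_diffs (S b)))"
    using dim_image_le[OF linear_newt_point, of "span (exponent_diffs (S b))"] by simp
  finally have "aff_dim \<Delta> < int CARD('m)" using dim by simp
  then have "\<exists>\<epsilon>>0. \<forall>z. (\<Sum>k\<in>UNIV. exp (- supp_fun (D k) z) * norm (face_part (?f k) (D k) z)) \<ge> \<epsilon>"
    using K \<Delta>face \<Delta>ne Dface unfolding kazarnovskii_regular_def \<Delta>_def by blast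
  then obtain \<epsilon> where \<epsilon>: "\<epsilon> > 0"
    "\<And>z. (\<Sum>k\<in>UNIV. exp (- supp_fun (D k) z) * norm (face_part (?f k) (D k) z)) \<ge> \<epsilon>" by blast
  have part: "face_part (?f k) (D k) z = (\<Sum>l\<in>S b k. exp_coeff (?f k) l * expo l z)" for k z
  proof -
    have "{l \<in> Sp (?f k). cvec l \<in> (\<lambda>u. \<i> *s u) ` D k} = S b k"
      using pD SL by (auto simp: newt_point_preimage L_def)
    then show ?thesis by (simp add: face_part_def)
  qed
  have supp: "- supp_fun (D k) z \<le> imv z \<bullet> l" if "l \<in> S b k" for l k z
  proof -
    have "bounded (Newt (?f k))" unfolding Newt using L by (simp add: bounded_convex_hull finite_imp_bounded)
    then obtain B where B: "\<And>u. u \<in> Newt (?f k) \<Longrightarrow> norm u \<le> B" by (auto simp: bounded_iff)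
    have "bdd_above ((\<lambda>u. Re (hprod z u)) ` D k)"
    proof (rule bdd_aboveI2)
      fix u assume "u \<in> D k"
      then have "norm u \<le> B" using B by (simp add: D_def)
      then show "Re (hprod z u) \<le> norm z * B"
        unfolding inner_hprod[symmetric]
        using norm_cauchy_schwarz[of z u] mult_left_mono[of "norm u" B "norm z"] by simp
    qed
    moreover have "newt_point l \<in> D k" using that SL pD by blast
    ultimately have "Re (hprod z (newt_point l)) \<le> supp_fun (D k) z"
      unfolding supp_fun_def by (intro cSUP_upper)
    then show ?thesis by (simp add: hprod_newt_point)
  qed
  have "\<epsilon> \<le> (\<Sum>k\<in>UNIV. exp (imv z \<bullet> l k) * norm (\<Sum>l\<in>S b k. exp_coeff (?f k) l * expo l z))"
    if l: "\<forall>k. l k \<in> S b k" for z l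
  proof -
    have "\<epsilon> \<le> (\<Sum>k\<in>UNIV. exp (- supp_fun (D k) z) * norm (face_part (?f k) (D k) z))" by (rule \<epsilon>(2))
    also have "\<dots> \<le> (\<Sum>k\<in>UNIV. exp (imv z \<bullet> l k) * norm (face_part (?f k) (D k) z))"
      using supp l by (intro sum_mono mult_right_mono) auto
    finally show ?thesis by (simp add: part)
  qed
  then show ?thesis using \<epsilon>(1) by blast
qed

section \<open>The codimension of the zero sets\<close>

lemma common_zerosD: "z \<in> common_zeros U H \<Longrightarrow> h \<in> H \<Longrightarrow> h z = 0"
  by (simp add: common_zeros_def)

lemma chart_slice_islimpt:
  assumes c: "chart U W \<phi> \<psi>" and a: "a \<in> U" and lim: "\<phi> a islimpt A" and A: "A \<subseteq> W"
    and B: "\<And>w. w \<in> A \<Longrightarrow> \<psi> w \<in> B"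
  shows "a islimpt B"
  unfolding islimpt_approachable
proof (intro allI impI)
  fix e :: real assume e: "e > 0"
  have hom: "homeomorphism U W \<phi> \<psi>" using c by (simp add: chart_def)
  have aW: "\<phi> a \<in> W" "\<psi> (\<phi> a) = a" using hom a by (auto simp: homeomorphism_def)
  have "continuous_on W \<psi>" using hom by (simp add: homeomorphism_def)
  then obtain d where d: "d > 0" "\<And>w. w \<in> W \<Longrightarrow> dist w (\<phi> a) < d \<Longrightarrow> dist (\<psi> w) (\<psi> (\<phi> a)) < e"
    using aW(1) e unfolding continuous_on_iff by blast
  obtain w where w: "w \<in> A" "w \<noteq> \<phi> a" "dist w (\<phi> a) < d"
    using lim d(1) unfolding islimpt_approachable by blast
  have "\<phi> (\<psi> w) = w" using w(1) A hom by (auto simp: homeomorphism_def)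
  then have "\<psi> w \<noteq> a" using w(2) by auto
  then show "\<exists>x'\<in>B. x' \<noteq> a \<and> dist x' a < e"
    using d(2)[of w] w A B[OF w(1)] aW(2) by (intro bexI[of _ "\<psi> w"]) auto
qed

lemma regular_point_chart:
  fixes V :: "(complex ^ 'n) set"
  assumes "regular_point V d a"
  obtains U W \<phi> \<psi> and J :: "'n set" where "a \<in> V" "a \<in> U" "chart U W \<phi> \<psi>" "card J = d"
    "\<phi> ` (V \<inter> U) = {w \<in> W. \<forall>j. j \<notin> J \<longrightarrow> w $ j = 0}"
  using assms unfolding regular_point_def chart_def by blast

text \<open>Fixing the \<open>d\<close> free coordinates as well makes \<open>a\<close> an isolated zero of fewer than \<open>n\<close> functions.\<close>

lemma regular_point_dim_ge:
  fixes H :: "(complex ^ 'n \<Rightarrow> complex) set"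
  assumes fin: "finite H" and H: "\<And>h. h \<in> H \<Longrightarrow> hol UNIV h"
    and reg: "regular_point (common_zeros UNIV H) d a"
  shows "CARD('n) \<le> card H + d"
proof (rule ccontr)
  assume neg: "\<not> ?thesis"
  let ?V = "common_zeros UNIV H"
  obtain U W \<phi> \<psi> and J :: "'n set" where a: "a \<in> ?V" "a \<in> U" and c: "chart U W \<phi> \<psi>" and J: "card J = d"
    and slice: "\<phi> ` (?V \<inter> U) = {w \<in> W. \<forall>j. j \<notin> J \<longrightarrow> w $ j = 0}"
    by (rule regular_point_chart[OF reg])
  have W: "open W" and hom: "homeomorphism U W \<phi> \<psi>" and hpsi: "holo_on \<psi> W"
    using c by (auto simp: chart_def)
  let ?A = "(\<lambda>h w. h (\<psi> w)) ` H" and ?B = "(\<lambda>j w. w $ j - \<phi> a $ j) ` J"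
  have mem: "\<phi> a \<in> {w \<in> W. \<forall>j. j \<notin> J \<longrightarrow> w $ j = 0}" using a unfolding slice[symmetric] by blast
  have "\<phi> a islimpt common_zeros W (?A \<union> ?B)"
  proof (rule islimpt_common_zeros)
    show "finite (?A \<union> ?B)" using fin by simp
    have "card (?A \<union> ?B) \<le> card ?A + card ?B" by (rule card_Un_le)
    also have "\<dots> \<le> card H + card J" by (intro add_mono card_image_le fin) simp
    finally show "card (?A \<union> ?B) < CARD('n)" using neg J by simp
    show "hol W h" if "h \<in> ?A \<union> ?B" for h
      using that
    proof
      assume "h \<in> ?A"
      then obtain g where g: "g \<in> H" "h = (\<lambda>w. g (\<psi> w))" by blast
      show ?thesis unfolding g(2) by (rule hol_compose[OF open_UNIV H[OF g(1)] hpsi]) simp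
    next
      assume "h \<in> ?B"
      then show ?thesis by (auto intro!: hol_diff hol_component hol_const)
    qed
    have "\<psi> (\<phi> a) = a" using hom a by (simp add: homeomorphism_def)
    then show "\<phi> a \<in> common_zeros W (?A \<union> ?B)"
      using a mem by (auto simp: common_zeros_def)
  qed (rule W)
  moreover have "common_zeros W (?A \<union> ?B) \<subseteq> {\<phi> a}"
  proof
    fix w assume w: "w \<in> common_zeros W (?A \<union> ?B)"
    then have "w \<in> W" "\<psi> w \<in> ?V" by (auto simp: common_zeros_def)
    then have x: "\<psi> w \<in> ?V \<inter> U" "\<phi> (\<psi> w) = w" using hom by (auto simp: homeomorphism_def)
    have "w \<in> {w \<in> W. \<forall>j. j \<notin> J \<longrightarrow> w $ j = 0}"
      using imageI[OF x(1), of \<phi>] unfolding slice x(2) .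
    moreover have "w $ j = \<phi> a $ j" if "j \<in> J" for j
      using common_zerosD[OF w, of "\<lambda>w. w $ j - \<phi> a $ j"] that by simp
    ultimately have "w $ j = \<phi> a $ j" for j using mem by (cases "j \<in> J") auto
    then show "w \<in> {\<phi> a}" by (simp add: vec_eq_iff)
  qed
  ultimately have "\<phi> a islimpt {\<phi> a}" using islimpt_subset by blast
  then show False by (simp add: islimpt_finite)
qed

section \<open>Analytic sets with bounded imaginary part\<close>

lemma norm_power2_imv: "(norm z)\<^sup>2 = (norm (\<chi> j. Re (z $ j)))\<^sup>2 + (norm (imv z))\<^sup>2"
  for z :: "complex ^ 'n"
  unfolding norm_vec_power2 power2_norm_eq_inner[of "imv z"] power2_norm_eq_inner[of "\<chi> j. Re (z $ j)"]
  by (simp add: inner_vec_def imv_def sum.distrib[symmetric] cmod_power2 power2_eq_square[symmetric])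

text \<open>With \<open>z = x + iy\<close>, the function \<open>2|y|\<^sup>2 - |x|\<^sup>2\<close> is strictly plurisubharmonic and tends to minus
  infinity along a set with bounded imaginary part, so it has a maximum on the derived set.\<close>

lemma derived_set_empty_if_bounded_imaginary_part:
  fixes H :: "(complex ^ 'n \<Rightarrow> complex) set"
  assumes fin: "finite H" and H: "\<And>h. h \<in> H \<Longrightarrow> hol UNIV h"
    and R: "\<And>z. z \<in> common_zeros UNIV H \<Longrightarrow> norm (imv z) \<le> R"
  shows "\<not> a islimpt common_zeros UNIV H"
proof
  let ?V = "common_zeros UNIV H"
  assume a: "a islimpt ?V"
  define u where "u z = 2 * (norm (imv z))\<^sup>2 - (norm (\<chi> j. Re (z $ j)))\<^sup>2" for z :: "complex ^ 'n"
  have ucont: "continuous_on UNIV u"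
    unfolding u_def imv_def by (intro continuous_intros)
  have "closed ?V"
  proof -
    have "?V = (\<Inter>h\<in>H. {z. h z = 0})" by (auto simp: common_zeros_def)
    moreover have "closed {z. h z = 0}" if "h \<in> H" for h
      using closed_Collect_eq[OF hol_continuous[OF H[OF that]], of "\<lambda>_. 0"] by simp
    ultimately show ?thesis by (simp add: closed_INT)
  qed
  then have in_V: "z \<in> ?V" if "z islimpt ?V" for z using that closed_limpt[of ?V] by simp
  let ?K = "{z. z islimpt ?V} \<inter> {z. u a \<le> u z}"
  \<comment> \<open>With imaginary part at most \<open>R\<close>, the condition
    \<open>u a \<le> u z\<close> bounds the square of the real part by
    \<open>2 * R\<^sup>2 - u a\<close>; adding \<open>R\<^sup>2\<close> for the imaginary part gives
    the factor 3.\<close>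
  have "bounded ?K"
    unfolding bounded_iff
  proof (intro exI ballI)
    fix z assume z: "z \<in> ?K"
    have "norm (imv z) \<le> R" using R[OF in_V] z by blast
    then have "(norm (imv z))\<^sup>2 \<le> R\<^sup>2" by (simp add: power_mono)
    then have "(norm z)\<^sup>2 \<le> 3 * R\<^sup>2 - u a" using z norm_power2_imv[of z] by (simp add: u_def)
    then show "norm z \<le> sqrt (3 * R\<^sup>2 - u a)" by (rule real_le_rsqrt)
  qed
  moreover have "closed ?K"
    by (intro closed_Int closed_limpts closed_Collect_le continuous_on_const ucont)
  ultimately have K: "compact ?K" by (simp add: compact_eq_bounded_closed)
  have "a \<in> ?K" using a by simp
  then have ne: "?K \<noteq> {}" by blast
  from continuous_attains_sup[OF K ne continuous_on_subset[OF ucont subset_UNIV]]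
  obtain p where p: "p \<in> ?K" "\<And>z. z \<in> ?K \<Longrightarrow> u z \<le> u p" by (elim bexE) (rule that, auto)
  have max: "u z \<le> u p" if "z islimpt ?V" for z
    using p(1) p(2)[of z] that by (cases "u a \<le> u z") auto
  \<comment> \<open>The expansion of \<open>u\<close> at \<open>p\<close>. For an increment
    \<open>s + i t\<close> in one coordinate,
    \<open>2 t^2 - s^2 = -3/2 (s^2 - t^2) + 1/2 (s^2 + t^2)\<close>: the harmonic part gives the
    coefficient -3/2, the positive rest makes the peak strict. The linear coefficient reproduces the
    gradient of \<open>u\<close>.\<close>
  define q where "q z = (\<Sum>j\<in>UNIV. - (3/2) * ((z $ j - p $ j) * (z $ j - p $ j))
      + (- 2 * of_real (Re (p $ j)) - 4 * \<i> * of_real (Im (p $ j))) * (z $ j - p $ j))" for z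
  have scalar: "Re (- (3/2) * ((c - b) * (c - b)) + (- 2 * of_real (Re b) - 4 * \<i> * of_real (Im b)) * (c - b))
      = (2 * (Im c)\<^sup>2 - (Re c)\<^sup>2) - (2 * (Im b)\<^sup>2 - (Re b)\<^sup>2) - (norm (c - b))\<^sup>2 / 2" for b c :: complex
  proof -
    have "(norm (c - b))\<^sup>2 = (Re c - Re b)\<^sup>2 + (Im c - Im b)\<^sup>2" by (simp add: cmod_power2)
    then show ?thesis by (simp add: power2_eq_square field_simps)
  qed
  have u_sum: "u z = (\<Sum>j\<in>UNIV. 2 * (Im (z $ j))\<^sup>2 - (Re (z $ j))\<^sup>2)" for z
    unfolding u_def power2_norm_eq_inner
    by (simp add: inner_vec_def imv_def power2_eq_square sum_subtractf sum_distrib_left)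
  have q: "Re (q z) = u z - u p - (norm (z - p))\<^sup>2 / 2" for z
    unfolding q_def u_sum norm_vec_power2[of "z - p"] Re_sum scalar
    by (simp add: sum_subtractf sum_divide_distrib)
  show False
  proof (rule no_strict_peak_on_derived_set[OF fin open_UNIV H])
    show "hol UNIV q"
      unfolding q_def by (intro hol_sum hol_add hol_mult hol_diff hol_const hol_component)
    show "q p = 0" by (simp add: q_def)
    show "p islimpt ?V" using p(1) by simp
    show "Re (q z) < 0" if "z \<in> ball p 1" "z islimpt ?V" "z \<noteq> p" for z
    proof -
      have "(norm (z - p))\<^sup>2 > 0" using that(3) by simp
      then show ?thesis using max[OF that(2)] unfolding q by linarith
    qed
  qed auto
qed

lemma zero_set_codim_of_closure:
  fixes F :: "complex ^ 'n \<Rightarrow> complex ^ 'm"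
  assumes "CARD('m) \<le> CARD('n)"
    and "F \<in> Exp_maps"
    and "kazarnovskii_regular F"
    and G: "G \<in> translates_closure F" and ne: "zero_set G \<noteq> {}"
  shows "analytic_codim (zero_set G) = CARD('m)"
proof -
  let ?f = "\<lambda>k z. F z $ k"
  define L where "L k = Sp (?f k)" for k
  have expF: "exp_sum (?f k)" for k using assms(2) by (simp add: Exp_maps_def)
  have L: "finite (L k)" "L k \<noteq> {}" for k
    using exp_sum_expansion[OF expF] by (auto simp: L_def)
  have F_eq: "F z $ k = (\<Sum>l\<in>L k. exp_coeff (?f k) l * expo l z)" for k z
    using fun_cong[OF exp_sum_expansion(3)[OF expF[of k]], of z] by (simp add: L_def)
  obtain t \<theta> where t: "\<And>k l. l \<in> L k \<Longrightarrow> (\<lambda>j. expo l (cvec (t j))) \<longlonglongrightarrow> \<theta> l"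
    "\<And>z. (\<lambda>j. F (z + cvec (t j))) \<longlonglongrightarrow> G z"
    unfolding L_def by (rule translates_closure_limit[OF assms(2) G]) blast
  define a where "a k l = exp_coeff (?f k) l * \<theta> l" for k l
  have lim: "(\<lambda>j. \<Sum>l\<in>S. exp_coeff (?f k) l * expo l (z + cvec (t j))) \<longlonglongrightarrow> (\<Sum>l\<in>S. a k l * expo l z)"
    if "S \<subseteq> L k" for S k z
  proof (rule tendsto_sum)
    fix l assume "l \<in> S"
    then have "(\<lambda>j. exp_coeff (?f k) l * (expo l z * expo l (cvec (t j))))
        \<longlonglongrightarrow> exp_coeff (?f k) l * (expo l z * \<theta> l)"
      using that by (intro tendsto_intros t(1)[of l k]) auto
    then show "(\<lambda>j. exp_coeff (?f k) l * expo l (z + cvec (t j))) \<longlonglongrightarrow> a k l * expo l z"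
      by (simp add: a_def expo_add mult_ac)
  qed
  have G_eq: "G z $ k = (\<Sum>l\<in>L k. a k l * expo l z)" for z k
  proof -
    have "(\<lambda>j. F (z + cvec (t j)) $ k) \<longlonglongrightarrow> (\<Sum>l\<in>L k. a k l * expo l z)"
      using lim[of "L k" k z] by (simp only: F_eq[symmetric] subset_refl simp_thms)
    moreover have "(\<lambda>j. F (z + cvec (t j)) $ k) \<longlonglongrightarrow> G z $ k" by (intro tendsto_vec_nth t(2))
    ultimately show ?thesis using LIMSEQ_unique by blast
  qed
  \<comment> \<open>The bounds survive the limit because real translations leave \<open>imv\<close>,
    and with it the exponential factors, unchanged.\<close>
  have lower: "\<exists>\<epsilon>>0. \<forall>z l. (\<forall>k. l k \<in> minimizers (L k) b) \<longrightarrow>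
        \<epsilon> \<le> (\<Sum>k\<in>UNIV. exp (imv z \<bullet> l k) * norm (\<Sum>l\<in>minimizers (L k) b. a k l * expo l z))"
    if dim: "dim (exponent_diffs (\<lambda>k. minimizers (L k) b)) < CARD('m)" for b
  proof -
    obtain \<epsilon> where \<epsilon>: "\<epsilon> > 0" "\<And>z l. (\<forall>k. l k \<in> minimizers (L k) b) \<Longrightarrow>
      \<epsilon> \<le> (\<Sum>k\<in>UNIV. exp (imv z \<bullet> l k) * norm (\<Sum>l\<in>minimizers (L k) b. exp_coeff (?f k) l * expo l z))"
      using face_lower_bound[OF assms(2,3), of b] dim unfolding L_def by blast
    have "\<epsilon> \<le> (\<Sum>k\<in>UNIV. exp (imv z \<bullet> l k) * norm (\<Sum>l\<in>minimizers (L k) b. a k l * expo l z))"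
      if l: "\<forall>k. l k \<in> minimizers (L k) b" for z l
    proof (rule LIMSEQ_le_const)
      show "(\<lambda>j. \<Sum>k\<in>UNIV. exp (imv (z + cvec (t j)) \<bullet> l k) *
          norm (\<Sum>l\<in>minimizers (L k) b. exp_coeff (?f k) l * expo l (z + cvec (t j))))
        \<longlonglongrightarrow> (\<Sum>k\<in>UNIV. exp (imv z \<bullet> l k) * norm (\<Sum>l\<in>minimizers (L k) b. a k l * expo l z))"
        unfolding imv_cvec by (intro tendsto_intros lim) (auto simp: minimizers_def)
    qed (use \<epsilon>(2)[OF l] in blast)
    then show ?thesis using \<epsilon>(1) by blast
  qed
  define H where "H = range (\<lambda>k z. G z $ k)"
  have finH: "finite H" by (simp add: H_def)
  have cardH: "card H \<le> CARD('m)" unfolding H_def by (rule card_image_le) simp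
  have "G \<in> HAP" using G unfolding in_closure_of_tube_topology by blast
  then have Gholo: "holo_on G UNIV" by (simp add: HAP_def)
  have holH: "hol UNIV h" if "h \<in> H" for h
    using that by (auto simp: H_def intro: holo_on_hol_component[OF Gholo])
  have V: "zero_set G = common_zeros UNIV H"
    by (auto simp: zero_set_def common_zeros_def H_def vec_eq_iff)
  have upper: "d \<le> CARD('n) - CARD('m)" if reg: "regular_point (zero_set G) d p" for d p
  proof (rule ccontr)
    assume neg: "\<not> ?thesis"
    \<comment> \<open>Complements are taken for all exponent systems of dimension at least m, faces
      or not, since finitely many occur. Each has dimension at most n - m, so that many real
      functionals separate them all.\<close>
    let ?T = "\<lambda>S :: 'm \<Rightarrow> (real ^ 'n) set. {x. \<forall>v\<in>span (exponent_diffs S). orthogonal v x}"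
    let ?SS = "{S :: 'm \<Rightarrow> (real ^ 'n) set. (\<forall>k. S k \<subseteq> L k) \<and> CARD('m) \<le> dim (exponent_diffs S)}"
    have "finite (?T ` ?SS)"
    proof (rule finite_imageI)
      have "?SS \<subseteq> PiE UNIV (\<lambda>k. Pow (L k))" by auto
      moreover have "finite (PiE UNIV (\<lambda>k. Pow (L k)))" by (intro finite_PiE) (auto simp: L)
      ultimately show "finite ?SS" using finite_subset by blast
    qed
    moreover have "subspace T \<and> dim T \<le> CARD('n) - CARD('m)" if T: "T \<in> ?T ` ?SS" for T
    proof -
      obtain S :: "'m \<Rightarrow> (real ^ 'n) set" where S: "CARD('m) \<le> dim (exponent_diffs S)" "T = ?T S" using T by blast
      have "subspace T" unfolding S(2) subspace_def orthogonal_def by (simp add: inner_add_right)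
      moreover have "dim T + dim (exponent_diffs S) = CARD('n)"
        using dim_subspace_orthogonal_to_vectors[of "span (exponent_diffs S)" UNIV] S(2) by simp
      ultimately show ?thesis using S(1) by simp
    qed
    ultimately have "\<exists>E. finite E \<and> card E \<le> CARD('n) - CARD('m) \<and>
        (\<forall>T\<in>?T ` ?SS. \<forall>x\<in>T. (\<forall>e\<in>E. x \<bullet> e = 0) \<longrightarrow> x = 0)"
      by (rule exists_separating_set)
    then obtain E where E: "finite E" "card E \<le> CARD('n) - CARD('m)"
      and sepT: "\<forall>T\<in>?T ` ?SS. \<forall>x\<in>T. (\<forall>e\<in>E. x \<bullet> e = 0) \<longrightarrow> x = 0" by (elim exE conjE)
    have sep: "x = 0" if "\<And>k. S k \<subseteq> L k" "CARD('m) \<le> dim (exponent_diffs S)"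
      "\<forall>v\<in>exponent_diffs S. x \<bullet> v = 0" "\<forall>e\<in>E. x \<bullet> e = 0" for S :: "'m \<Rightarrow> (real ^ 'n) set" and x
    proof -
      have "orthogonal v x" if "v \<in> span (exponent_diffs S)" for v
        using that
      proof (induction rule: span_induct)
        case base
        show ?case by (simp add: subspace_def orthogonal_def inner_add_left)
      next
        case (step v)
        then show ?case using \<open>\<forall>v\<in>exponent_diffs S. x \<bullet> v = 0\<close> by (simp add: orthogonal_def inner_commute)
      qed
      then have "x \<in> ?T S" by simp
      moreover have "?T S \<in> ?T ` ?SS" using that(1,2) by blast
      ultimately show ?thesis using sepT that(4) by blast
    qed
    have "\<exists>R. \<forall>z. (\<forall>k. (\<Sum>l\<in>L k. a k l * expo l z) = 0) \<longrightarrow> (\<forall>e\<in>E. imv z \<bullet> e = imv p \<bullet> e) \<longrightarrow> norm (imv z) \<le> R"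
    proof (rule bounded_imaginary_parts_of_zeros[OF L E(1) lower])
      fix S :: "'m \<Rightarrow> (real ^ 'n) set" and x
      assume "\<And>k. S k \<subseteq> L k" "CARD('m) \<le> dim (exponent_diffs S)" "\<forall>v\<in>exponent_diffs S. x \<bullet> v = 0" "\<forall>e\<in>E. x \<bullet> e = 0"
      then show "x = 0" by (rule sep)
    qed
    then obtain R where R: "\<And>z. \<forall>k. (\<Sum>l\<in>L k. a k l * expo l z) = 0 \<Longrightarrow> \<forall>e\<in>E. imv z \<bullet> e = imv p \<bullet> e \<Longrightarrow> norm (imv z) \<le> R"
      by blast
    \<comment> \<open>Equations of the complexified affine subspace through \<open>p\<close>; their
      imaginary parts fix \<open>imv z \<bullet> e\<close>.\<close>
    let ?E = "(\<lambda>e z. hprod (z - p) (cvec e)) ` E"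
    have hE: "hol UNIV h" if "h \<in> ?E" for h using that by (auto intro: hol_hprod)
    have "\<not> p islimpt common_zeros UNIV (H \<union> ?E)"
    proof (rule derived_set_empty_if_bounded_imaginary_part)
      show "finite (H \<union> ?E)" using finH E(1) by simp
      show "hol UNIV h" if "h \<in> H \<union> ?E" for h using that holH hE by blast
      fix z assume z: "z \<in> common_zeros UNIV (H \<union> ?E)"
      have "imv z \<bullet> e = imv p \<bullet> e" if "e \<in> E" for e
      proof -
        have "hprod (z - p) (cvec e) = 0"
          using common_zerosD[OF z, of "\<lambda>z. hprod (z - p) (cvec e)"] that by simp
        moreover have "Im (hprod (z - p) (cvec e)) = imv z \<bullet> e - imv p \<bullet> e"
          by (simp add: hprod_def cvec_def imv_def inner_vec_def sum_subtractf left_diff_distrib)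
        ultimately show ?thesis by simp
      qed
      moreover have "(\<Sum>l\<in>L k. a k l * expo l z) = 0" for k
        using common_zerosD[OF z, of "\<lambda>z. G z $ k"] by (simp add: H_def G_eq[symmetric])
      ultimately show "norm (imv z) \<le> R" using R by blast
    qed
    moreover have "p islimpt common_zeros UNIV (H \<union> ?E)"
    proof -
      obtain U W \<phi> \<psi> and J :: "'n set" where p: "p \<in> zero_set G" "p \<in> U" and c: "chart U W \<phi> \<psi>" and J: "card J = d"
        and slice: "\<phi> ` (zero_set G \<inter> U) = {w \<in> W. \<forall>j. j \<notin> J \<longrightarrow> w $ j = 0}"
        by (rule regular_point_chart[OF reg])
      have W: "open W" and hom: "homeomorphism U W \<phi> \<psi>" and hpsi: "holo_on \<psi> W"
        using c by (auto simp: chart_def)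
      \<comment> \<open>In the chart, the n - d coordinates outside \<open>J\<close> replace the m
        components of \<open>G\<close>. Together with at most n - m slice equations they number
        fewer than n, because d > n - m.\<close>
      let ?A = "(\<lambda>j (w :: complex ^ 'n). w $ j) ` (- J)" and ?B = "(\<lambda>h w. h (\<psi> w)) ` ?E"
      have mem: "\<phi> p \<in> {w \<in> W. \<forall>j. j \<notin> J \<longrightarrow> w $ j = 0}" using p unfolding slice[symmetric] by blast
      have "\<phi> p islimpt common_zeros W (?A \<union> ?B)"
      proof (rule islimpt_common_zeros)
        show "finite (?A \<union> ?B)" using E(1) by simp
        have "card (?A \<union> ?B) \<le> card ?A + card ?B" by (rule card_Un_le)
        also have "\<dots> \<le> card (- J) + card E"
          using E(1) card_image_le[of E "\<lambda>e z. hprod (z - p) (cvec e)"] card_image_le[of ?E "\<lambda>h w. h (\<psi> w)"]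
            card_image_le[of "- J" "\<lambda>j (w :: complex ^ 'n). w $ j"] by simp
        also have "card (- J) = CARD('n) - d" using J card_Diff_subset[of J UNIV] by (simp add: Compl_eq_Diff_UNIV)
        also have "CARD('n) - d + card E < CARD('n)"
        proof -
          have "d \<le> CARD('n)" using J card_mono[of UNIV J] by simp
          then show ?thesis using E(2) neg by linarith
        qed
        finally show "card (?A \<union> ?B) < CARD('n)" .
        show "hol W h" if "h \<in> ?A \<union> ?B" for h
          using that
        proof
          assume "h \<in> ?B"
          then obtain g where g: "g \<in> ?E" "h = (\<lambda>w. g (\<psi> w))" by blast
          show ?thesis unfolding g(2) by (rule hol_compose[OF open_UNIV hE[OF g(1)] hpsi]) simp
        qed (auto intro: hol_component)
        have "\<psi> (\<phi> p) = p" using hom p by (simp add: homeomorphism_def)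
        then show "\<phi> p \<in> common_zeros W (?A \<union> ?B)"
          using mem by (auto simp: common_zeros_def hprod_def)
      qed (rule W)
      then show ?thesis
      proof (rule chart_slice_islimpt[OF c p(2)])
        show "common_zeros W (?A \<union> ?B) \<subseteq> W" by (auto simp: common_zeros_def)
        fix w assume w: "w \<in> common_zeros W (?A \<union> ?B)"
        have "w $ j = 0" if "j \<notin> J" for j
          using common_zerosD[OF w, of "\<lambda>w. w $ j"] that by simp
        moreover have "w \<in> W" using w by (simp add: common_zeros_def)
        ultimately have "w \<in> {w \<in> W. \<forall>j. j \<notin> J \<longrightarrow> w $ j = 0}" by blast
        then obtain x where x: "x \<in> zero_set G \<inter> U" "w = \<phi> x" unfolding slice[symmetric] by blast
        then have "\<psi> w = x" using hom by (simp add: homeomorphism_def)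
        then have "\<psi> w \<in> common_zeros UNIV H" using x V by blast
        moreover have "h (\<psi> w) = 0" if "h \<in> ?E" for h
          using common_zerosD[OF w UnI2[OF imageI[OF that, of "\<lambda>h w. h (\<psi> w)"]]] .
        ultimately show "\<psi> w \<in> common_zeros UNIV (H \<union> ?E)" unfolding common_zeros_def by blast
      qed
    qed
    ultimately show False by blast
  qed
  have dims: "d = CARD('n) - CARD('m)" if "regular_point (zero_set G) d p" for d p
    using upper[OF that] regular_point_dim_ge[OF finH holH that[unfolded V]] cardH by linarith
  have "zero_set G = {z. \<forall>h\<in>H. h z = 0}" using V by (simp add: common_zeros_def)
  \<comment> \<open>A regular point has to exist for the maximum in \<open>analytic_dim\<close> to
    be taken over a nonempty set.\<close>
  from nonempty_common_zero_set_regular_point[OF holH this ne]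
  obtain d p where "regular_point (zero_set G) d p" by blast
  then have "{d. \<exists>p. regular_point (zero_set G) d p} = {CARD('n) - CARD('m)}"
    using dims by blast
  then show ?thesis
    using assms(1) by (simp add: analytic_codim_def analytic_dim_def)
qed

theorem corollary6p1:
  fixes F :: "complex ^ 'n \<Rightarrow> complex ^ 'm"
  assumes "CARD('m) \<le> CARD('n)"
    and "F \<in> Exp_maps"
    and "kazarnovskii_regular F"
  shows "regular_map F"
  unfolding regular_map_def using zero_set_codim_of_closure[OF assms] by blast

end
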